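(* Let $\mathbb{P}$ be a nonempty finite set of primes, and let $\bar{\mathbb{P}}=\prod_{p\in\mathbb{P}}p$. Let $\tau\in\mathbb{C}$ with $\mathrm{Re}(\tau)>0$, let $\alpha\in\mathbb{C}\setminus\{0\}$, and let $s\in\mathbb{C}$ with $\mathrm{Re}(s)>\max\{0,\mathrm{Re}(\alpha)\}$ and $s\neq 1,\,1+\alpha$. Then $$ \begin{aligned} \zeta(s)\zeta(s-\alpha)&\prod_{p\in\mathbb{P}}\left(1-\frac{1}{p^s}\right)\left(1-\frac{1}{p^{s-\alpha}}\right) =1+\frac{\pi^{s-\alpha/2}\tau^{s/2}}{\Gamma\left(\frac{s}{2}\right)\Gamma\left(\frac{s-\alpha}{2}\right)}\Bigg(\frac{\tau^{-1/2}}{s-1}\mathcal{R}_{1-\alpha}+\frac{\tau^{-(1+\alpha)/2}}{s-1-\alpha}\mathcal{R}_{1+\alpha}\\ &+2\tau^{-\alpha/4}\int_{1}^{\infty}t^{-\alpha/4+s/2-1}\Bigg(\sum_{\substack{n\ge 2\\(n,\bar{\mathbb{P}})=1}}\frac{\sigma_\alpha(n)}{n^{\alpha/2}}K_{\alpha/2}\left(2n\pi\sqrt{\tau t}\right)\\ &\qquad+\frac{t^{\alpha/2}}{t^s}\Bigg(\sum_{\substack{n\ge 2\\(n,\bar{\mathbb{P}})=1}}\frac{\sigma_\alpha(n)}{n^{\alpha/2}}K_{\alpha/2}\left(2n\pi\sqrt{\frac{\tau}{t}}\right)-\sqrt{\frac{t}{\tau}}\left(\mathcal{F}_\alpha(t)+\mathcal{F}_{-\alpha}(t)\right)\Bigg)\Bigg)dt\Bigg),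 \end{aligned} $$ where $$ \mathcal{R}_\beta=\pi^{-\beta/2}\,\Gamma\left(\frac{\beta}{2}\right)\zeta(\beta)\prod_{p\in\mathbb{P}}\left(1-\frac1p\right)\left(1-\frac{1}{p^{\beta}}\right) $$ and $$ \mathcal{F}_{\beta}(t)=\frac14\,\Gamma\left(\frac{\beta}{2}\right)\zeta(\beta)\left(\frac1\pi\sqrt{\frac{\tau}{t}}\right)^{\beta/2}\prod_{p\in\mathbb{P}}\left(1-\frac1p\right)\left(1-\frac{1}{p^{1-\beta}}\right). $$
   Context: $\zeta$ is the (analytically continued) Riemann zeta function, $\Gamma$ the gamma function, $\sigma_\alpha(n)=\sum_{d\mid n}d^\alpha$ the generalized divisor function, and $K_\nu(z)$ the modified Bessel function of the second kind of order $\nu$. $(n,m)$ denotes the greatest common divisor. Complex powers and square roots of $\tau$ (with $\mathrm{Re}(\tau)>0$) are principal branches. For those values of $\alpha\ne 0$ at which a factor in $\mathcal{R}_{1\pm\alpha}$ or $\mathcal{F}_{\pm\alpha}(t)$ has a pole (cancelled by a zero of another factor), the expression is understood as its limit in $\beta$ (removable singularity). *)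

theory Defs
  imports "HOL-Complex_Analysis.Complex_Analysis" "HOL-Computational_Algebra.Primes"
begin

(* The analytic continuation of the Dirichlet series to the punctured plane. It is unique off 1
   by the identity theorem; the value at the pole 1 is unspecified. *)
definition zeta :: "complex \<Rightarrow> complex" where
  "zeta = (SOME f. f holomorphic_on - {1} \<and>
             (\<forall>s. Re s > 1 \<longrightarrow> (\<lambda>n. of_nat (Suc n) powr (- s)) sums f s))"

definition divisor_sigma :: "complex \<Rightarrow> nat \<Rightarrow> complex" where
  "divisor_sigma \<alpha> n = (\<Sum>d | d dvd n. of_nat d powr \<alpha>)"

(* rGamma is the entire function 1 / Gamma, so terms at poles of Gamma vanish. *)
definition bessel_I :: "complex \<Rightarrow> complex \<Rightarrow> complex" where
  "bessel_I \<nu> z = (\<Sum>k. (z / 2) powr (\<nu> + 2 * of_nat k) * rGamma (\<nu> + of_nat k + 1) / fact k)"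

definition bessel_K :: "complex \<Rightarrow> complex \<Rightarrow> complex" where
  "bessel_K \<nu> z =
     (let K = (\<lambda>\<mu>. of_real pi / 2 * (bessel_I (- \<mu>) z - bessel_I \<mu> z) / sin (\<mu> * of_real pi))
      in if \<nu> \<in> \<int> then Lim (at \<nu>) K else K \<nu>)"

(* The sum over all n \<ge> 2 prime to the product of P; the Bessel argument is 2 pi n w. *)
definition sigma_bessel_term :: "complex \<Rightarrow> complex \<Rightarrow> nat \<Rightarrow> complex" where
  "sigma_bessel_term \<alpha> w n =
     divisor_sigma \<alpha> n / of_nat n powr (\<alpha> / 2) * bessel_K (\<alpha> / 2) (2 * of_nat n * of_real pi * w)"

definition coprime_indices :: "nat set \<Rightarrow> nat set" where
  "coprime_indices P = {n. 2 \<le> n \<and> coprime n (\<Prod>P)}"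

definition sigma_bessel_sum :: "nat set \<Rightarrow> complex \<Rightarrow> complex \<Rightarrow> complex" where
  "sigma_bessel_sum P \<alpha> w = (\<Sum>\<^sub>\<infinity>n\<in>coprime_indices P. sigma_bessel_term \<alpha> w n)"

(* Expressions containing Gamma (b / 2) * zeta b are read as limits at those b where
   one of these two factors has a pole. *)
definition gamma_zeta_pole :: "complex \<Rightarrow> bool" where
  "gamma_zeta_pole b \<longleftrightarrow> b / 2 \<in> \<int>\<^sub>\<le>\<^sub>0 \<or> b = 1"

definition calR :: "nat set \<Rightarrow> complex \<Rightarrow> complex" where
  "calR P \<beta> =
     (let R = (\<lambda>b. of_real pi powr (- b / 2) * Gamma (b / 2) * zeta b *
                   (\<Prod>p\<in>P. (1 - 1 / of_nat p) * (1 - 1 / of_nat p powr b)))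
      in if gamma_zeta_pole \<beta> then Lim (at \<beta>) R else R \<beta>)"

definition calF :: "nat set \<Rightarrow> complex \<Rightarrow> complex \<Rightarrow> real \<Rightarrow> complex" where
  "calF P \<tau> \<beta> t =
     (let F = (\<lambda>b. 1 / 4 * Gamma (b / 2) * zeta b *
                   (1 / of_real pi * csqrt (\<tau> / of_real t)) powr (b / 2) *
                   (\<Prod>p\<in>P. (1 - 1 / of_nat p) * (1 - 1 / of_nat p powr (1 - b))))
      in if gamma_zeta_pole \<beta> then Lim (at \<beta>) F else F \<beta>)"

definition zeta_integrand :: "nat set \<Rightarrow> complex \<Rightarrow> complex \<Rightarrow> complex \<Rightarrow> real \<Rightarrow> complex" where
  "zeta_integrand P \<tau> \<alpha> s t =
     of_real t powr (- \<alpha> / 4 + s / 2 - 1) *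
       (sigma_bessel_sum P \<alpha> (csqrt (\<tau> * of_real t)) +
        of_real t powr (\<alpha> / 2) / of_real t powr s *
          (sigma_bessel_sum P \<alpha> (csqrt (\<tau> / of_real t)) -
           csqrt (of_real t / \<tau>) * (calF P \<tau> \<alpha> t + calF P \<tau> (- \<alpha>) t)))"

end

theory Submission
  imports Defs "HOL-Probability.Characteristic_Functions"
begin

text \<open>
  Put \<open>\<nu> = \<alpha> / 2\<close>, \<open>w = \<surd>\<tau>\<close> and \<open>t = e\<^sup>x\<close>. Through the integral \<open>2 K\<^sub>\<nu>(2 q) = \<integral> e\<^bsup>\<nu> y - q (e\<^sup>y + e\<^sup>-\<^sup>y)\<^esup> dy\<close> the full
  divisor-Bessel series (including \<open>n = 1\<close>) becomes, up to an exponential factor, the convolution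
  \<open>T(x) = \<integral> e\<^bsup>\<nu> y\<^esup> \<psi>(w e\<^sup>y) \<psi>(w e\<^bsup>x - y\<^esup>) dy\<close> of two theta series \<open>\<psi>(z) = \<Sum> e\<^bsup>- \<pi> n\<^sup>2 z\<^esup>\<close> over the \<open>n\<close> prime to all
  \<open>p \<in> P\<close>, and the Mellin transform of \<open>T\<close> is a product of two completed L-functions. By Poisson summation and
  sieving, \<open>\<psi>(z) - c z\<^bsup>-1/2\<^esup>\<close> decays rapidly at \<open>0\<close>; there is no constant term because \<open>P \<noteq> {}\<close>. Splitting both
  factors of the convolution accordingly shows that \<open>T\<close> minus an explicit combination of two exponentials decays rapidly
  at \<open>-\<infinity>\<close>. These two exponentials are the terms \<open>F\<^bsub>\<plusminus>\<alpha>\<^esub>\<close>, their Mellin transforms are the polar terms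
  \<open>R\<^bsub>1\<plusminus>\<alpha>\<^esub>\<close>, and subtracting them continues the Mellin identity to all \<open>s\<close>. The summand \<open>n = 1\<close> is a product of two Gamma
  integrals; it yields the leading \<open>1\<close> and accounts for the condition on \<open>Re s\<close>.
\<close>

section \<open>Parametric integrals, convolutions and exponential substitution\<close>

text \<open>The obstacle is that the functions in the formula are given by choices and limits:
  \<open>zeta\<close> is a chosen continuation, \<open>bessel_K\<close> is a limit at integral
  orders, \<open>calR\<close> and \<open>calF\<close> are limits at removable singularities. The
  device that tames them is \<open>completed_L\<close>. It is built from the theta series and not
  from \<open>zeta\<close>, and once a prime has been sieved its only singularity is a simple pole
  at 1. So one continuous expression in \<open>completed_L\<close> covers the generic and the
  exceptional parameters at once. Continuation alone does not suffice: the convolution produces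
  completed functions at 1 - \<beta>, whereas \<open>calF\<close> contains zeta at \<beta> with
  Euler factors at 1 - \<beta>. The functional equation of zeta reconciles the two. The condition
  \<alpha> \<noteq> 0 keeps the two exponentials apart; at \<alpha> = 0 they would merge and leave a
  term x e^(-x/2). Both theta factors carry the same w in the open right half-plane, so powers of w
  multiply without crossing the branch cut.\<close>

lemma norm_exp_minus_one_le:
  fixes z :: complex
  shows "norm (exp z - 1) \<le> norm z * exp (norm z)"
proof -
  have "norm (exp z - exp 0) \<le> exp (norm z) * norm (z - 0)"
  proof (rule field_differentiable_bound[of "cball 0 (norm z)" exp exp])
    fix w :: complex assume "w \<in> cball 0 (norm z)"
    then show "norm (exp w) \<le> exp (norm z)"
      using norm_exp[of w] by (smt (verit) dist_0_norm exp_le_cancel_iff mem_cball)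
  qed (auto intro!: derivative_eq_intros)
  then show ?thesis by (simp add: mult.commute)
qed

text \<open>The imaginary part of k contributes only a unimodular factor, so integrability at the
  real point \<open>Re k\<close> serves the whole vertical line.\<close>

lemma laplace_integrable:
  fixes L :: "'a \<Rightarrow> real" and h :: "'a \<Rightarrow> complex"
  assumes [measurable]: "L \<in> borel_measurable M"
    and int: "integrable M (\<lambda>x. exp (of_real (Re k * L x)) * h x)"
  shows "integrable M (\<lambda>x. exp (k * of_real (L x)) * h x)"
proof -
  have "integrable M (\<lambda>x. exp (\<i> * of_real (Im k * L x)) * (exp (of_real (Re k * L x)) * h x))"
  proof (rule Bochner_Integration.integrable_bound[OF int])
    show "(\<lambda>x. exp (\<i> * of_real (Im k * L x)) * (exp (of_real (Re k * L x)) * h x)) \<in> borel_measurable M"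
      by (intro borel_measurable_times borel_measurable_integrable[OF int]) measurable
    show "AE x in M. norm (exp (\<i> * of_real (Im k * L x)) * (exp (of_real (Re k * L x)) * h x))
        \<le> norm (exp (of_real (Re k * L x)) * h x)"
      by (intro AE_I2) (simp add: norm_mult)
  qed
  also have "(\<lambda>x. exp (\<i> * of_real (Im k * L x)) * (exp (of_real (Re k * L x)) * h x)) =
      (\<lambda>x. exp (k * of_real (L x)) * h x)"
  proof
    fix x
    have "k * of_real (L x) = \<i> * of_real (Im k * L x) + of_real (Re k * L x)"
      by (subst complex_eq[of k]) (simp add: algebra_simps)
    then show "exp (\<i> * of_real (Im k * L x)) * (exp (of_real (Re k * L x)) * h x) =
      exp (k * of_real (L x)) * h x" by (simp add: exp_add mult.assoc)
  qed
  finally show ?thesis .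
qed

text \<open>A counting measure \<^term>\<open>M\<close> is allowed, so that this also covers generalised Dirichlet series.\<close>

lemma laplace_holomorphic:
  fixes L :: "'a \<Rightarrow> real" and h :: "'a \<Rightarrow> complex"
  assumes [measurable]: "L \<in> borel_measurable M"
    and "open I"
    and int: "\<And>r. r \<in> I \<Longrightarrow> integrable M (\<lambda>x. exp (of_real (r * L x)) * h x)"
  shows "(\<lambda>k. \<integral>x. exp (k * of_real (L x)) * h x \<partial>M) holomorphic_on {k. Re k \<in> I}"
proof -
  define F where "F = (\<lambda>k. \<integral>x. exp (k * of_real (L x)) * h x \<partial>M)"
  have "F field_differentiable (at k)" if k: "Re k \<in> I" for k
  proof -
    define r where "r = Re k"
    obtain e where e: "e > 0" "ball r e \<subseteq> I"
      using \<open>open I\<close> k unfolding r_def open_contains_ball by blast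
    \<comment> \<open>One d absorbs the factor |L x| from the derivative and another the difference
      quotient, so r + 2d and r - 2d must stay inside the ball of radius e.\<close>
    define d where "d = e / 3"
    have d: "d > 0" using e by (simp add: d_def)
    have mem: "r \<in> I" "r + 2 * d \<in> I" "r - 2 * d \<in> I" "\<And>k'. k' \<in> ball k d \<Longrightarrow> Re k' \<in> I"
    proof -
      show "Re k' \<in> I" if "k' \<in> ball k d" for k'
      proof -
        have "\<bar>Re k - Re k'\<bar> \<le> dist k k'"
          by (metis abs_Re_le_cmod dist_norm minus_complex.sel(1))
        then show ?thesis using that e d by (intro subsetD[OF e(2)]) (auto simp: r_def d_def dist_real_def)
      qed
    qed (use e k in \<open>auto intro!: subsetD[OF e(2)] simp: d_def dist_real_def r_def\<close>)
    have intk: "integrable M (\<lambda>x. exp (k' * of_real (L x)) * h x)" if "Re k' \<in> I" for k'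
      using laplace_integrable[of L M k' h] int[OF that] by simp
    define D where "D = (\<integral>x. of_real (L x) * (exp (k * of_real (L x)) * h x) \<partial>M)"
    \<comment> \<open>Both exponentials occur because L may take either sign: their sum dominates
      e^(r L + 2d |L|).\<close>
    define w where "w = (\<lambda>x. 1 / d * (norm (exp (of_real ((r + 2 * d) * L x)) * h x)
        + norm (exp (of_real ((r - 2 * d) * L x)) * h x)))"
    have "(F has_field_derivative D) (at k within ball k d)"
      unfolding has_field_derivative_iff tendsto_at_iff_sequentially
    proof (intro allI impI)
      fix X assume X: "\<forall>i. X i \<in> ball k d - {k}" and lim: "X \<longlonglongrightarrow> k"
      define s where "s = (\<lambda>i x. (exp (X i * of_real (L x)) * h x - exp (k * of_real (L x)) * h x) / (X i - k))"
      have XI: "Re (X i) \<in> I" for i using X mem(4) by blast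
      have "(\<lambda>i. \<integral>x. s i x \<partial>M) \<longlonglongrightarrow> D"
        unfolding D_def
      proof (rule integral_dominated_convergence[where w = w])
        have m: "(\<lambda>x. exp (k' * of_real (L x)) * h x) \<in> borel_measurable M" if "Re k' \<in> I" for k'
          using intk[OF that] by auto
        show "(\<lambda>x. of_real (L x) * (exp (k * of_real (L x)) * h x)) \<in> borel_measurable M"
          by (intro borel_measurable_times m k) measurable
        show "s i \<in> borel_measurable M" for i
          unfolding s_def by (intro borel_measurable_divide borel_measurable_diff m XI k) auto
        show "integrable M w"
          unfolding w_def using int[OF mem(2)] int[OF mem(3)] by (intro integrable_mult_right Bochner_Integration.integrable_add integrable_norm)
        show "AE x in M. (\<lambda>i. s i x) \<longlonglongrightarrow> of_real (L x) * (exp (k * of_real (L x)) * h x)"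
        proof (intro AE_I2)
          fix x
          have "((\<lambda>z. exp (z * of_real (L x)) * h x) has_field_derivative
              of_real (L x) * (exp (k * of_real (L x)) * h x)) (at k within ball k d)"
            by (auto intro!: derivative_eq_intros)
          then show "(\<lambda>i. s i x) \<longlonglongrightarrow> of_real (L x) * (exp (k * of_real (L x)) * h x)"
            using X lim unfolding has_field_derivative_iff tendsto_at_iff_sequentially s_def comp_def by blast
        qed
        show "AE x in M. norm (s i x) \<le> w x" for i
        proof (intro AE_I2)
          fix x
          define z where "z = X i - k"
          have z: "z \<noteq> 0" "norm z < d" using X by (auto simp: z_def dist_norm norm_minus_commute)
          have "exp (X i * of_real (L x)) = exp (k * of_real (L x)) * exp (z * of_real (L x))"
            by (simp add: z_def algebra_simps flip: exp_add)
          then have "s i x = (exp (z * of_real (L x)) - 1) / z * (exp (k * of_real (L x)) * h x)"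
            by (simp add: s_def z_def[symmetric] algebra_simps diff_divide_distrib)
          then have "norm (s i x) = norm (exp (z * of_real (L x)) - 1) / norm z * (exp (r * L x) * norm (h x))"
            by (simp add: norm_mult norm_divide r_def)
          also have "\<dots> \<le> (norm (z * of_real (L x)) * exp (norm (z * of_real (L x)))) / norm z * (exp (r * L x) * norm (h x))"
            by (intro mult_right_mono divide_right_mono norm_exp_minus_one_le) auto
          also have "\<dots> = \<bar>L x\<bar> * exp (norm z * \<bar>L x\<bar>) * (exp (r * L x) * norm (h x))"
            using z by (simp add: norm_mult)
          also have "\<dots> \<le> (1 / d * exp (d * \<bar>L x\<bar>)) * exp (d * \<bar>L x\<bar>) * (exp (r * L x) * norm (h x))"
          proof (intro mult_right_mono mult_mono)
            have "d * \<bar>L x\<bar> \<le> exp (d * \<bar>L x\<bar>)" using exp_ge_add_one_self[of "d * \<bar>L x\<bar>"] by linarith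
            then show "\<bar>L x\<bar> \<le> 1 / d * exp (d * \<bar>L x\<bar>)" using d by (simp add: field_simps)
            show "exp (norm z * \<bar>L x\<bar>) \<le> exp (d * \<bar>L x\<bar>)" using z by (simp add: mult_right_mono)
          qed (use d in auto)
          also have "\<dots> = 1 / d * (exp (2 * d * \<bar>L x\<bar> + r * L x) * norm (h x))"
            by (simp add: mult_exp_exp algebra_simps flip: exp_add)
          also have "\<dots> \<le> 1 / d * ((exp ((r + 2 * d) * L x) + exp ((r - 2 * d) * L x)) * norm (h x))"
          proof (intro mult_left_mono mult_right_mono)
            show "exp (2 * d * \<bar>L x\<bar> + r * L x) \<le> exp ((r + 2 * d) * L x) + exp ((r - 2 * d) * L x)"
              by (cases "L x \<ge> 0") (auto simp: algebra_simps add_increasing add_increasing2)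
          qed (use d in auto)
          also have "\<dots> = w x" by (simp add: w_def norm_mult algebra_simps)
          finally show "norm (s i x) \<le> w x" .
        qed
      qed
      moreover have "(\<integral>x. s i x \<partial>M) = (F (X i) - F k) / (X i - k)" for i
        unfolding s_def F_def using intk[OF XI] intk[OF k] by (simp add: Bochner_Integration.integral_diff)
      ultimately show "((\<lambda>y. (F y - F k) / (y - k)) \<circ> X) \<longlonglongrightarrow> D" by (simp add: comp_def)
    qed
    then have "(F has_field_derivative D) (at k)"
      using d at_within_open[of k "ball k d"] by simp
    then show ?thesis unfolding field_differentiable_def by blast
  qed
  then have "F holomorphic_on {k. Re k \<in> I}"
    by (metis (mono_tags, lifting) field_differentiable_at_within holomorphic_on_def mem_Collect_eq)
  then show ?thesis by (simp only: F_def)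
qed

text \<open>Counting measure on a countable set is sigma-finite, so this exchange is Fubini's
  theorem on its product with \<open>M\<close>.\<close>

lemma has_sum_integral:
  fixes f :: "'i \<Rightarrow> 'a \<Rightarrow> complex"
  assumes "countable A" "sigma_finite_measure M"
    and int: "\<And>a. a \<in> A \<Longrightarrow> integrable M (f a)"
    and norms: "(\<lambda>a. \<integral>x. norm (f a x) \<partial>M) summable_on A"
    and F: "\<And>x. x \<in> space M \<Longrightarrow> ((\<lambda>a. f a x) has_sum F x) A"
  shows "integrable M F" "((\<lambda>a. \<integral>x. f a x \<partial>M) has_sum (\<integral>x. F x \<partial>M)) A"
proof -
  let ?C = "count_space A"
  interpret M: sigma_finite_measure M by fact
  interpret C: sigma_finite_measure ?C using \<open>countable A\<close> by (rule sigma_finite_measure_count_space_countable)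
  interpret P: pair_sigma_finite ?C M ..
  have [measurable]: "(\<lambda>(a, x). f a x) \<in> borel_measurable (?C \<Otimes>\<^sub>M M)"
    by (rule measurable_pair_measure_countable1[OF \<open>countable A\<close>]) (use int in auto)
  have "Infinite_Set_Sum.abs_summable_on (\<lambda>a. \<integral>x. norm (f a x) \<partial>M) A"
    using norms by (subst abs_summable_equivalent[symmetric]) simp
  then have "integrable (?C \<Otimes>\<^sub>M M) (\<lambda>(a, x). f a x)"
    using int by (intro P.Fubini_integrable) (auto simp: abs_summable_on_def)
  note I = this
  have Feq: "(\<integral>a. f a x \<partial>?C) = F x" if "x \<in> space M" for x
  proof -
    have "(\<lambda>a. norm (f a x)) summable_on A"
      using F[OF that] by (metis has_sum_imp_summable summable_on_iff_abs_summable_on_complex)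
    then show ?thesis
      using F[OF that] by (metis abs_summable_equivalent infsetsum_def infsetsum_infsum infsumI)
  qed
  have "integrable M (\<lambda>x. \<integral>a. f a x \<partial>?C)" using P.integrable_snd[OF I] by simp
  then show "integrable M F" using Feq by (simp cong: Bochner_Integration.integrable_cong)
  have "integrable ?C (\<lambda>a. \<integral>x. f a x \<partial>M)" using P.integrable_fst[OF I] by simp
  then have s: "Infinite_Set_Sum.abs_summable_on (\<lambda>a. \<integral>x. f a x \<partial>M) A" by (simp add: abs_summable_on_def)
  have "infsum (\<lambda>a. \<integral>x. f a x \<partial>M) A = (\<integral>a. \<integral>x. f a x \<partial>M \<partial>?C)"
    using infsetsum_infsum[OF s] by (simp add: infsetsum_def)
  also have "\<dots> = (\<integral>x. \<integral>a. f a x \<partial>?C \<partial>M)" using P.Fubini_integral[OF I] by simp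
  also have "\<dots> = (\<integral>x. F x \<partial>M)" using Feq by (simp cong: Bochner_Integration.integral_cong)
  finally show "((\<lambda>a. \<integral>x. f a x \<partial>M) has_sum (\<integral>x. F x \<partial>M)) A"
    using s by (metis abs_summable_equivalent abs_summable_summable has_sum_infsum)
qed

text \<open>Fubini and translation invariance. In the variable x = ln t this is the multiplicativity
  of the Mellin transform under convolution.\<close>

lemma integral_convolution:
  fixes f g :: "real \<Rightarrow> complex"
  assumes f: "integrable lborel f" and g: "integrable lborel g"
  shows "integrable lborel (\<lambda>x. \<integral>y. f y * g (x - y) \<partial>lborel)"
    and "(\<integral>x. (\<integral>y. f y * g (x - y) \<partial>lborel) \<partial>lborel) = (\<integral>x. f x \<partial>lborel) * (\<integral>x. g x \<partial>lborel)"
proof -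
  have [measurable]: "f \<in> borel_measurable borel" "g \<in> borel_measurable borel" using f g by auto
  have gs: "integrable lborel (\<lambda>x. g (x - y))" "(\<integral>x. g (x - y) \<partial>lborel) = (\<integral>x. g x \<partial>lborel)"
    "(\<integral>x. norm (g (x - y)) \<partial>lborel) = (\<integral>x. norm (g x) \<partial>lborel)" for y
    using lborel_integrable_real_affine[OF g, of 1 "-y"] lborel_integral_real_affine[of 1 g "-y"]
      lborel_integral_real_affine[of 1 "\<lambda>x. norm (g x)" "-y"] by simp_all
  have I: "integrable (lborel \<Otimes>\<^sub>M lborel) (\<lambda>(y, x). f y * g (x - y))"
    using f gs by (intro lborel_pair.Fubini_integrable) (auto simp: norm_mult)
  show "integrable lborel (\<lambda>x. \<integral>y. f y * g (x - y) \<partial>lborel)" using lborel_pair.integrable_snd[OF I] by simp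
  have "(\<integral>x. (\<integral>y. f y * g (x - y) \<partial>lborel) \<partial>lborel) = (\<integral>y. (\<integral>x. f y * g (x - y) \<partial>lborel) \<partial>lborel)"
    using lborel_pair.Fubini_integral[OF I] by simp
  also have "\<dots> = (\<integral>x. f x \<partial>lborel) * (\<integral>x. g x \<partial>lborel)" by (simp add: gs)
  finally show "(\<integral>x. (\<integral>y. f y * g (x - y) \<partial>lborel) \<partial>lborel) = (\<integral>x. f x \<partial>lborel) * (\<integral>x. g x \<partial>lborel)" .
qed

section \<open>The substitution t = e^x\<close>

lemma exp_image_eq: "exp ` S = {t. t > 0 \<and> ln t \<in> S}" for S :: "real set"
  by (force intro: image_eqI[of _ exp "ln _"])

lemma set_integral_exp_subst_real:
  fixes f :: "real \<Rightarrow> real"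
  assumes f[measurable]: "f \<in> borel_measurable borel" and S[measurable]: "S \<in> sets borel"
  shows "set_integrable lborel (exp ` S) f \<longleftrightarrow> set_integrable lborel S (\<lambda>x. exp x * f (exp x))"
    and "set_integrable lborel S (\<lambda>x. exp x * f (exp x)) \<Longrightarrow>
       (LBINT t:exp ` S. f t) = (LBINT x:S. exp x * f (exp x))"
proof -
  have S'[measurable]: "exp ` S \<in> sets borel" unfolding exp_image_eq by measurable
  \<comment> \<open>The change of variables theorem speaks of completed Lebesgue measure; Borel
    measurability of the integrand and of the set allows the return to
    \<open>lborel\<close>.\<close>
  have conv: "set_integrable lebesgue T h \<longleftrightarrow> set_integrable lborel T h"
    if "h \<in> borel_measurable borel" "T \<in> sets borel" for h :: "real \<Rightarrow> real" and T
    using that unfolding set_integrable_def by (intro integrable_completion) simp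
  have eq: "integral T h = (LBINT x:T. h x)" if "set_integrable lborel T h" for h :: "real \<Rightarrow> real" and T
    using that by (rule set_borel_integral_eq_integral(2)[symmetric])
  have cv: "((\<lambda>x. \<bar>exp x\<bar> * f (exp x)) absolutely_integrable_on S \<and>
           integral S (\<lambda>x. \<bar>exp x\<bar> * f (exp x)) = b)
     \<longleftrightarrow> (f absolutely_integrable_on (exp ` S) \<and> integral (exp ` S) f = b)" for b
    by (rule has_absolute_integral_change_of_variables_1')
      (auto intro!: derivative_eq_intros borel_measurable_subalgebra inj_onI simp: S sets_completionI_sets)
  show i: "set_integrable lborel (exp ` S) f \<longleftrightarrow> set_integrable lborel S (\<lambda>x. exp x * f (exp x))"
    using cv by (auto simp flip: conv)
  assume a: "set_integrable lborel S (\<lambda>x. exp x * f (exp x))"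
  then have b: "set_integrable lborel (exp ` S) f" using i by simp
  have "integral (exp ` S) f = integral S (\<lambda>x. exp x * f (exp x))"
    using cv[of "integral S (\<lambda>x. exp x * f (exp x))"] a by (auto simp flip: conv)
  then show "(LBINT t:exp ` S. f t) = (LBINT x:S. exp x * f (exp x))"
    using eq[OF a] eq[OF b] by simp
qed

lemma set_integrable_complex_iff:
  fixes f :: "real \<Rightarrow> complex"
  shows "set_integrable M S f \<longleftrightarrow> set_integrable M S (\<lambda>x. Re (f x)) \<and> set_integrable M S (\<lambda>x. Im (f x))"
proof
  assume "set_integrable M S f"
  then show "set_integrable M S (\<lambda>x. Re (f x)) \<and> set_integrable M S (\<lambda>x. Im (f x))"
    unfolding set_integrable_def by (auto dest: integrable_Re integrable_Im)
next
  assume "set_integrable M S (\<lambda>x. Re (f x)) \<and> set_integrable M S (\<lambda>x. Im (f x))"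
  then have "integrable M (\<lambda>x. complex_of_real (indicat_real S x *\<^sub>R Re (f x)) + \<i> * of_real (indicat_real S x *\<^sub>R Im (f x)))"
    unfolding set_integrable_def by (intro Bochner_Integration.integrable_add integrable_mult_right integrable_of_real) auto
  also have "(\<lambda>x. complex_of_real (indicat_real S x *\<^sub>R Re (f x)) + \<i> * of_real (indicat_real S x *\<^sub>R Im (f x))) =
      (\<lambda>x. indicat_real S x *\<^sub>R f x)"
    by (auto simp: fun_eq_iff complex_eq_iff)
  finally show "set_integrable M S f" unfolding set_integrable_def .
qed

lemma set_integral_exp_subst:
  fixes f :: "real \<Rightarrow> complex"
  assumes f[measurable]: "f \<in> borel_measurable borel" and S[measurable]: "S \<in> sets borel"
  shows "set_integrable lborel (exp ` S) f \<longleftrightarrow> set_integrable lborel S (\<lambda>x. of_real (exp x) * f (exp x))"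
    and "set_integrable lborel S (\<lambda>x. of_real (exp x) * f (exp x)) \<Longrightarrow>
       (LBINT t:exp ` S. f t) = (LBINT x:S. of_real (exp x) * f (exp x))"
proof -
  have R: "(\<lambda>t. Re (f t)) \<in> borel_measurable borel" "(\<lambda>t. Im (f t)) \<in> borel_measurable borel" by measurable
  show i: "set_integrable lborel (exp ` S) f \<longleftrightarrow> set_integrable lborel S (\<lambda>x. of_real (exp x) * f (exp x))"
    by (simp add: set_integrable_complex_iff set_integral_exp_subst_real(1)[OF R(1) S] set_integral_exp_subst_real(1)[OF R(2) S] del: of_real_exp)
  assume a: "set_integrable lborel S (\<lambda>x. of_real (exp x) * f (exp x))"
  then have b: "set_integrable lborel (exp ` S) f" using i by simp
  have *: "Re (LBINT x:T. h x) = (LBINT x:T. Re (h x))" "Im (LBINT x:T. h x) = (LBINT x:T. Im (h x))"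
    if "set_integrable lborel T h" for T and h :: "real \<Rightarrow> complex"
    using that unfolding set_integrable_def set_lebesgue_integral_def
    by (auto simp flip: integral_Re integral_Im)
  show "(LBINT t:exp ` S. f t) = (LBINT x:S. of_real (exp x) * f (exp x))"
    using a set_integral_exp_subst_real(2)[OF R(1) S] set_integral_exp_subst_real(2)[OF R(2) S]
    by (intro complex_eqI) (simp_all add: *[OF a] *[OF b] set_integrable_complex_iff del: of_real_exp)
qed

text \<open>The source of all polar terms: an exponential that is split off on the negative
  half-line reappears as 1 / c in the transform.\<close>

lemma exp_half_line:
  assumes c: "Re c > 0"
  shows "set_integrable lborel {..<0::real} (\<lambda>x. exp (c * of_real x))"
    and "(LBINT x:{..<0}. exp (c * of_real x)) = 1 / c"
proof -
  have i0: "set_integrable lborel {..<0} (\<lambda>x. exp (r * x))" if r: "r > 0" for r :: real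
  proof -
    have "((\<lambda>x. exp (- r * x)) has_integral exp (- r * 0) / r) {0..}"
      using has_integral_exp_minus_to_infinity[OF r, of 0] by simp
    then have "(\<lambda>x. exp (- r * x)) absolutely_integrable_on {0..}"
      by (intro nonnegative_absolutely_integrable_1) (auto simp: has_integral_iff)
    then have "set_integrable lborel {0..} (\<lambda>x. exp (- r * x))"
      unfolding set_integrable_def by (subst (asm) integrable_completion) measurable
    then have "integrable lborel (\<lambda>x. indicat_real {0..} (0 + (-1) * x) *\<^sub>R exp (- r * (0 + (-1) * x)))"
      unfolding set_integrable_def by (rule lborel_integrable_real_affine) auto
    then have "set_integrable lborel {..0} (\<lambda>x. exp (r * x))"
      unfolding set_integrable_def by (rule Bochner_Integration.integrable_cong[THEN iffD1, rotated -1])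
        (auto simp: indicator_def)
    then show ?thesis by (rule set_integrable_subset) auto
  qed
  show i: "set_integrable lborel {..<0::real} (\<lambda>x. exp (c * of_real x))"
    using i0[OF c] by (rule set_integrable_bound) (auto simp: set_borel_measurable_def)
  have e: "einterval (-\<infinity>) 0 = {..<0}" by (auto simp: einterval_def)
  have "(LBINT x=-\<infinity>..0. exp (c * of_real x)) = exp (c * of_real 0) / c - 0"
  proof (rule interval_integral_FTC_integrable)
    show "((\<lambda>x. exp (c * of_real x) / c) has_vector_derivative exp (c * of_real x)) (at x)" for x
    proof -
      have "((\<lambda>z. exp (c * z) / c) has_field_derivative exp (c * of_real x)) (at (of_real x))"
        using c by (auto intro!: derivative_eq_intros)
      then show ?thesis by (rule has_vector_derivative_real_field)
    qed
    show "set_integrable lborel (einterval (-\<infinity>) 0) (\<lambda>x. exp (c * of_real x))" using i e by simp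
    have "((\<lambda>x. exp (Re c * x)) \<longlongrightarrow> 0) at_bot"
      using c by real_asymp
    then have "((\<lambda>x. exp (c * of_real x)) \<longlongrightarrow> 0) (at_bot :: real filter)"
      by (subst tendsto_norm_zero_iff[symmetric]) simp
    then have "((\<lambda>x. exp (c * of_real x) / c) \<longlongrightarrow> 0 / c) (at_bot :: real filter)"
      by (intro tendsto_divide tendsto_const) (use c in auto)
    then show "(((\<lambda>x. exp (c * of_real x) / c) \<circ> real_of_ereal) \<longlongrightarrow> 0) (at_right (-\<infinity>))"
      by (simp add: ereal_tendsto_simps)
    have "((\<lambda>x. exp (c * of_real x) / c) \<longlongrightarrow> exp (c * of_real 0) / c) (at_left (0::real))"
      using c by (intro tendsto_intros) auto
    then show "(((\<lambda>x. exp (c * of_real x) / c) \<circ> real_of_ereal) \<longlongrightarrow> exp (c * of_real 0) / c) (at_left 0)"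
      by (simp add: zero_ereal_def ereal_tendsto_simps)
  qed auto
  then show "(LBINT x:{..<0}. exp (c * of_real x)) = 1 / c"
    by (simp add: interval_lebesgue_integral_def e)
qed

section \<open>The Bessel function as an integral\<close>

lemma summable_on_Times_real:
  fixes f :: "'a \<Rightarrow> real" and g :: "'b \<Rightarrow> real"
  assumes "f summable_on A" "g summable_on B" "\<And>x. f x \<ge> 0" "\<And>y. g y \<ge> 0"
  shows "(\<lambda>(x, y). f x * g y) summable_on A \<times> B"
proof (rule summable_on_SigmaI)
  show "((\<lambda>y. case (x, y) of (x, y) \<Rightarrow> f x * g y) has_sum f x * infsum g B) B" for x
    using assms(2) by (simp add: has_sum_cmult_right)
  show "(\<lambda>x. f x * infsum g B) summable_on A" by (intro summable_on_cmult_left assms)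
qed (use assms in auto)

text \<open>Unconditional summability of complex numbers is absolute, so the double family is
  dominated by a product of summable families of norms.\<close>

lemma has_sum_Times_complex:
  fixes f :: "'a \<Rightarrow> complex" and g :: "'b \<Rightarrow> complex"
  assumes f: "(f has_sum a) A" and g: "(g has_sum b) B"
  shows "((\<lambda>(x, y). f x * g y) has_sum a * b) (A \<times> B)"
proof (rule has_sum_SigmaI)
  show "((\<lambda>y. case (x, y) of (x, y) \<Rightarrow> f x * g y) has_sum f x * b) B" for x
    using g by (simp add: has_sum_cmult_right)
  show "((\<lambda>x. f x * b) has_sum a * b) A" by (intro has_sum_cmult_left f)
  have "(\<lambda>(x, y). norm (f x) * norm (g y)) summable_on A \<times> B"
    using has_sum_imp_summable[OF f] has_sum_imp_summable[OF g]
    by (intro summable_on_Times_real) (simp_all add: summable_on_iff_abs_summable_on_complex)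
  then have "(\<lambda>p. norm (case p of (x, y) \<Rightarrow> f x * g y)) summable_on A \<times> B"
    by (simp add: case_prod_unfold norm_mult)
  then show "(\<lambda>(x, y). f x * g y) summable_on A \<times> B"
    by (simp add: summable_on_iff_abs_summable_on_complex)
qed

text \<open>The identity theorem, with 1 as a limit point of the positive reals. It transfers to
  complex arguments what a real translation or Poisson summation proves for positive ones.\<close>

lemma holomorphic_eq_right_half_plane:
  assumes "f holomorphic_on {z. Re z > 0}" "g holomorphic_on {z. Re z > 0}"
    and eq: "\<And>x::real. x > 0 \<Longrightarrow> f (of_real x) = g (of_real x)" and "Re z > 0"
  shows "f z = g z"
proof -
  have "f z - g z = 0"
  proof (rule analytic_continuation[of "\<lambda>z. f z - g z" "{z. Re z > 0}" "of_real ` {0<..}" 1])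
    show "(\<lambda>z. f z - g z) holomorphic_on {z. Re z > 0}" by (intro holomorphic_intros assms)
    show "connected {z::complex. Re z > 0}" by (intro convex_connected convex_halfspace_Re_gt)
    show "1 islimpt complex_of_real ` {0<..}"
      unfolding islimpt_sequential
    proof (intro exI conjI allI)
      show "of_real (1 + 1 / real (Suc n)) \<in> complex_of_real ` {0<..} - {1}" for n
      proof -
        have "1 + 1 / real (Suc n) \<noteq> 1" "1 + 1 / real (Suc n) \<in> {0<..}" by (auto simp: add_pos_pos)
        then show ?thesis by (metis Diff_iff imageI of_real_eq_1_iff singletonD)
      qed
      have "(\<lambda>n. 1 + 1 / real (Suc n)) \<longlonglongrightarrow> 1 + 0"
        by (intro tendsto_intros lim_1_over_n[THEN LIMSEQ_Suc])
      then show "(\<lambda>n. complex_of_real (1 + 1 / real (Suc n))) \<longlonglongrightarrow> 1"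
        by (metis add.right_neutral of_real_1 tendsto_of_real)
    qed
  qed (use assms open_halfspace_Re_gt in auto)
  then show ?thesis by simp
qed

lemma norm_exp_of_real_mult: "norm (exp (a * of_real x)) = exp (Re a * x)"
  by simp

lemma Gamma_integral_log:
  assumes a: "Re a > 0"
  shows "integrable lborel (\<lambda>x::real. exp (a * of_real x) * exp (- of_real (exp x)))" (is ?I)
    and "(\<integral>x. exp (a * of_real x) * exp (- of_real (exp x)) \<partial>lborel) = Gamma a" (is ?V)
proof -
  \<comment> \<open>Written with \<open>ln\<close>, the integrand of Euler's integral is visibly
    Borel measurable on the whole line; for positive t it agrees with the usual one.\<close>
  define f where "f = (\<lambda>t::real. exp ((a - 1) * of_real (ln t)) * exp (- of_real t) :: complex)"
  have eq: "f t = of_real t powr (a - 1) / of_real (exp t)" if "t \<in> {0<..}" for t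
    using that by (simp add: f_def powr_def exp_minus field_simps Ln_of_real exp_of_real)
  have [measurable]: "f \<in> borel_measurable borel" unfolding f_def by measurable
  have im: "exp ` UNIV = {0::real<..}" by (auto simp: exp_image_eq)
  have ai: "f absolutely_integrable_on {0<..}"
    using absolutely_integrable_Gamma_integral'[OF a] eq
    by (subst set_integrable_cong[OF refl]) auto
  then have si: "set_integrable lborel {0<..} f"
    unfolding set_integrable_def by (subst (asm) integrable_completion) simp_all
  have hi: "(f has_integral Gamma a) {0<..}"
    using Gamma_integral_complex'[OF a] eq by (subst has_integral_cong) auto
  then have v: "(LBINT t:{0<..}. f t) = Gamma a"
    using set_borel_integral_eq_integral(2)[OF si] by (simp add: has_integral_iff)
  have e: "of_real (exp x) * f (exp x) = exp (a * of_real x) * exp (- of_real (exp x))" for x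
  proof -
    have "exp (a * of_real x) = exp (of_real x) * exp ((a - 1) * of_real x)"
      by (simp add: mult_exp_exp algebra_simps)
    then show ?thesis by (simp add: f_def exp_of_real)
  qed
  note s = set_integral_exp_subst[of f UNIV, unfolded im e]
  show ?I using s(1) si by (simp add: set_integrable_def)
  then show ?V using s(2) v by (simp add: set_integrable_def set_lebesgue_integral_def)
qed

text \<open>The rotated Gamma integral: both sides are holomorphic in \<^term>\<open>z\<close> and agree for positive \<^term>\<open>z\<close>
  by translating the variable.\<close>

lemma Gamma_integral_rotated:
  assumes a: "Re a > 0" and z: "Re z > 0"
  shows "integrable lborel (\<lambda>x::real. exp (a * of_real x) * exp (- z * of_real (exp x)))" (is "?I z")
    and "(\<integral>x. exp (a * of_real x) * exp (- z * of_real (exp x)) \<partial>lborel) = Gamma a * z powr (- a)" (is "?V z")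
proof -
  have real: "integrable lborel (\<lambda>x::real. exp (a * of_real x) * exp (- of_real r * of_real (exp x)))"
    "(\<integral>x. exp (a * of_real x) * exp (- of_real r * of_real (exp x)) \<partial>lborel) = Gamma a * of_real r powr (- a)"
    if r: "r > 0" for r :: real
  proof -
    let ?g = "\<lambda>x::real. exp (a * of_real x) * exp (- of_real (exp x)) :: complex"
    have shift: "?g (ln r + 1 * x) = of_real r powr a * (exp (a * of_real x) * exp (- of_real r * of_real (exp x)))" for x
      using r by (simp add: powr_def exp_add algebra_simps Ln_of_real)
    have "integrable lborel (\<lambda>x. ?g (ln r + 1 * x))"
      by (rule lborel_integrable_real_affine[OF Gamma_integral_log(1)[OF a]]) auto
    moreover have nz: "of_real r powr a \<noteq> (0::complex)" using r by (simp add: powr_def)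
    ultimately show "integrable lborel (\<lambda>x::real. exp (a * of_real x) * exp (- of_real r * of_real (exp x)))"
      unfolding shift using integrable_mult_right[of "inverse (of_real r powr a)" lborel
        "\<lambda>x. of_real r powr a * (exp (a * of_real x) * exp (- of_real r * of_real (exp x)))"] by (simp add: mult.assoc[symmetric])
    have "Gamma a = \<bar>1\<bar> *\<^sub>R (\<integral>x. ?g (ln r + 1 * x) \<partial>lborel)"
      unfolding Gamma_integral_log(2)[OF a, symmetric] by (rule lborel_integral_real_affine) auto
    then have "Gamma a = of_real r powr a * (\<integral>x. exp (a * of_real x) * exp (- of_real r * of_real (exp x)) \<partial>lborel)"
      unfolding shift by simp
    then show "(\<integral>x. exp (a * of_real x) * exp (- of_real r * of_real (exp x)) \<partial>lborel) = Gamma a * of_real r powr (- a)"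
      using nz by (simp add: powr_minus field_simps)
  qed
  have comm: "exp (a * of_real x) * exp (- z * of_real (exp x)) = exp (z * of_real (- exp x)) * exp (a * of_real x)"
    for x z by (simp add: mult.commute)
  have int: "integrable lborel (\<lambda>x. exp (of_real (r * - exp x)) * exp (a * of_real x))" if "r \<in> {0<..}" for r
    using real(1)[of r] that by (simp add: mult.commute exp_minus)
  show "?I z"
    unfolding comm by (rule laplace_integrable) (use int[of "Re z"] z in auto)
  have "(\<lambda>z. \<integral>x. exp (z * of_real (- exp x)) * exp (a * of_real x) \<partial>lborel) holomorphic_on {z. Re z \<in> {0<..}}"
    by (rule laplace_holomorphic) (use int in auto)
  then have h: "(\<lambda>z. \<integral>x. exp (a * of_real x) * exp (- z * of_real (exp x)) \<partial>lborel) holomorphic_on {z. Re z > 0}"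
    unfolding comm by simp
  show "?V z"
  proof (rule holomorphic_eq_right_half_plane[OF h _ real(2) z])
    show "(\<lambda>z. Gamma a * z powr (- a)) holomorphic_on {z. Re z > 0}"
      by (intro holomorphic_intros) (auto simp: complex_nonpos_Reals_iff)
  qed
qed

section \<open>Incomplete gamma functions\<close>

lemma exp_has_sum: "((\<lambda>k. (c::complex) ^ k / fact k) has_sum exp c) UNIV"
proof (rule norm_summable_imp_has_sum)
  show "(\<lambda>k. c ^ k / fact k) sums exp c" using exp_converges[of c] by (simp add: scaleR_conv_of_real divide_inverse mult.commute)
  show "summable (\<lambda>k. norm (c ^ k / fact k))"
    using summable_norm_exp[of c] by (simp add: scaleR_conv_of_real divide_inverse mult.commute norm_mult norm_inverse)
qed

lemma exp_coeff_norm_summable: "(\<lambda>k. norm (c::complex) ^ k / fact k) summable_on UNIV"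
proof -
  have "(\<lambda>k. norm (c ^ k / fact k)) summable_on UNIV"
    using exp_has_sum[of c] summable_on_iff_abs_summable_on_complex[of "\<lambda>k. c ^ k / fact k"]
    by (auto simp: summable_on_def)
  then show ?thesis by (simp add: norm_divide norm_power)
qed

text \<open>The integers form a closed set. The uniform bound keeps the denominators a + j of the
  series below away from 0.\<close>

lemma dist_Ints_pos:
  fixes a :: complex
  assumes "a \<notin> \<int>"
  obtains d where "d > 0" "\<And>n. n \<in> \<int> \<Longrightarrow> norm (a + n) \<ge> d"
proof -
  have "open (- \<int> :: complex set)" by (simp add: open_Compl)
  moreover have "- a \<in> - \<int>" using assms by (simp add: minus_in_Ints_iff)
  ultimately obtain d where d: "d > 0" "ball (- a) d \<subseteq> - \<int>"
    by (meson open_contains_ball)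
  have bound: "norm (a + n) \<ge> d" if "n \<in> \<int>" for n
  proof (rule ccontr)
    assume "\<not> ?thesis"
    moreover have "dist (- a) n = norm (a + n)"
      using norm_minus_cancel[of "a + n"] by (simp add: dist_norm)
    ultimately have "n \<in> ball (- a) d" by simp
    then show False using subsetD[OF d(2)] \<open>n \<in> \<int>\<close> by blast
  qed
  show ?thesis using that[OF d(1) bound] .
qed

text \<open>With t = e^x this is the integral of t^(a-1) e^(-q t) over t \<ge> 1, that is q^(-a)
  times the upper incomplete gamma function at (a, q).\<close>

definition upper_gamma :: "complex \<Rightarrow> complex \<Rightarrow> complex" where
  "upper_gamma q a = (LBINT x:{0..}. exp (a * of_real x) * exp (- q * of_real (exp x)))"

text \<open>For Re a > 0 this is the integral of t^(a-1) e^(-q t) over 0 < t < 1, expanded termwise.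
  The series continues it to all nonintegral a.\<close>

definition lower_gamma_series :: "complex \<Rightarrow> complex \<Rightarrow> complex" where
  "lower_gamma_series q a = (\<Sum>\<^sub>\<infinity>j. (- q) ^ j / (fact j * (a + of_nat j)))"

context
  fixes q :: complex
  assumes q: "Re q > 0"
begin

lemma upper_gamma_integrable:
  "set_integrable lborel {0..} (\<lambda>x::real. exp (a * of_real x) * exp (- q * of_real (exp x)))"
proof -
  \<comment> \<open>On x \<ge> 0 a larger real exponent only enlarges the modulus, and the full
    Gamma integral requires a positive one.\<close>
  define b where "b = complex_of_real (max 1 (Re a))"
  have "Re b > 0" by (simp add: b_def)
  then have "set_integrable lborel UNIV (\<lambda>x::real. exp (b * of_real x) * exp (- q * of_real (exp x)))"
    using Gamma_integral_rotated(1)[OF _ q, of b] by (simp add: set_integrable_def)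
  then have "set_integrable lborel {0..} (\<lambda>x::real. exp (b * of_real x) * exp (- q * of_real (exp x)))"
    by (rule set_integrable_subset) auto
  then show ?thesis
    by (rule set_integrable_bound)
      (auto simp: set_borel_measurable_def norm_mult b_def mult_right_mono)
qed

lemma lower_gamma_series_has_sum:
  assumes "a \<notin> \<int>"
  shows "((\<lambda>j. (- q) ^ j / (fact j * (a + of_nat j))) has_sum lower_gamma_series q a) UNIV"
proof -
  obtain d where d: "d > 0" "\<And>n. n \<in> \<int> \<Longrightarrow> norm (a + n) \<ge> d" using dist_Ints_pos[OF assms] by blast
  have "(\<lambda>j. norm ((- q) ^ j / (fact j * (a + of_nat j)))) summable_on UNIV"
  proof (rule summable_on_comparison_test)
    show "(\<lambda>j. norm q ^ j / fact j * (1 / d)) summable_on UNIV"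
      by (intro summable_on_cmult_left exp_coeff_norm_summable)
    show "norm ((- q) ^ j / (fact j * (a + of_nat j))) \<le> norm q ^ j / fact j * (1 / d)" for j
      using d(1) d(2)[of "of_nat j"]
      by (simp add: norm_divide norm_mult norm_power) (intro divide_left_mono mult_left_mono; auto intro!: mult_pos_pos)
  qed auto
  then show ?thesis unfolding lower_gamma_series_def
    by (intro has_sum_infsum summable_on_iff_abs_summable_on_complex[THEN iffD2])
qed

text \<open>Termwise a / (a + j) = 1 - j / (a + j): the first part sums to the exponential, the
  second is the series at a + 1 with its index shifted.\<close>

lemma lower_gamma_series_rec:
  assumes a: "a \<notin> \<int>"
  shows "a * lower_gamma_series q a = exp (- q) + q * lower_gamma_series q (a + 1)"
proof -
  have a1: "a + 1 \<notin> \<int>" using a by (metis Ints_1 Ints_diff add_diff_cancel_right')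
  have nz: "a + of_nat j \<noteq> 0" for j
    using a by (metis Ints_minus Ints_of_nat add.commute add_eq_0_iff2 minus_minus)
  let ?t = "\<lambda>a j. (- q) ^ j / (fact j * (a + of_nat j))"
  have s: "?t a sums lower_gamma_series q a" "?t (a + 1) sums lower_gamma_series q (a + 1)" using has_sum_imp_sums lower_gamma_series_has_sum a a1 by blast+
  have "(\<lambda>j. (- q) ^ j / fact j - a * ?t a j) sums (exp (- q) - a * lower_gamma_series q a)"
    by (intro sums_diff sums_mult s has_sum_imp_sums exp_has_sum)
  \<comment> \<open>The term dropped by the shift, j = 0, is 1 - a / a = 0.\<close>
  then have "(\<lambda>j. (- q) ^ Suc j / fact (Suc j) - a * ?t a (Suc j)) sums (exp (- q) - a * lower_gamma_series q a)"
    by (subst sums_Suc_iff) (use nz[of 0] in auto)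
  moreover have "(- q) ^ Suc j / fact (Suc j) - a * ?t a (Suc j) = - q * ?t (a + 1) j" for j
  proof -
    have "(- q) ^ Suc j / fact (Suc j) - a * ?t a (Suc j) = (- q) ^ Suc j / fact (Suc j) * (of_nat (Suc j) / (a + of_nat (Suc j)))"
    proof -
      have gen: "c - a * (c / m) = c * ((m - a) / m)" if "m \<noteq> 0" for c m :: complex
        using that by (simp add: field_simps)
      show ?thesis
        using gen[OF nz[of "Suc j"], of "(- q) ^ Suc j / fact (Suc j)"] by (simp del: fact_Suc power_Suc of_nat_Suc)
    qed
    also have "\<dots> = - q * ?t (a + 1) j"
    proof -
      have gen: "(c * p) / (N * f) * (N / m) = c * (p / (f * m))" if "N \<noteq> 0" for c p N f m :: complex
        using that by simp
      have m: "a + of_nat (Suc j) = a + 1 + of_nat j" by simp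
      show ?thesis unfolding power_Suc fact_Suc m of_nat_mult by (rule gen) (simp del: of_nat_Suc)
    qed
    finally show ?thesis .
  qed
  ultimately have "(\<lambda>j. - q * ?t (a + 1) j) sums (exp (- q) - a * lower_gamma_series q a)" by simp
  moreover have "(\<lambda>j. - q * ?t (a + 1) j) sums (- q * lower_gamma_series q (a + 1))" by (intro sums_mult s)
  ultimately have "exp (- q) - a * lower_gamma_series q a = - q * lower_gamma_series q (a + 1)" by (rule sums_unique2)
  then show ?thesis by (simp add: algebra_simps)
qed

text \<open>Integration by parts: e^(a x) e^(-q e^x) vanishes at infinity and has the value e^(-q)
  at 0.\<close>

lemma upper_gamma_rec: "a * upper_gamma q a = - exp (- q) + q * upper_gamma q (a + 1)"
proof -
  let ?F = "\<lambda>x::real. exp (a * of_real x) * exp (- q * of_real (exp x))"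
  let ?f = "\<lambda>x::real. a * ?F x - q * (exp ((a + 1) * of_real x) * exp (- q * of_real (exp x)))"
  have sub: "set_integrable lborel {0<..} (\<lambda>x::real. exp (b * of_real x) * exp (- q * of_real (exp x)))" for b
    by (rule set_integrable_subset[OF upper_gamma_integrable]) auto
  have e: "einterval 0 \<infinity> = {0<..}" by (auto simp: einterval_def)
  have G: "upper_gamma q b = (LBINT x:{0<..}. exp (b * of_real x) * exp (- q * of_real (exp x)))" for b
    unfolding upper_gamma_def set_lebesgue_integral_def
  proof (rule integral_cong_AE)
    show "AE x in lborel. indicat_real {0..} x *\<^sub>R (exp (b * complex_of_real x) * exp (- q * complex_of_real (exp x))) =
         indicat_real {0<..} x *\<^sub>R (exp (b * complex_of_real x) * exp (- q * complex_of_real (exp x)))"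
      using AE_lborel_singleton[of 0] by eventually_elim (auto simp: indicator_def)
  qed auto
  have "(LBINT x=0..\<infinity>. ?f x) = 0 - exp (- q)"
  proof (rule interval_integral_FTC_integrable)
    show "(?F has_vector_derivative ?f x) (at x)" for x
    proof -
      have "((\<lambda>z. exp (a * z) * exp (- q * exp z)) has_field_derivative ?f x) (at (of_real x))"
        by (auto intro!: derivative_eq_intros simp: exp_of_real exp_add algebra_simps)
      then have "((\<lambda>x. exp (a * of_real x) * exp (- q * exp (of_real x))) has_vector_derivative ?f x) (at x)"
        by (rule has_vector_derivative_real_field)
      then show ?thesis by (simp add: exp_of_real)
    qed
    show "isCont ?f x" for x by (intro continuous_intros)
    show "set_integrable lborel (einterval 0 \<infinity>) ?f"
      unfolding e by (intro set_integral_diff set_integrable_mult_right sub)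
    have "((\<lambda>x. exp (Re a * x - Re q * exp x)) \<longlongrightarrow> 0) at_top"
      using q by real_asymp
    then have "(?F \<longlongrightarrow> 0) at_top"
      by (subst tendsto_norm_zero_iff[symmetric]) (simp add: norm_mult norm_divide exp_diff exp_minus field_simps flip: exp_add)
    then show "((?F \<circ> real_of_ereal) \<longlongrightarrow> 0) (at_left \<infinity>)" by (simp add: ereal_tendsto_simps)
    have "(?F \<longlongrightarrow> exp (a * of_real 0) * exp (- q * of_real (exp 0))) (at_right 0)"
      by (intro tendsto_intros)
    then show "((?F \<circ> real_of_ereal) \<longlongrightarrow> exp (- q)) (at_right 0)"
      by (simp add: zero_ereal_def ereal_tendsto_simps)
  qed auto
  moreover have "(LBINT x=0..\<infinity>. ?f x) = a * upper_gamma q a - q * upper_gamma q (a + 1)"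
  proof -
    have "(LBINT x:{0<..}. ?f x) = (LBINT x:{0<..}. a * ?F x) -
        (LBINT x:{0<..}. q * (exp ((a + 1) * of_real x) * exp (- q * of_real (exp x))))"
      by (intro set_integral_diff(2) set_integrable_mult_right sub)
    then show ?thesis by (simp add: G interval_lebesgue_integral_def e)
  qed
  ultimately show ?thesis by (simp add: algebra_simps)
qed

text \<open>For Re a > 0 the Gamma integral is cut at x = 0 and the exponential expanded on the
  negative side. The recurrences of the upper and lower parts add up to the functional equation of
  Gamma, so induction carries the identity one unit to the left at a time.\<close>

lemma upper_gamma_eq:
  assumes a: "a \<notin> \<int>"
  shows "upper_gamma q a = q powr (- a) * Gamma a - lower_gamma_series q a"
proof -
  have q0: "q \<noteq> 0" using q by auto
  have "upper_gamma q a = q powr (- a) * Gamma a - lower_gamma_series q a" if "Re a > - real n" "a \<notin> \<int>" for n a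
    using that
  proof (induction n arbitrary: a)
    case 0
    then have ra: "Re a > 0" by simp
    let ?f = "\<lambda>x::real. exp (a * of_real x) * exp (- q * of_real (exp x))"
    have int: "set_integrable lborel UNIV ?f" using Gamma_integral_rotated(1)[OF ra q] by (simp add: set_integrable_def)
    have "(LBINT x:{..<0} \<union> {0..}. ?f x) = (LBINT x:{..<0}. ?f x) + (LBINT x:{0..}. ?f x)"
      by (rule set_integral_Un; (rule set_integrable_subset[OF int])?) auto
    moreover have "{..<0} \<union> {0::real..} = UNIV" by auto
    ultimately have "Gamma a * q powr (- a) = (LBINT x:{..<0}. ?f x) + upper_gamma q a"
      using Gamma_integral_rotated(2)[OF ra q] by (simp add: upper_gamma_def set_lebesgue_integral_def)
    moreover have "(LBINT x:{..<0}. ?f x) = lower_gamma_series q a"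
    proof -
      let ?h = "\<lambda>j x. indicat_real {..<0} x *\<^sub>R ((- q) ^ j / fact j * exp ((a + of_nat j) * of_real x))"
      have int: "integrable lborel (?h j)" for j
        using exp_half_line(1)[of "a + of_nat j"] ra set_integrable_mult_right unfolding set_integrable_def[symmetric] by fastforce
      have val: "(\<integral>x. ?h j x \<partial>lborel) = (- q) ^ j / (fact j * (a + of_nat j))" for j
        using exp_half_line(2)[of "a + of_nat j"] ra unfolding set_lebesgue_integral_def[symmetric] by simp
      have "((\<lambda>j. \<integral>x. ?h j x \<partial>lborel) has_sum (\<integral>x. indicat_real {..<0} x *\<^sub>R ?f x \<partial>lborel)) UNIV"
      proof (rule has_sum_integral(2))
        show "(\<lambda>j. \<integral>x. norm (?h j x) \<partial>lborel) summable_on UNIV"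
        proof (rule summable_on_comparison_test)
          show "(\<lambda>j. norm q ^ j / fact j * (\<integral>x. norm (?h 0 x) \<partial>lborel)) summable_on UNIV"
            by (intro summable_on_cmult_left exp_coeff_norm_summable)
          fix j
          have "(\<integral>x. norm (?h j x) \<partial>lborel) \<le> (\<integral>x. norm q ^ j / fact j * norm (?h 0 x) \<partial>lborel)"
          proof (rule integral_mono[OF integrable_norm[OF int] integrable_mult_right[OF integrable_norm[OF int]]])
            show "norm (?h j x) \<le> norm q ^ j / fact j * norm (?h 0 x)" for x
            proof -
              have "exp (Re a * x + real j * x) \<le> exp (Re a * x)" if "x < 0"
                using that by (simp add: mult_nonneg_nonpos)
              then show ?thesis
                by (auto simp: indicator_def norm_mult norm_divide norm_power distrib_right intro!: divide_right_mono mult_left_mono)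
            qed
          qed
          then show "(\<integral>x. norm (?h j x) \<partial>lborel) \<le> norm q ^ j / fact j * (\<integral>x. norm (?h 0 x) \<partial>lborel)" by simp
        qed auto
        show "((\<lambda>j. ?h j x) has_sum indicat_real {..<0} x *\<^sub>R ?f x) UNIV" for x
        proof -
          have "((\<lambda>j. (indicat_real {..<0} x *\<^sub>R exp (a * of_real x)) * ((- q * of_real (exp x)) ^ j / fact j)) has_sum
             (indicat_real {..<0} x *\<^sub>R exp (a * of_real x)) * exp (- q * of_real (exp x))) UNIV"
            by (intro has_sum_cmult_right exp_has_sum)
          moreover have "(indicat_real {..<0} x *\<^sub>R exp (a * of_real x)) * ((- q * of_real (exp x)) ^ j / fact j) = ?h j x" for j
          proof -
            have "(- q * of_real (exp x)) ^ j = (- q) ^ j * exp (of_nat j * of_real x)"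
              by (simp only: power_mult_distrib exp_of_nat_mult exp_of_real)
            then show ?thesis
              by (simp only: exp_add distrib_right scaleR_conv_of_real) (simp add: mult_ac)
          qed
          moreover have "(indicat_real {..<0} x *\<^sub>R exp (a * of_real x)) * exp (- q * of_real (exp x)) =
             indicat_real {..<0} x *\<^sub>R ?f x" by simp
          ultimately show ?thesis by (simp only:)
        qed
      qed (use int lborel.sigma_finite_measure_axioms in auto)
      then show ?thesis
        using lower_gamma_series_has_sum[OF 0(2)] unfolding val set_lebesgue_integral_def by (rule has_sum_unique)
    qed
    ultimately show ?case by (simp add: algebra_simps)
  next
    case (Suc n)
    have a0: "a \<noteq> 0" using Suc.prems by auto
    have a1: "a + 1 \<notin> \<int>" using Suc.prems by (metis Ints_1 Ints_diff add_diff_cancel_right')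
    have "a * upper_gamma q a = - exp (- q) + q * (q powr (- (a + 1)) * Gamma (a + 1) - lower_gamma_series q (a + 1))"
      using Suc.IH[OF _ a1] Suc.prems by (simp add: upper_gamma_rec)
    have pq: "q * (q powr (- (a + 1))) = q powr (- a)"
      using powr_add[of q "- (a + 1)" 1] q0 by (simp add: mult.commute)
    have "a \<notin> \<int>\<^sub>\<le>\<^sub>0" using Suc.prems nonpos_Ints_Int by blast
    then have G: "Gamma (a + 1) = a * Gamma a" by (rule Gamma_plus1)
    note \<open>a * upper_gamma q a = _\<close>
    also have "- exp (- q) + q * (q powr (- (a + 1)) * Gamma (a + 1) - lower_gamma_series q (a + 1)) =
        q powr (- a) * (a * Gamma a) - (exp (- q) + q * lower_gamma_series q (a + 1))"
      unfolding pq[symmetric] G by (simp add: algebra_simps)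
    also have "\<dots> = a * (q powr (- a) * Gamma a - lower_gamma_series q a)"
      using lower_gamma_series_rec[OF Suc.prems(2)] by (simp add: algebra_simps)
    finally show ?case using a0 by simp
  qed
  moreover obtain n where "Re a > - real n" using reals_Archimedean2[of "- Re a"] by (metis minus_less_iff)
  ultimately show ?thesis using a by blast
qed

end

text \<open>The part over x \<ge> 0 of the integral for \<open>2 * bessel_K \<nu> (2 * q)\<close>;
  reflection turns the other part into the same expression at -\<nu>.\<close>

definition bessel_half :: "complex \<Rightarrow> complex \<Rightarrow> complex" where
  "bessel_half q \<nu> = (LBINT x:{0..}. exp (\<nu> * of_real x) * exp (- q * (of_real (exp x + exp (- x)))))"

lemma bessel_half_integrable:
  assumes q: "Re q > 0"
  shows "set_integrable lborel {0..} (\<lambda>x::real. exp (\<nu> * of_real x) * exp (- q * (of_real (exp x + exp (- x)))))"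
  using upper_gamma_integrable[OF q, of \<nu>]
proof (rule set_integrable_bound)
  show "AE x in lborel. x \<in> {0..} \<longrightarrow>
      norm (exp (\<nu> * of_real x) * exp (- q * (of_real (exp x + exp (- x)))))
      \<le> norm (exp (\<nu> * of_real x) * exp (- q * of_real (exp x)))"
    using q by (auto simp: norm_mult distrib_left)
qed (simp add: set_borel_measurable_def)

text \<open>Only the factor e^(-q e^(-x)), whose exponent is bounded on x \<ge> 0, is expanded;
  e^(-q e^x) is kept for convergence and yields incomplete gamma functions.\<close>

lemma bessel_half_has_sum:
  assumes q: "Re q > 0"
  shows "((\<lambda>k. (- q) ^ k / fact k * upper_gamma q (\<nu> - of_nat k)) has_sum bessel_half q \<nu>) UNIV"
proof -
  let ?f = "\<lambda>a (x::real). exp (a * of_real x) * exp (- q * of_real (exp x))"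
  let ?h = "\<lambda>k x. indicat_real {0..} x *\<^sub>R ((- q) ^ k / fact k * ?f (\<nu> - of_nat k) x)"
  have int: "integrable lborel (?h k)" for k
    using set_integrable_mult_right[OF upper_gamma_integrable[OF q]] unfolding set_integrable_def by blast
  have val: "(\<integral>x. ?h k x \<partial>lborel) = (- q) ^ k / fact k * upper_gamma q (\<nu> - of_nat k)" for k
    unfolding set_lebesgue_integral_def[symmetric] upper_gamma_def by simp
  have "((\<lambda>k. \<integral>x. ?h k x \<partial>lborel) has_sum
     (\<integral>x. indicat_real {0..} x *\<^sub>R (exp (\<nu> * of_real x) * exp (- q * (of_real (exp x + exp (- x))))) \<partial>lborel)) UNIV"
  proof (rule has_sum_integral(2))
    show "(\<lambda>k. \<integral>x. norm (?h k x) \<partial>lborel) summable_on UNIV"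
    proof (rule summable_on_comparison_test)
      show "(\<lambda>k. norm q ^ k / fact k * (\<integral>x. norm (?h 0 x) \<partial>lborel)) summable_on UNIV"
        by (intro summable_on_cmult_left exp_coeff_norm_summable)
      fix k
      have "(\<integral>x. norm (?h k x) \<partial>lborel) \<le> (\<integral>x. norm q ^ k / fact k * norm (?h 0 x) \<partial>lborel)"
      proof (rule integral_mono[OF integrable_norm[OF int] integrable_mult_right[OF integrable_norm[OF int]]])
        show "norm (?h k x) \<le> norm q ^ k / fact k * norm (?h 0 x)" for x
        proof -
          have "exp ((Re \<nu> - real k) * x) \<le> exp (Re \<nu> * x)" if "x \<ge> 0"
            using that by (simp add: mult_right_mono)
          then show ?thesis
            by (auto simp: indicator_def norm_mult norm_divide norm_power intro!: divide_right_mono mult_left_mono mult_right_mono)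
        qed
      qed
      then show "(\<integral>x. norm (?h k x) \<partial>lborel) \<le> norm q ^ k / fact k * (\<integral>x. norm (?h 0 x) \<partial>lborel)" by simp
    qed auto
    fix x :: real
    have "((\<lambda>k. (indicat_real {0..} x *\<^sub>R ?f \<nu> x) * ((- q * exp (- of_real x)) ^ k / fact k)) has_sum
       (indicat_real {0..} x *\<^sub>R ?f \<nu> x) * exp (- q * exp (- of_real x))) UNIV"
      by (intro has_sum_cmult_right exp_has_sum)
    moreover have "(indicat_real {0..} x *\<^sub>R ?f \<nu> x) * ((- q * exp (- of_real x)) ^ k / fact k) = ?h k x" for k
    proof -
      have "(- q * exp (- of_real x)) ^ k = (- q) ^ k * exp (of_nat k * - of_real x)"
        by (simp only: power_mult_distrib exp_of_nat_mult)
      moreover have "exp ((\<nu> - of_nat k) * of_real x) = exp (\<nu> * of_real x) * exp (of_nat k * - of_real x)"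
        by (simp add: mult_exp_exp algebra_simps)
      ultimately show ?thesis by (simp only: scaleR_conv_of_real) (simp add: mult_ac)
    qed
    moreover have "(indicat_real {0..} x *\<^sub>R ?f \<nu> x) * exp (- q * exp (- of_real x)) =
       indicat_real {0..} x *\<^sub>R (exp (\<nu> * of_real x) * exp (- q * (of_real (exp x + exp (- x)))))"
    proof -
      have e: "exp (- of_real x) = complex_of_real (exp (- x))" by (metis exp_of_real of_real_minus)
      show ?thesis unfolding e by (simp add: mult_exp_exp algebra_simps)
    qed
    ultimately show "((\<lambda>k. ?h k x) has_sum
        indicat_real {0..} x *\<^sub>R (exp (\<nu> * of_real x) * exp (- q * (of_real (exp x + exp (- x)))))) UNIV" by (simp only:)
  qed (use int lborel.sigma_finite_measure_axioms in auto)
  then show ?thesis unfolding val bessel_half_def set_lebesgue_integral_def .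
qed

text \<open>Swapping the two summation indices reverses the sign of this double sum, so its contributions to the
  two halves of the Bessel integral cancel.\<close>

definition bessel_double :: "complex \<Rightarrow> complex \<Rightarrow> complex" where
  "bessel_double q \<nu> =
     (\<Sum>\<^sub>\<infinity>(k, j). (- q) ^ k / fact k * ((- q) ^ j / (fact j * (\<nu> - of_nat k + of_nat j))))"

lemma bessel_double_has_sum:
  assumes \<nu>: "\<nu> \<notin> \<int>" and q: "Re q > 0"
  shows "((\<lambda>(k, j). (- q) ^ k / fact k * ((- q) ^ j / (fact j * (\<nu> - of_nat k + of_nat j)))) has_sum
    bessel_double q \<nu>) UNIV"
proof -
  obtain d where d: "d > 0" "\<And>n. n \<in> \<int> \<Longrightarrow> norm (\<nu> + n) \<ge> d" using dist_Ints_pos[OF \<nu>] by blast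
  have "(\<lambda>p. norm (case p of (k, j) \<Rightarrow> (- q) ^ k / fact k * ((- q) ^ j / (fact j * (\<nu> - of_nat k + of_nat j))))) summable_on UNIV"
  proof (rule summable_on_comparison_test)
    have "(\<lambda>(k, j). (norm q ^ k / fact k) * (norm q ^ j / fact j)) summable_on UNIV \<times> UNIV"
      by (intro summable_on_Times_real exp_coeff_norm_summable) auto
    then show "(\<lambda>p. (case p of (k, j) \<Rightarrow> (norm q ^ k / fact k) * (norm q ^ j / fact j)) * (1 / d)) summable_on UNIV"
      by (intro summable_on_cmult_left) simp
    fix p :: "nat \<times> nat"
    obtain k j where p: "p = (k, j)" by (cases p)
    have "norm (\<nu> - of_nat k + of_nat j) \<ge> d"
      using d(2)[of "of_nat j - of_nat k"] by (simp add: algebra_simps)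
    then have "1 / norm (\<nu> - of_nat k + of_nat j) \<le> 1 / d" using d(1) by (intro frac_le) auto
    then have "(norm q ^ k / fact k) * (norm q ^ j / fact j) * (1 / norm (\<nu> - of_nat k + of_nat j)) \<le>
       (norm q ^ k / fact k) * (norm q ^ j / fact j) * (1 / d)"
      by (intro mult_left_mono) auto
    then show "norm (case p of (k, j) \<Rightarrow> (- q) ^ k / fact k * ((- q) ^ j / (fact j * (\<nu> - of_nat k + of_nat j))))
        \<le> (case p of (k, j) \<Rightarrow> (norm q ^ k / fact k) * (norm q ^ j / fact j)) * (1 / d)"
      by (simp add: p norm_mult norm_divide norm_power)
  qed auto
  then show ?thesis unfolding bessel_double_def
    by (intro has_sum_infsum summable_on_iff_abs_summable_on_complex[THEN iffD2])
qed

lemma bessel_double_minus: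
  assumes \<nu>: "\<nu> \<notin> \<int>" and q: "Re q > 0"
  shows "bessel_double q (- \<nu>) = - bessel_double q \<nu>"
proof -
  let ?t = "\<lambda>\<nu> (k, j). (- q) ^ k / fact k * ((- q) ^ j / (fact j * (\<nu> - of_nat k + of_nat j)))"
  have m: "- \<nu> \<notin> \<int>" using \<nu> by (simp add: minus_in_Ints_iff)
  have "((\<lambda>p. ?t (- \<nu>) (prod.swap p)) has_sum bessel_double q (- \<nu>)) UNIV"
    using bessel_double_has_sum[OF m q] has_sum_reindex[of prod.swap UNIV "?t (- \<nu>)"]
    by (simp add: o_def)
  moreover have "?t (- \<nu>) (prod.swap p) = - ?t \<nu> p" for p
  proof (cases p)
    case (Pair k j)
    have "- \<nu> - of_nat j + of_nat k = - (\<nu> - of_nat k + of_nat j)" by simp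
    then show ?thesis unfolding Pair by (simp only: swap_simp case_prod_conv mult_minus_right divide_minus_right) (simp add: mult_ac)
  qed
  ultimately have "((\<lambda>p. - ?t \<nu> p) has_sum bessel_double q (- \<nu>)) UNIV" by simp
  moreover have "((\<lambda>p. - ?t \<nu> p) has_sum - bessel_double q \<nu>) UNIV"
    unfolding has_sum_uminus minus_minus by (rule bessel_double_has_sum[OF assms])
  ultimately show ?thesis by (rule has_sum_unique)
qed

text \<open>Inserting \<open>upper_gamma_eq\<close> splits each term in two. The reflection formula
  turns the complete Gamma values into the coefficients of \<open>bessel_I\<close> at -\<nu>; the
  lower series sum to \<open>bessel_double\<close> with a minus sign.\<close>

lemma bessel_half_eq:
  assumes \<nu>: "\<nu> \<notin> \<int>" and q: "Re q > 0"
  shows "bessel_half q \<nu> + bessel_double q \<nu> =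
    of_real pi / sin (of_real pi * \<nu>) * bessel_I (- \<nu>) (2 * q)"
proof -
  have nk: "\<nu> - of_nat k \<notin> \<int>" for k using \<nu> by (metis Ints_add Ints_of_nat diff_add_cancel)
  have q0: "q \<noteq> 0" using q by auto
  have inner: "((\<lambda>k. (- q) ^ k / fact k * lower_gamma_series q (\<nu> - of_nat k)) has_sum bessel_double q \<nu>) UNIV"
  proof (rule has_sum_SigmaD[of _ UNIV "\<lambda>_. UNIV"])
    show "((\<lambda>(k, j). (- q) ^ k / fact k * ((- q) ^ j / (fact j * (\<nu> - of_nat k + of_nat j)))) has_sum bessel_double q \<nu>) (Sigma UNIV (\<lambda>_. UNIV))"
      using bessel_double_has_sum[OF assms] by simp
    show "((\<lambda>j. case (k, j) of (k, j) \<Rightarrow> (- q) ^ k / fact k * ((- q) ^ j / (fact j * (\<nu> - of_nat k + of_nat j)))) has_sum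
        (- q) ^ k / fact k * lower_gamma_series q (\<nu> - of_nat k)) UNIV" for k
      unfolding case_prod_conv by (rule has_sum_cmult_right[OF lower_gamma_series_has_sum[OF q nk]])
  qed
  have summand: "(- q) ^ k / fact k * upper_gamma q (\<nu> - of_nat k) + (- q) ^ k / fact k * lower_gamma_series q (\<nu> - of_nat k) =
     of_real pi / sin (of_real pi * \<nu>) * ((2 * q / 2) powr (- \<nu> + 2 * of_nat k) * rGamma (- \<nu> + of_nat k + 1) / fact k)" for k
  proof -
    have r1: "Gamma (\<nu> - of_nat k) * Gamma (1 - (\<nu> - of_nat k)) = of_real pi / sin (of_real pi * (\<nu> - of_nat k))"
      by (rule Gamma_reflection_complex)
    have "1 - (\<nu> - of_nat k) \<notin> \<int>\<^sub>\<le>\<^sub>0"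
      using nk[of k] by (metis Ints_1 Ints_diff diff_diff_cancel nonpos_Ints_Int add_diff_cancel_left' diff_add_cancel)
    then have r2: "Gamma (1 - (\<nu> - of_nat k)) \<noteq> 0" by (simp add: Gamma_eq_zero_iff)
    have r3: "sin (of_real pi * (\<nu> - of_nat k)) = (- 1) ^ k * sin (of_real pi * \<nu>)"
    proof -
      have "sin (complex_of_real pi * of_nat k) = 0" "cos (complex_of_real pi * of_nat k) = (- 1) ^ k"
        by (metis of_real_0 of_real_mult of_real_of_nat_eq sin_npi2 sin_of_real)
          (metis cos_npi2 cos_of_real of_real_1 of_real_minus of_real_mult of_real_of_nat_eq of_real_power)
      then show ?thesis by (simp add: right_diff_distrib sin_diff)
    qed
    have "Gamma (\<nu> - of_nat k) = of_real pi / ((- 1) ^ k * sin (of_real pi * \<nu>)) * rGamma (1 - (\<nu> - of_nat k))"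
    proof -
      have "x = c * inverse y" if "x * y = c" "y \<noteq> 0" for x y c :: complex using that by (simp add: field_simps)
      from this[OF r1 r2] show ?thesis
        using r3 by (simp only: rGamma_inverse_Gamma)
    qed
    then have G: "Gamma (\<nu> - of_nat k) = (- 1) ^ k * (of_real pi / sin (of_real pi * \<nu>)) * rGamma (- \<nu> + of_nat k + 1)"
      by (cases "even k") (auto simp: algebra_simps)
    have pw: "q ^ k * q powr (- (\<nu> - of_nat k)) = q powr (- \<nu> + 2 * of_nat k)"
    proof -
      have "q ^ k * q powr (- (\<nu> - of_nat k)) = q powr of_nat k * q powr (- \<nu> + of_nat k)"
        using q0 by (simp add: powr_nat')
      also have "\<dots> = q powr (- \<nu> + 2 * of_nat k)"
        by (simp add: powr_add[symmetric])
      finally show ?thesis .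
    qed
    have "(- q) ^ k / fact k * upper_gamma q (\<nu> - of_nat k) + (- q) ^ k / fact k * lower_gamma_series q (\<nu> - of_nat k) =
       (- 1) ^ k * (q ^ k * q powr (- (\<nu> - of_nat k))) / fact k * Gamma (\<nu> - of_nat k)"
      by (subst upper_gamma_eq[OF q nk]) (simp add: algebra_simps power_minus[of q])
    also have "\<dots> = ((- 1) ^ k * (- 1) ^ k) * (q powr (- \<nu> + 2 * of_nat k)) / fact k * ((of_real pi / sin (of_real pi * \<nu>)) * rGamma (- \<nu> + of_nat k + 1))"
      unfolding pw G by simp
    also have "(- 1) ^ k * (- 1) ^ k = (1::complex)" by (simp add: power_mult_distrib[symmetric])
    finally show ?thesis by (simp add: mult_ac)
  qed
  have "((\<lambda>k. of_real pi / sin (of_real pi * \<nu>) * ((2 * q / 2) powr (- \<nu> + 2 * of_nat k) * rGamma (- \<nu> + of_nat k + 1) / fact k))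
      has_sum (bessel_half q \<nu> + bessel_double q \<nu>)) UNIV"
    using has_sum_add[OF bessel_half_has_sum[OF q, of \<nu>] inner] unfolding summand .
  then have s: "(\<lambda>k. of_real pi / sin (of_real pi * \<nu>) * ((2 * q / 2) powr (- \<nu> + 2 * of_nat k) * rGamma (- \<nu> + of_nat k + 1) / fact k))
      sums (bessel_half q \<nu> + bessel_double q \<nu>)" by (rule has_sum_imp_sums)
  have "sin (of_real pi * \<nu>) \<noteq> 0"
    using \<nu> by (auto simp: sin_eq_0)
  then have c: "of_real pi / sin (of_real pi * \<nu>) \<noteq> (0::complex)" by simp
  \<comment> \<open>Convergence of the series of \<open>bessel_I\<close> is inferred from that of a
    nonzero multiple of it.\<close>
  then have "summable (\<lambda>k. (2 * q / 2) powr (- \<nu> + 2 * of_nat k) * rGamma (- \<nu> + of_nat k + 1) / fact k)"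
    using sums_summable[OF s] by (subst (asm) summable_cmult_iff) blast
  then show ?thesis unfolding bessel_I_def using sums_unique[OF s] by (simp only: suminf_mult)
qed

text \<open>Despite the letter this is not the Bessel function of the first kind: it is 2 K of order
  \<nu> at 2 q.\<close>

definition bessel_J :: "complex \<Rightarrow> complex \<Rightarrow> complex" where
  "bessel_J q \<nu> = (\<integral>x. exp (\<nu> * of_real x) * exp (- q * (of_real (exp x + exp (- x)))) \<partial>lborel)"

lemma bessel_J_halves:
  assumes q: "Re q > 0"
  shows "integrable lborel (\<lambda>x::real. exp (\<nu> * of_real x) * exp (- q * (of_real (exp x + exp (- x)))))"
    and "bessel_J q \<nu> = bessel_half q \<nu> + bessel_half q (- \<nu>)"
proof -
  let ?f = "\<lambda>\<nu> (x::real). exp (\<nu> * of_real x) * exp (- q * (of_real (exp x + exp (- x))))"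
  let ?g = "\<lambda>x. indicat_real {0..} x *\<^sub>R ?f (- \<nu>) x"
  have i: "integrable lborel (\<lambda>x. indicat_real {0..} x *\<^sub>R ?f \<nu> x)" for \<nu>
    using bessel_half_integrable[OF q] unfolding set_integrable_def .
  have r: "?g (0 + (- 1) * x) = indicat_real {..0} x *\<^sub>R ?f \<nu> x" for x
    by (auto simp: indicator_def add.commute)
  have i2: "integrable lborel (\<lambda>x. indicat_real {..0} x *\<^sub>R ?f \<nu> x)"
    using lborel_integrable_real_affine[OF i[of "- \<nu>"], of "-1" 0] unfolding r by simp
  have v2: "(\<integral>x. indicat_real {..0} x *\<^sub>R ?f \<nu> x \<partial>lborel) = bessel_half q (- \<nu>)"
    using lborel_integral_real_affine[of "-1" ?g 0] unfolding r bessel_half_def set_lebesgue_integral_def by simp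
  have ae: "AE x in lborel. indicat_real {0..} x *\<^sub>R ?f \<nu> x + indicat_real {..0} x *\<^sub>R ?f \<nu> x = ?f \<nu> x"
    using AE_lborel_singleton[of 0] by eventually_elim (auto simp: indicator_def)
  have i3: "integrable lborel (\<lambda>x. indicat_real {0..} x *\<^sub>R ?f \<nu> x + indicat_real {..0} x *\<^sub>R ?f \<nu> x)"
    by (intro Bochner_Integration.integrable_add i i2)
  show "integrable lborel (?f \<nu>)"
    by (rule integrable_cong_AE_imp[OF i3 _ ae]) measurable
  have "bessel_J q \<nu> = (\<integral>x. indicat_real {0..} x *\<^sub>R ?f \<nu> x + indicat_real {..0} x *\<^sub>R ?f \<nu> x \<partial>lborel)"
    unfolding bessel_J_def
  proof (rule integral_cong_AE[OF _ _ AE_mp[OF ae]])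
    show "(\<lambda>x. indicat_real {0..} x *\<^sub>R ?f \<nu> x + indicat_real {..0} x *\<^sub>R ?f \<nu> x) \<in> borel_measurable lborel"
      using i3 by auto
  qed auto
  also have "\<dots> = bessel_half q \<nu> + bessel_half q (- \<nu>)"
    by (subst Bochner_Integration.integral_add[OF i i2]) (simp only: v2 bessel_half_def set_lebesgue_integral_def)
  finally show "bessel_J q \<nu> = bessel_half q \<nu> + bessel_half q (- \<nu>)" .
qed

lemma bessel_J_holomorphic:
  assumes q: "Re q > 0"
  shows "bessel_J q holomorphic_on UNIV"
proof -
  have "(\<lambda>\<nu>. \<integral>x. exp (\<nu> * of_real x) * exp (- q * (of_real (exp x + exp (- x)))) \<partial>lborel) holomorphic_on {k. Re k \<in> UNIV}"
    by (rule laplace_holomorphic) (use bessel_J_halves(1)[OF q, of "of_real _"] in auto)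
  then show ?thesis by (simp add: bessel_J_def[abs_def])
qed

text \<open>Adding the halves for \<nu> and -\<nu> cancels the double sums and leaves the defining
  combination of \<open>bessel_I\<close>. The integral is entire in \<nu>, so at an integral order
  its value is the limit taken in \<open>bessel_K\<close>.\<close>

theorem bessel_K_integral:
  assumes z: "Re z > 0"
  shows "bessel_K \<nu> z = bessel_J (z / 2) \<nu> / 2"
proof -
  define q where "q = z / 2"
  have q: "Re q > 0" "2 * q = z" using z by (auto simp: q_def)
  define K where "K = (\<lambda>\<mu>. of_real pi / 2 * (bessel_I (- \<mu>) z - bessel_I \<mu> z) / sin (\<mu> * of_real pi))"
  have K: "K \<mu> = bessel_J q \<mu> / 2" if \<mu>: "\<mu> \<notin> \<int>" for \<mu>
  proof -
    have m: "- \<mu> \<notin> \<int>" using \<mu> by (simp add: minus_in_Ints_iff)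
    have "bessel_J q \<mu> = (bessel_half q \<mu> + bessel_double q \<mu>) + (bessel_half q (- \<mu>) + bessel_double q (- \<mu>))"
      by (simp add: bessel_J_halves(2)[OF q(1)] bessel_double_minus[OF \<mu> q(1)])
    then show ?thesis
      unfolding bessel_half_eq[OF \<mu> q(1)] bessel_half_eq[OF m q(1)] q(2) K_def
      by (simp add: algebra_simps diff_divide_distrib)
  qed
  show ?thesis
  proof (cases "\<nu> \<in> \<int>")
    case True
    have "isCont (bessel_J q) \<nu>"
      using bessel_J_holomorphic[OF q(1)] holomorphic_on_imp_continuous_on continuous_on_eq_continuous_at by blast
    then have lim: "((\<lambda>\<mu>. bessel_J q \<mu> / 2) \<longlongrightarrow> bessel_J q \<nu> / 2) (at \<nu>)"
      by (intro tendsto_intros) (simp_all add: isCont_def)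
    have "open (- (\<int> - {\<nu>}) :: complex set)"
      by (intro open_Compl closed_subset_Ints) auto
    then have "\<forall>\<^sub>F \<mu> in at \<nu>. \<mu> \<in> - (\<int> - {\<nu>}) - {\<nu>}"
      by (rule eventually_at_in_open) auto
    then have "\<forall>\<^sub>F \<mu> in at \<nu>. bessel_J q \<mu> / 2 = K \<mu>" by eventually_elim (auto simp: K)
    with lim have "(K \<longlongrightarrow> bessel_J q \<nu> / 2) (at \<nu>)" by (rule Lim_transform_eventually)
    then have "Lim (at \<nu>) K = bessel_J q \<nu> / 2" by (intro tendsto_Lim) auto
    then show ?thesis using True by (simp add: bessel_K_def K_def q_def)
  next
    case False
    then show ?thesis using K[OF False] by (simp add: bessel_K_def K_def q_def)
  qed
qed

section \<open>Poisson summation for Gaussians\<close>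

text \<open>Lets \<open>laplace_holomorphic\<close> act on unconditional sums.\<close>

lemma infsum_eq_integral_count_space:
  fixes f :: "'a \<Rightarrow> complex"
  assumes "f summable_on A"
  shows "integrable (count_space A) f" "infsum f A = (\<integral>a. f a \<partial>count_space A)"
proof -
  have s: "Infinite_Set_Sum.abs_summable_on f A"
    using assms by (metis abs_summable_equivalent summable_on_iff_abs_summable_on_complex)
  then show "integrable (count_space A) f" by (simp add: abs_summable_on_def)
  show "infsum f A = (\<integral>a. f a \<partial>count_space A)"
    using infsetsum_infsum[OF s] by (simp add: infsetsum_def)
qed

lemma dirichlet_summable:
  fixes L :: "'a \<Rightarrow> real" and h :: "'a \<Rightarrow> complex"
  assumes "(\<lambda>a. exp (of_real (Re k * L a)) * h a) summable_on A"
  shows "(\<lambda>a. exp (k * of_real (L a)) * h a) summable_on A"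
proof -
  have "(\<lambda>a. norm (exp (of_real (Re k * L a)) * h a)) summable_on A"
    using assms by (simp only: summable_on_iff_abs_summable_on_complex)
  then have "(\<lambda>a. norm (exp (k * of_real (L a)) * h a)) summable_on A" by (simp add: norm_mult)
  then show ?thesis by (simp only: summable_on_iff_abs_summable_on_complex)
qed

lemma dirichlet_holomorphic:
  fixes L :: "'a \<Rightarrow> real" and h :: "'a \<Rightarrow> complex"
  assumes "open I" and sum: "\<And>r. r \<in> I \<Longrightarrow> (\<lambda>a. exp (of_real (r * L a)) * h a) summable_on A"
  shows "(\<lambda>k. \<Sum>\<^sub>\<infinity>a\<in>A. exp (k * of_real (L a)) * h a) holomorphic_on {k. Re k \<in> I}"
proof -
  have "(\<lambda>k. \<integral>a. exp (k * of_real (L a)) * h a \<partial>count_space A) holomorphic_on {k. Re k \<in> I}"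
    by (rule laplace_holomorphic) (use assms infsum_eq_integral_count_space(1) in auto)
  moreover have "(\<integral>a. exp (k * of_real (L a)) * h a \<partial>count_space A) = (\<Sum>\<^sub>\<infinity>a\<in>A. exp (k * of_real (L a)) * h a)"
    if "k \<in> {k. Re k \<in> I}" for k
    using that sum by (intro infsum_eq_integral_count_space(2)[symmetric] dirichlet_summable) auto
  ultimately show ?thesis by (rule holomorphic_transform)
qed

section \<open>Fourier series on an interval of length one\<close>

definition fexp :: "int \<Rightarrow> real \<Rightarrow> complex" where "fexp k y = cis (2 * pi * of_int k * y)"

lemma fexp_simps: "fexp 0 y = 1" "fexp j y * fexp k y = fexp (j + k) y" "cnj (fexp k y) = fexp (- k) y"
  by (simp_all add: fexp_def cis_mult cis_cnj algebra_simps)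

lemma continuous_on_fexp [continuous_intros]: "continuous_on A (fexp k)"
  unfolding fexp_def[abs_def] by (intro continuous_intros)

lemma fexp_integral: "integral {-(1/2)..1/2} (fexp k) = (if k = 0 then 1 else 0)"
proof (cases "k = 0")
  case True
  moreover have "fexp 0 = (\<lambda>_. 1)" by (simp add: fun_eq_iff fexp_simps)
  ultimately show ?thesis by simp
next
  case False
  define c where "c = 2 * pi * of_int k"
  have c: "c \<noteq> 0" using False by (simp add: c_def)
  have "(fexp k has_integral cis (c * (1/2)) / (\<i> * c) - cis (c * (- (1/2))) / (\<i> * c)) {-(1/2)..1/2}"
  proof (rule fundamental_theorem_of_calculus)
    show "((\<lambda>y. cis (c * y) / (\<i> * c)) has_vector_derivative fexp k x) (at x within {-(1/2)..1/2})" for x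
    proof -
      define w where "w = \<i> * of_real c"
      have "w \<noteq> 0" using c by (simp add: w_def)
      then have "((\<lambda>z. exp (w * z) / w) has_field_derivative exp (w * of_real x)) (at (of_real x))"
        by (auto intro!: derivative_eq_intros)
      then have "((\<lambda>x. exp (w * of_real x) / w) has_vector_derivative exp (w * of_real x)) (at x within {-(1/2)..1/2})"
        by (rule has_vector_derivative_real_field)
      then show ?thesis by (simp add: fexp_def c_def w_def cis_conv_exp mult_ac)
    qed
  qed auto
  moreover have "cis (c * (1/2)) = cis (c * (- (1/2)))"
  proof -
    have "cis (c * (1/2)) = cis (c * (- (1/2))) * cis (2 * pi * of_int k)" by (subst cis_mult) (simp add: c_def)
    also have "cis (2 * pi * of_int k) = 1" by (simp add: cis_multiple_2pi)
    finally show ?thesis by simp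
  qed
  ultimately show ?thesis using False by (simp add: has_integral_iff)
qed

text \<open>The squared distance of q to its Fourier sum S over F is nonnegative. By orthonormality
  the integrals of q times conj S, S times conj q and S times conj S all equal the sum of the |c
  k|^2.\<close>

lemma Bessel_inequality:
  fixes q :: "real \<Rightarrow> complex"
  assumes q: "continuous_on {-(1/2)..1/2} q" and F: "finite F"
  defines "c \<equiv> (\<lambda>k. integral {-(1/2)..1/2} (\<lambda>y. q y * fexp (- k) y))"
  shows "(\<Sum>k\<in>F. (norm (c k))\<^sup>2) \<le> integral {-(1/2)..1/2} (\<lambda>y. (norm (q y))\<^sup>2)"
proof -
  let ?I = "integral {-(1/2)..1/2} :: (real \<Rightarrow> complex) \<Rightarrow> complex"
  define S where "S = (\<lambda>y. \<Sum>k\<in>F. c k * fexp k y)"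
  have S: "continuous_on {-(1/2)..1/2} S" unfolding S_def by (intro continuous_intros)
  have int: "f integrable_on {-(1/2)..1/2}" if "continuous_on {-(1/2)..1/2} f" for f :: "real \<Rightarrow> complex"
    by (rule integrable_continuous_interval[OF that])
  have cnjI: "?I (\<lambda>y. cnj (f y)) = cnj (?I f)" for f by (rule integral_cnj[symmetric])
  define s where "s = (\<Sum>k\<in>F. c k * cnj (c k))"
  have s: "s = of_real (\<Sum>k\<in>F. (norm (c k))\<^sup>2)" unfolding s_def of_real_sum
    by (intro sum.cong refl) (rule complex_norm_square[symmetric])
  have gen: "?I (\<lambda>y. f y * cnj (S y)) = (\<Sum>k\<in>F. cnj (c k) * ?I (\<lambda>y. f y * fexp (- k) y))"
    if f: "continuous_on {-(1/2)..1/2} f" for f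
  proof -
    have "?I (\<lambda>y. f y * cnj (S y)) = ?I (\<lambda>y. \<Sum>k\<in>F. cnj (c k) * (f y * fexp (- k) y))"
      by (simp add: S_def fexp_simps sum_distrib_left mult_ac)
    also have "\<dots> = (\<Sum>k\<in>F. ?I (\<lambda>y. cnj (c k) * (f y * fexp (- k) y)))"
      by (intro integral_sum F int continuous_intros f)
    finally show ?thesis by simp
  qed
  have qS: "?I (\<lambda>y. q y * cnj (S y)) = s"
    unfolding gen[OF q] s_def c_def by (simp add: mult.commute)
  have SS: "?I (\<lambda>y. S y * cnj (S y)) = s"
  proof -
    have "?I (\<lambda>y. S y * fexp (- k) y) = c k" if "k \<in> F" for k
    proof -
      have "?I (\<lambda>y. S y * fexp (- k) y) = ?I (\<lambda>y. \<Sum>j\<in>F. c j * fexp (j - k) y)"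
        by (simp add: S_def sum_distrib_right mult.assoc fexp_simps)
      also have "\<dots> = (\<Sum>j\<in>F. ?I (\<lambda>y. c j * fexp (j - k) y))"
        by (intro integral_sum F int continuous_intros)
      also have "\<dots> = (\<Sum>j\<in>F. if j = k then c j else 0)"
        by (intro sum.cong) (auto simp: fexp_integral)
      finally show ?thesis using F that by simp
    qed
    then show ?thesis unfolding gen[OF S] s_def by (intro sum.cong) (auto simp: mult.commute)
  qed
  have Sq: "?I (\<lambda>y. S y * cnj (q y)) = s"
  proof -
    have "?I (\<lambda>y. S y * cnj (q y)) = cnj (?I (\<lambda>y. q y * cnj (S y)))"
      by (subst cnjI[symmetric]) (simp add: mult.commute)
    then show ?thesis by (simp add: qS s)
  qed
  have "?I (\<lambda>y. of_real ((norm (q y - S y))\<^sup>2)) =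
     ?I (\<lambda>y. (q y * cnj (q y) - q y * cnj (S y)) - (S y * cnj (q y) - S y * cnj (S y)))"
    unfolding complex_norm_square by (simp add: algebra_simps)
  also have "\<dots> = (?I (\<lambda>y. q y * cnj (q y)) - ?I (\<lambda>y. q y * cnj (S y))) - (?I (\<lambda>y. S y * cnj (q y)) - ?I (\<lambda>y. S y * cnj (S y)))"
    by (subst Henstock_Kurzweil_Integration.integral_diff | intro int continuous_intros q S)+ simp
  also have "\<dots> = ?I (\<lambda>y. of_real ((norm (q y))\<^sup>2)) - s"
    unfolding qS SS Sq complex_norm_square by simp
  finally have eq: "?I (\<lambda>y. of_real ((norm (q y - S y))\<^sup>2)) = ?I (\<lambda>y. of_real ((norm (q y))\<^sup>2)) - s" .
  have "of_real (integral {-(1/2)..1/2} (\<lambda>y. (norm (q y - S y))\<^sup>2)) =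
      (of_real (integral {-(1/2)..1/2} (\<lambda>y. (norm (q y))\<^sup>2) - (\<Sum>k\<in>F. (norm (c k))\<^sup>2)) :: complex)"
  proof -
    have "?I (\<lambda>y. complex_of_real (f y)) = of_real (integral {- (1/2)..1/2} f)"
      if "continuous_on {- (1/2)..1/2} f" for f
    proof -
      have "?I (complex_of_real \<circ> f) = of_real (integral {- (1/2)..1/2} f)"
        by (rule integral_linear[OF integrable_continuous_interval[OF that] bounded_linear_of_real])
      then show ?thesis by (simp add: o_def)
    qed
    note of_real_I = this
    have c1: "continuous_on {- (1/2)..1/2} (\<lambda>y. (norm (q y - S y))\<^sup>2)" "continuous_on {- (1/2)..1/2} (\<lambda>y. (norm (q y))\<^sup>2)"
      by (intro continuous_intros q S)+
    show ?thesis using eq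
      unfolding s of_real_I[OF c1(1)] of_real_I[OF c1(2)] of_real_diff .
  qed
  then have "integral {-(1/2)..1/2} (\<lambda>y. (norm (q y - S y))\<^sup>2) =
      integral {-(1/2)..1/2} (\<lambda>y. (norm (q y))\<^sup>2) - (\<Sum>k\<in>F. (norm (c k))\<^sup>2)"
    using of_real_eq_iff by blast
  moreover have "integral {-(1/2)..1/2} (\<lambda>y. (norm (q y - S y))\<^sup>2) \<ge> 0"
    by (intro integral_nonneg integrable_continuous_interval continuous_intros q S) auto
  ultimately show ?thesis by linarith
qed

text \<open>Square summability of the coefficients; injectivity of m ensures that each is counted at
  most once.\<close>

lemma fourier_coeff_tendsto_0:
  fixes q :: "real \<Rightarrow> complex" and m :: "nat \<Rightarrow> int"
  assumes q: "continuous_on {-(1/2)..1/2} q" and m: "inj m"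
  shows "(\<lambda>n. integral {-(1/2)..1/2} (\<lambda>y. q y * fexp (- m n) y)) \<longlonglongrightarrow> 0"
proof -
  define c where "c = (\<lambda>k. integral {-(1/2)..1/2} (\<lambda>y. q y * fexp (- k) y))"
  have "summable (\<lambda>n. (norm (c (m n)))\<^sup>2)"
  proof (rule bounded_imp_summable)
    show "(\<Sum>i\<le>n. (norm (c (m i)))\<^sup>2) \<le> integral {-(1/2)..1/2} (\<lambda>y. (norm (q y))\<^sup>2)" for n
    proof -
      have "(\<Sum>i\<le>n. (norm (c (m i)))\<^sup>2) = (\<Sum>k\<in>m ` {..n}. (norm (c k))\<^sup>2)"
        using m by (subst sum.reindex) (auto intro: inj_on_subset)
      then show ?thesis using Bessel_inequality[OF q, of "m ` {..n}"] by (simp add: c_def)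
    qed
  qed simp
  then have "(\<lambda>n. (norm (c (m n)))\<^sup>2) \<longlonglongrightarrow> 0" by (rule summable_LIMSEQ_zero)
  then have "(\<lambda>n. norm (c (m n))) \<longlonglongrightarrow> 0"
    using tendsto_real_sqrt by fastforce
  then show ?thesis unfolding c_def by (rule tendsto_norm_zero_cancel)
qed

text \<open>Chernoff's argument: with \<open>g - g 0 = q * (e\<^sub>1 - 1)\<close> the Fourier coefficients of \<open>g - g 0\<close> telescope.\<close>

lemma fourier_series_at_0:
  fixes G :: "complex \<Rightarrow> complex"
  assumes G: "G holomorphic_on UNIV"
  defines "g \<equiv> (\<lambda>y::real. G (of_real y))"
  defines "c \<equiv> (\<lambda>k. integral {-(1/2)..1/2} (\<lambda>y. g y * fexp (- k) y))"
  assumes c: "c summable_on UNIV"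
  shows "(c has_sum g 0) UNIV"
proof -
  define e where "e = (\<lambda>y. fexp 1 y - 1)"
  have e0: "e y \<noteq> 0" if "y \<in> {-(1/2)..1/2}" "y \<noteq> 0" for y
  proof
    assume "e y = 0"
    then have "cos (2 * pi * y) = 1" by (simp add: e_def fexp_def complex_eq_iff)
    then obtain n :: int where "2 * pi * y = of_int n * 2 * pi" by (auto simp: cos_one_2pi_int)
    then have "y = of_int n" by simp
    then have "n = 0" using that(1) by auto
    then show False using \<open>y = of_int n\<close> that(2) by simp
  qed
  have g: "continuous_on A g" for A :: "real set"
    unfolding g_def
    by (intro continuous_on_compose2[OF holomorphic_on_imp_continuous_on[OF G]] continuous_intros) auto
  obtain g' where g': "(G has_field_derivative g') (at 0)"
    using G by (auto simp: holomorphic_on_def field_differentiable_def)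
  have of_real_at: "filterlim complex_of_real (at 0) (at 0)"
  proof (rule filterlim_atI)
    show "(complex_of_real \<longlongrightarrow> 0) (at 0)" using tendsto_of_real[OF tendsto_ident_at, of 0 UNIV] by simp
  qed (auto simp: eventually_at_filter)
  have quot: "((\<lambda>y. (H (of_real y) - H 0) / of_real y) \<longlongrightarrow> H') (at (0::real))"
    if "(H has_field_derivative H') (at 0)" for H :: "complex \<Rightarrow> complex" and H'
    using filterlim_compose[OF that[unfolded has_field_derivative_iff] of_real_at] by simp
  have "((\<lambda>z. exp (2 * pi * \<i> * z) - 1) has_field_derivative 2 * pi * \<i>) (at 0)"
    by (auto intro!: derivative_eq_intros)
  from quot[OF this] have e': "((\<lambda>y. e y / of_real y) \<longlongrightarrow> 2 * pi * \<i>) (at 0)"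
    by (simp add: e_def fexp_def cis_conv_exp mult_ac)
  \<comment> \<open>The value at 0 is the limit of the quotient, since e has derivative 2 pi i
    there. As e has no other zero on the interval, q is continuous, which is what
    \<open>fourier_coeff_tendsto_0\<close> asks for.\<close>
  define q where "q = (\<lambda>y. if y = 0 then g' / (2 * pi * \<i>) else (g y - g 0) / e y)"
  have q: "continuous_on {-(1/2)..1/2} q"
    unfolding continuous_on_def
  proof
    fix y :: real assume y: "y \<in> {-(1/2)..1/2}"
    show "(q \<longlongrightarrow> q y) (at y within {-(1/2)..1/2})"
    proof (cases "y = 0")
      case True
      have "((\<lambda>y. ((g y - g 0) / of_real y) / (e y / of_real y)) \<longlongrightarrow> g' / (2 * pi * \<i>)) (at 0)"
        using quot[OF g'] e' unfolding g_def by (intro tendsto_divide) auto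
      moreover have "\<forall>\<^sub>F y in at 0. ((g y - g 0) / of_real y) / (e y / of_real y) = q y"
        by (auto simp: eventually_at_filter q_def)
      ultimately have "(q \<longlongrightarrow> q 0) (at 0)"
        using Lim_transform_eventually by (fastforce simp: q_def)
      then show ?thesis using True by (auto intro: tendsto_within_subset)
    next
      case False
      have "((\<lambda>y. (g y - g 0) / e y) \<longlongrightarrow> (g y - g 0) / e y) (at y within {-(1/2)..1/2})"
      proof (intro tendsto_intros)
        show "(g \<longlongrightarrow> g y) (at y within {-(1/2)..1/2})" using g y by (auto simp: continuous_on_def)
        show "(e \<longlongrightarrow> e y) (at y within {-(1/2)..1/2})"
          using continuous_on_fexp[of "{-(1/2)..1/2}" 1] y unfolding e_def by (intro tendsto_intros) (auto simp: continuous_on_def)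
      qed (use e0 y False in auto)
      moreover have "\<forall>\<^sub>F z in at y within {-(1/2)..1/2}. (g z - g 0) / e z = q z"
        using eventually_neq_at_within[of 0 y "{-(1/2)..1/2}"] by eventually_elim (simp add: q_def)
      ultimately show ?thesis using False Lim_transform_eventually by (fastforce simp: q_def)
    qed
  qed
  have ge: "g y = g 0 + q y * fexp 1 y - q y" if "y \<in> {-(1/2)..1/2}" for y
  proof -
    have "q y * e y = g y - g 0" using e0[OF that] by (cases "y = 0") (auto simp: q_def e_def fexp_def)
    then show ?thesis by (simp add: e_def algebra_simps)
  qed
  define d where "d = (\<lambda>k. integral {-(1/2)..1/2} (\<lambda>y. q y * fexp (- k) y))"
  have int: "f integrable_on {-(1/2)..1/2}" if "continuous_on {-(1/2)..1/2} f" for f :: "real \<Rightarrow> complex"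
    by (rule integrable_continuous_interval[OF that])
  have cd: "c k = (if k = 0 then g 0 else 0) + (d (k - 1) - d k)" for k
  proof -
    have "c k = integral {-(1/2)..1/2} (\<lambda>y. g 0 * fexp (- k) y + (q y * fexp (- (k - 1)) y - q y * fexp (- k) y))"
      unfolding c_def
    proof (rule Henstock_Kurzweil_Integration.integral_cong)
      fix y :: real assume y: "y \<in> {-(1/2)..1/2}"
      have "q y * fexp 1 y * fexp (- k) y = q y * fexp (- (k - 1)) y"
        by (simp add: mult.assoc fexp_simps)
      then show "g y * fexp (- k) y = g 0 * fexp (- k) y + (q y * fexp (- (k - 1)) y - q y * fexp (- k) y)"
        by (subst ge[OF y]) (simp add: algebra_simps)
    qed
    also have "\<dots> = integral {-(1/2)..1/2} (\<lambda>y. g 0 * fexp (- k) y) + integral {-(1/2)..1/2} (\<lambda>y. q y * fexp (- (k - 1)) y - q y * fexp (- k) y)"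
      by (rule Henstock_Kurzweil_Integration.integral_add; intro int continuous_intros q)
    also have "integral {-(1/2)..1/2} (\<lambda>y. q y * fexp (- (k - 1)) y - q y * fexp (- k) y) = d (k - 1) - d k"
      unfolding d_def by (rule Henstock_Kurzweil_Integration.integral_diff; intro int continuous_intros q)
    also have "integral {-(1/2)..1/2} (\<lambda>y. g 0 * fexp (- k) y) = (if k = 0 then g 0 else 0)"
      by (simp add: fexp_integral)
    finally show ?thesis .
  qed
  have part: "(\<Sum>k\<in>{- int N..int N}. c k) = g 0 + d (- int N - 1) - d (int N)" for N
  proof (induction N)
    case 0
    then show ?case by (simp add: cd)
  next
    case (Suc N)
    have "{- int (Suc N)..int (Suc N)} = insert (- int (Suc N)) (insert (int (Suc N)) {- int N..int N})" by auto
    then have "(\<Sum>k\<in>{- int (Suc N)..int (Suc N)}. c k) = c (- int (Suc N)) + (c (int (Suc N)) + (\<Sum>k\<in>{- int N..int N}. c k))"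
      by (simp only: sum.insert finite_insert finite_atLeastAtMost_int) simp
    moreover have "c (- int (Suc N)) = d (- int N - 2) - d (- int N - 1)"
    proof -
      have i: "- int (Suc N) = - int N - 1" "- int N - 1 - 1 = - int N - 2" "- int N - 1 \<noteq> 0" by simp_all
      show ?thesis unfolding i(1) cd[of "- int N - 1"] i(2) using i(3) by (simp only: if_False add_0)
    qed
    moreover have "c (int (Suc N)) = d (int N) - d (int (Suc N))"
      using cd[of "int (Suc N)"] by (simp add: algebra_simps)
    moreover have "- int (Suc N) - 1 = - int N - 2" by simp
    ultimately show ?case unfolding Suc.IH by (simp only:) simp
  qed
  have "(\<lambda>N. g 0 + d (- int N - 1) - d (int N)) \<longlonglongrightarrow> g 0 + 0 - 0"
    unfolding d_def by (intro tendsto_intros fourier_coeff_tendsto_0[OF q]) (auto intro!: injI)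
  then have l1: "(\<lambda>N. \<Sum>k\<in>{- int N..int N}. c k) \<longlonglongrightarrow> g 0" unfolding part by simp
  \<comment> \<open>Symmetric partial sums tend to g 0 by telescoping. They are cofinal among finite
    sets, so the assumed summability forces the unordered sum to be g 0 too.\<close>
  have "filterlim (\<lambda>N. {- int N..int N}) (finite_subsets_at_top UNIV) sequentially"
    unfolding filterlim_finite_subsets_at_top
  proof (intro allI impI)
    fix X :: "int set" assume X: "finite X \<and> X \<subseteq> UNIV"
    define B where "B = Max (insert 0 (abs ` X))"
    have B: "\<bar>x\<bar> \<le> B" if "x \<in> X" for x using X that by (auto simp: B_def intro!: Max_ge)
    show "\<forall>\<^sub>F N in sequentially. finite {- int N..int N} \<and> X \<subseteq> {- int N..int N} \<and> {- int N..int N} \<subseteq> UNIV"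
      using eventually_ge_at_top[of "nat B"]
    proof eventually_elim
      case (elim N)
      then have "x \<in> {- int N..int N}" if "x \<in> X" for x using B[OF that] by auto
      then show ?case by auto
    qed
  qed
  moreover have "(sum c \<longlongrightarrow> infsum c UNIV) (finite_subsets_at_top UNIV)"
    using c has_sum_infsum unfolding has_sum_def by blast
  ultimately have "(\<lambda>N. \<Sum>k\<in>{- int N..int N}. c k) \<longlonglongrightarrow> infsum c UNIV"
    using filterlim_compose by blast
  with l1 have "infsum c UNIV = g 0" using LIMSEQ_unique by blast
  then show ?thesis using c has_sum_infsum by metis
qed

text \<open>A rescaling of the characteristic function of the standard normal distribution.\<close>

lemma gaussian_fourier:
  fixes x :: real and k :: int
  assumes x: "x > 0"
  shows "integrable lborel (\<lambda>u. of_real (exp (- pi * x * u\<^sup>2)) * fexp k u)" (is ?I)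
    and "(\<integral>u. of_real (exp (- pi * x * u\<^sup>2)) * fexp k u \<partial>lborel) = of_real (exp (- pi * (of_int k)\<^sup>2 / x) / sqrt x)" (is ?V)
proof -
  \<comment> \<open>Under v = a u the density exponent -v^2 / 2 becomes -pi x u^2; the frequency t
    below is fixed by t a = 2 pi k.\<close>
  define a where "a = sqrt (2 * pi * x)"
  have a: "a > 0" "a\<^sup>2 = 2 * pi * x" using x by (auto simp: a_def)
  define t where "t = 2 * pi * of_int k / a"
  let ?d = "\<lambda>v. of_real (std_normal_density v) * iexp (t * v)"
  have d: "?d (0 + a * u) = of_real (1 / sqrt (2 * pi)) * (of_real (exp (- pi * x * u\<^sup>2)) * fexp k u)" for u
  proof -
    have "- (a * u)\<^sup>2 / 2 = - pi * x * u\<^sup>2" by (simp add: power_mult_distrib a(2))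
    moreover have "t * (a * u) = 2 * pi * of_int k * u" using a by (simp add: t_def)
    moreover have "?d (0 + a * u) = of_real (1 / sqrt (2 * pi)) * (of_real (exp (- (a * u)\<^sup>2 / 2)) * cis (t * (a * u)))"
      by (simp add: std_normal_density_def cis_conv_exp mult_ac)
    ultimately show ?thesis by (simp only: fexp_def)
  qed
  have int: "integrable lborel ?d"
  proof -
    have "integrable lborel std_normal_density" by simp
    then have "integrable lborel (\<lambda>v. complex_of_real (std_normal_density v))" by (rule integrable_of_real)
    then show ?thesis by (rule Bochner_Integration.integrable_bound) (auto simp: norm_mult)
  qed
  have val: "(\<integral>v. ?d v \<partial>lborel) = of_real (exp (- (t\<^sup>2) / 2))"
    using fun_cong[OF char_std_normal_distribution, of t] unfolding char_def
    by (subst (asm) integral_density) (auto simp: scaleR_conv_of_real normal_density_nonneg)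
  have "integrable lborel (\<lambda>u. ?d (0 + a * u))" using a by (intro lborel_integrable_real_affine int) auto
  then have "integrable lborel (\<lambda>u. of_real (sqrt (2 * pi)) * ?d (0 + a * u))" by (rule integrable_mult_right)
  moreover have "of_real (sqrt (2 * pi)) * (of_real (1 / sqrt (2 * pi)) * w) = w" for w :: complex
    by (simp add: mult.assoc[symmetric] of_real_mult[symmetric] del: of_real_mult)
  ultimately show ?I unfolding d by (simp only:)
  have "(\<integral>v. ?d v \<partial>lborel) = \<bar>a\<bar> *\<^sub>R (\<integral>u. ?d (0 + a * u) \<partial>lborel)"
    using a by (intro lborel_integral_real_affine) auto
  then have "of_real (exp (- (t\<^sup>2) / 2)) = of_real (a / sqrt (2 * pi)) * (\<integral>u. of_real (exp (- pi * x * u\<^sup>2)) * fexp k u \<partial>lborel)"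
    unfolding val d using a by (simp add: scaleR_conv_of_real)
  moreover have "a / sqrt (2 * pi) = sqrt x" by (simp add: a_def real_sqrt_mult)
  moreover have "- (t\<^sup>2) / 2 = - pi * (of_int k)\<^sup>2 / x"
    using x by (simp add: t_def power_divide a(2) power_mult_distrib) (simp add: power2_eq_square field_simps)
  ultimately have "of_real (exp (- pi * (of_int k)\<^sup>2 / x)) = of_real (sqrt x) * (\<integral>u. of_real (exp (- pi * x * u\<^sup>2)) * fexp k u \<partial>lborel)"
    by (simp only:)
  then show ?V using x by (simp only: of_real_divide) simp
qed

section \<open>Periodised Gaussians\<close>

lemma summable_on_int:
  fixes f :: "int \<Rightarrow> 'a :: topological_comm_monoid_add"
  assumes "(\<lambda>n. f (int n)) summable_on UNIV" "(\<lambda>n. f (- int (Suc n))) summable_on UNIV"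
  shows "f summable_on UNIV"
proof -
  have "f summable_on (range int)" "f summable_on (range (\<lambda>n. - int (Suc n)))"
    using assms by (auto simp: summable_on_reindex inj_on_def o_def)
  moreover have "range int \<inter> range (\<lambda>n. - int (Suc n)) = {}" by auto
  ultimately have "f summable_on (range int \<union> range (\<lambda>n. - int (Suc n)))" by (rule summable_on_Un_disjoint)
  moreover have "range int \<union> range (\<lambda>n. - int (Suc n)) = UNIV"
  proof -
    have "n \<in> range int \<union> range (\<lambda>n. - int (Suc n))" for n
      by (cases n) auto
    then show ?thesis by auto
  qed
  ultimately show ?thesis by simp
qed

lemma gaussian_summable_int:
  fixes r x :: real
  assumes x: "x > 0"
  shows "(\<lambda>n::int. exp (r * of_int n - x * (of_int n)\<^sup>2)) summable_on UNIV"
proof (rule summable_on_comparison_test)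
  \<comment> \<open>The maximum of (|r| + 1) m - x m^2 over real m; the extra 1 is what leaves the
    factor e^(-|n|).\<close>
  define C where "C = (\<bar>r\<bar> + 1)\<^sup>2 / (4 * x)"
  have e: "(\<lambda>n::nat. exp (- real n)) summable_on UNIV"
  proof -
    have "summable (\<lambda>n. (exp (- 1 :: real)) ^ n)" by (rule summable_geometric) simp
    then have "summable (\<lambda>n. exp (- real n))" by (simp add: exp_of_nat_mult[symmetric])
    then show ?thesis by (subst summable_on_UNIV_nonneg_real_iff) auto
  qed
  have e': "(\<lambda>n::nat. exp (- real (Suc n))) summable_on UNIV"
  proof -
    have "(\<lambda>n::nat. exp (- real n) * exp (- 1)) summable_on UNIV" by (intro summable_on_cmult_left e)
    moreover have "exp (- real (Suc n)) = exp (- real n) * exp (- 1)" for n by (simp add: mult_exp_exp)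
    ultimately show ?thesis by (simp only:)
  qed
  have "(\<lambda>n::int. exp (- \<bar>of_int n :: real\<bar>)) summable_on UNIV"
  proof (rule summable_on_int)
    have "\<bar>of_int (int n) :: real\<bar> = real n" "\<bar>of_int (- int (Suc n)) :: real\<bar> = real (Suc n)" for n by simp_all
    then show "(\<lambda>n. exp (- \<bar>of_int (int n) :: real\<bar>)) summable_on UNIV"
      "(\<lambda>n. exp (- \<bar>of_int (- int (Suc n)) :: real\<bar>)) summable_on UNIV"
      using e e' by (simp_all only:)
  qed
  then show "(\<lambda>n::int. exp C * exp (- \<bar>of_int n :: real\<bar>)) summable_on UNIV" by (rule summable_on_cmult_right)
  fix n :: int
  have "r * m - x * m\<^sup>2 \<le> C - \<bar>m\<bar>" for m :: real
  proof -
    have "(\<bar>r\<bar> + 1) * n - x * n\<^sup>2 \<le> C" for n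
    proof -
      have "0 \<le> (2 * x * n - (\<bar>r\<bar> + 1))\<^sup>2" by simp
      then have "4 * x * ((\<bar>r\<bar> + 1) * n - x * n\<^sup>2) \<le> (\<bar>r\<bar> + 1)\<^sup>2"
        by (simp add: power2_eq_square algebra_simps)
      then show ?thesis using x by (simp add: C_def field_simps)
    qed
    from this[of "\<bar>m\<bar>"] have "(\<bar>r\<bar> + 1) * \<bar>m\<bar> - x * m\<^sup>2 \<le> C" by simp
    moreover have "r * m \<le> \<bar>r\<bar> * \<bar>m\<bar>" by (metis abs_ge_self abs_mult)
    ultimately show ?thesis by (simp add: algebra_simps)
  qed
  then show "exp (r * of_int n - x * (of_int n)\<^sup>2) \<le> exp C * exp (- \<bar>of_int n :: real\<bar>)"
    by (simp add: exp_add[symmetric])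
qed auto

text \<open>Expanding (n + y)^2 writes the periodised Gaussian as e^(-pi x y^2) times a series of
  exponentials in y, hence as an entire function G. Its Fourier coefficients unfold to the Fourier
  transform of a single Gaussian, and their sum is G 0.\<close>

lemma theta_poisson:
  fixes x :: real
  assumes x: "x > 0"
  shows "((\<lambda>k::int. complex_of_real (exp (- pi * (of_int k)\<^sup>2 / x) / sqrt x)) has_sum
    (\<Sum>\<^sub>\<infinity>n::int. of_real (exp (- pi * (of_int n)\<^sup>2 * x)))) UNIV"
proof -
  define f where "f = (\<lambda>u::real. exp (- pi * x * u\<^sup>2))"
  define G where "G = (\<lambda>z::complex. exp (of_real (- pi * x) * z\<^sup>2) * (\<Sum>\<^sub>\<infinity>n::int. exp (z * of_real (- 2 * pi * x * of_int n)) * of_real (f (of_int n))))"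
  have sum: "(\<lambda>n::int. exp (of_real (r * (- 2 * pi * x * of_int n))) * complex_of_real (f (of_int n))) summable_on UNIV" for r
  proof -
    have "(\<lambda>n::int. exp ((- 2 * pi * x * r) * of_int n - (pi * x) * (of_int n)\<^sup>2)) summable_on UNIV"
      by (rule gaussian_summable_int) (use x in auto)
    then have "(\<lambda>n::int. complex_of_real (exp ((- 2 * pi * x * r) * of_int n - (pi * x) * (of_int n)\<^sup>2))) summable_on UNIV"
      by (rule summable_on_of_real)
    moreover have "exp (of_real (r * (- 2 * pi * x * of_int n))) * complex_of_real (f (of_int n)) =
        complex_of_real (exp ((- 2 * pi * x * r) * of_int n - (pi * x) * (of_int n)\<^sup>2))" for n
    proof -
      have "exp (of_real (r * (- 2 * pi * x * of_int n))) * complex_of_real (f (of_int n)) =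
        complex_of_real (exp (r * (- 2 * pi * x * of_int n) + - pi * x * (of_int n)\<^sup>2))"
        by (simp only: f_def exp_of_real of_real_mult[symmetric] exp_add)
      also have "r * (- 2 * pi * x * of_int n) + - pi * x * (of_int n)\<^sup>2 = (- 2 * pi * x * r) * of_int n - (pi * x) * (of_int n)\<^sup>2"
        by (simp add: algebra_simps)
      finally show ?thesis .
    qed
    ultimately show ?thesis by (simp only:)
  qed
  have G: "G holomorphic_on UNIV"
    using dirichlet_holomorphic[OF open_UNIV sum] unfolding G_def by (intro holomorphic_intros) simp_all
  have Gsum: "((\<lambda>n::int. of_real (f (of_int n + y))) has_sum G (of_real y)) UNIV" for y :: real
  proof -
    have "((\<lambda>n::int. exp (of_real y * of_real (- 2 * pi * x * of_int n)) * complex_of_real (f (of_int n))) has_sum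
       (\<Sum>\<^sub>\<infinity>n::int. exp (of_real y * of_real (- 2 * pi * x * of_int n)) * of_real (f (of_int n)))) UNIV"
      using sum[of y] by (intro has_sum_infsum) simp
    then have "((\<lambda>n::int. exp (of_real (- pi * x) * (of_real y)\<^sup>2) * (exp (of_real y * of_real (- 2 * pi * x * of_int n)) * complex_of_real (f (of_int n)))) has_sum
       G (of_real y)) UNIV" unfolding G_def by (rule has_sum_cmult_right)
    moreover have "exp (of_real (- pi * x) * (of_real y)\<^sup>2) * (exp (of_real y * of_real (- 2 * pi * x * of_int n)) * complex_of_real (f (of_int n))) = of_real (f (of_int n + y))" for n :: int
    proof -
      have "exp (of_real (- pi * x) * (of_real y)\<^sup>2) = complex_of_real (exp (- pi * x * y\<^sup>2))"
        "exp (of_real y * of_real (- 2 * pi * x * of_int n)) = complex_of_real (exp (y * (- 2 * pi * x * of_int n)))"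
        by (simp_all only: exp_of_real[symmetric] of_real_mult of_real_power)
      moreover have "- pi * x * y\<^sup>2 + (y * (- 2 * pi * x * of_int n) + - pi * x * (of_int n)\<^sup>2) = - pi * x * (of_int n + y)\<^sup>2"
        by (simp add: power2_eq_square algebra_simps)
      ultimately show ?thesis
        by (simp only: f_def of_real_mult[symmetric] exp_add[symmetric])
    qed
    ultimately show ?thesis by simp
  qed
  define c where "c = (\<lambda>k. integral {-(1/2)..1/2} (\<lambda>y. G (of_real y) * fexp (- k) y))"
  have ck: "c k = of_real (exp (- pi * (of_int k)\<^sup>2 / x) / sqrt x)" for k
  proof -
    \<comment> \<open>Half-open, so that its integer translates tile the line without
      overlap.\<close>
    let ?J = "{-(1/2)..<1/2::real}"
    let ?h = "\<lambda>(n::int) y. indicat_real ?J y *\<^sub>R (of_real (f (of_int n + y)) * fexp (- k) y)"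
    let ?h' = "\<lambda>(n::int) u. indicat_real ?J (u - of_int n) *\<^sub>R (of_real (f u) * fexp (- k) u)"
    have m [measurable]: "fexp k \<in> borel_measurable borel" for k
      by (intro borel_measurable_continuous_onI continuous_intros)
    have f [measurable]: "f \<in> borel_measurable borel" unfolding f_def by measurable
    have fi: "integrable lborel (\<lambda>u. of_real (f u) * fexp (- k) u)"
      using gaussian_fourier(1)[OF x] by (simp add: f_def)
    have int': "integrable lborel (?h' n)" for n
      by (rule Bochner_Integration.integrable_bound[OF fi]) (auto simp: indicator_def)
    have fper: "fexp (- k) (y + of_int n) = fexp (- k) y" for n y
    proof -
      have "fexp (- k) (y + of_int n) = fexp (- k) y * cis (2 * pi * of_int (- k * n))"
        by (simp add: fexp_def cis_mult algebra_simps)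
      moreover have "cis (2 * pi * of_int (- k * n)) = 1" by (rule cis_multiple_2pi) (rule Ints_of_int)
      ultimately show ?thesis by (simp only: mult_1_right)
    qed
    have sh: "?h' n (of_int n + 1 * y) = ?h n y" for n y
      using fper[of y n] by (simp add: add.commute)
    have int: "integrable lborel (?h n)" for n
      using lborel_integrable_real_affine[OF int'[of n], of 1 "of_int n"] unfolding sh by simp
    have val: "(\<integral>y. ?h n y \<partial>lborel) = (\<integral>u. ?h' n u \<partial>lborel)" for n
      using lborel_integral_real_affine[of 1 "?h' n" "of_int n"] unfolding sh by simp
    have nval: "(\<integral>y. norm (?h n y) \<partial>lborel) = (\<integral>u. norm (?h' n u) \<partial>lborel)" for n
      using lborel_integral_real_affine[of 1 "\<lambda>u. norm (?h' n u)" "of_int n"] unfolding sh by simp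
    have ns: "(\<lambda>n. \<integral>y. norm (?h n y) \<partial>lborel) summable_on UNIV"
    proof (rule summable_on_comparison_test)
      \<comment> \<open>For |y| \<le> 1/2 one has (n + y)^2 \<ge> n^2 - |n|; the two exponentials
        cover the two signs of n.\<close>
      show "(\<lambda>n::int. exp (pi * x * of_int n - pi * x * (of_int n)\<^sup>2) + exp (- pi * x * of_int n - pi * x * (of_int n)\<^sup>2)) summable_on UNIV"
        by (intro summable_on_add gaussian_summable_int) (use x in auto)
      fix n :: int
      let ?B = "exp (pi * x * of_int n - pi * x * (of_int n)\<^sup>2) + exp (- pi * x * of_int n - pi * x * (of_int n)\<^sup>2)"
      have "(\<integral>y. norm (?h n y) \<partial>lborel) \<le> (\<integral>y. indicat_real ?J y *\<^sub>R ?B \<partial>lborel)"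
      proof (rule integral_mono[OF integrable_norm[OF int]])
        show "norm (?h n y) \<le> indicat_real ?J y *\<^sub>R ?B" for y
        proof (cases "y \<in> ?J")
          case True
          have "(of_int n + y)\<^sup>2 \<ge> (of_int n)\<^sup>2 - \<bar>of_int n\<bar>"
          proof -
            have y: "2 * \<bar>y\<bar> \<le> 1" using True by (simp add: abs_le_iff) linarith
            have "\<bar>2 * of_int n * y\<bar> = \<bar>of_int n\<bar> * (2 * \<bar>y\<bar>)" by (simp add: abs_mult)
            also have "\<dots> \<le> \<bar>of_int n\<bar> * 1" using y by (rule mult_left_mono) simp
            finally have "\<bar>2 * of_int n * y\<bar> \<le> \<bar>of_int n\<bar>" by simp
            then have "2 * of_int n * y \<ge> - \<bar>of_int n\<bar>" by linarith
            then show ?thesis by (simp add: power2_eq_square algebra_simps) (smt (verit) zero_le_square)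
          qed
          then have "f (of_int n + y) \<le> exp (- pi * x * ((of_int n)\<^sup>2 - \<bar>of_int n\<bar>))"
            using x by (simp add: f_def)
          also have "\<dots> \<le> ?B" by (cases "n \<ge> 0") (simp_all add: algebra_simps)
          finally show ?thesis using True by (simp add: f_def norm_mult fexp_def)
        qed simp
      qed simp
      then show "(\<integral>y. norm (?h n y) \<partial>lborel) \<le> ?B" by simp
    qed auto
    have cc: "countable (UNIV :: int set)" by simp
    \<comment> \<open>Unfolding: the same integrals are summed over one period here, giving the
      coefficient of G, and over the whole line in \<open>B\<close>, giving the transform of one
      Gaussian.\<close>
    have A: "((\<lambda>n. \<integral>y. ?h n y \<partial>lborel) has_sum (\<integral>y. indicat_real ?J y *\<^sub>R (G (of_real y) * fexp (- k) y) \<partial>lborel)) UNIV"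
    proof (rule has_sum_integral(2)[OF cc lborel.sigma_finite_measure_axioms int ns])
      show "((\<lambda>n. ?h n y) has_sum indicat_real ?J y *\<^sub>R (G (of_real y) * fexp (- k) y)) UNIV" for y
        using has_sum_cmult_left[OF Gsum[of y], of "indicat_real ?J y *\<^sub>R fexp (- k) y"]
        by (simp add: scaleR_conv_of_real mult_ac)
    qed
    have B: "((\<lambda>n. \<integral>u. ?h' n u \<partial>lborel) has_sum (\<integral>u. of_real (f u) * fexp (- k) u \<partial>lborel)) UNIV"
    proof (rule has_sum_integral(2)[OF cc lborel.sigma_finite_measure_axioms int'])
      show "(\<lambda>n. \<integral>u. norm (?h' n u) \<partial>lborel) summable_on UNIV" using ns unfolding nval .
      show "((\<lambda>n. ?h' n u) has_sum (of_real (f u) * fexp (- k) u)) UNIV" for u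
      proof -
        \<comment> \<open>Rounding u to the nearest integer finds the only translate of the interval
          that contains u.\<close>
        define m where "m = \<lfloor>u + 1/2\<rfloor>"
        have s: "sum (\<lambda>n. ?h' n u) {m} = ?h' m u" by (subst sum.insert) auto
        have "((\<lambda>n. ?h' n u) has_sum ?h' m u) {m}"
          using has_sum_finite[of "{m}" "\<lambda>n. ?h' n u"] unfolding s by blast
        moreover have "?h' m u = of_real (f u) * fexp (- k) u"
          unfolding m_def by (simp add: indicator_def) linarith
        moreover have "?h' n u = 0" if "n \<notin> {m}" for n
        proof -
          have "u - of_int n \<notin> ?J"
          proof
            assume "u - of_int n \<in> ?J"
            then have "of_int n \<le> u + 1/2" "u + 1/2 < of_int n + 1" by auto
            then have "\<lfloor>u + 1/2\<rfloor> = n" by (simp add: floor_eq_iff)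
            then show False using that by (simp add: m_def)
          qed
          then show ?thesis by simp
        qed
        ultimately show ?thesis
          using has_sum_cong_neutral[of UNIV "{m}" "\<lambda>n. ?h' n u" "\<lambda>n. ?h' n u" "?h' m u"] by (simp only: Diff_iff) simp
      qed
    qed
    have "(\<integral>y. indicat_real ?J y *\<^sub>R (G (of_real y) * fexp (- k) y) \<partial>lborel) = (\<integral>u. of_real (f u) * fexp (- k) u \<partial>lborel)"
      using has_sum_unique[OF A[unfolded val] B] .
    also have "\<dots> = of_real (exp (- pi * (of_int k)\<^sup>2 / x) / sqrt x)"
      using gaussian_fourier(2)[OF x, of "-k"] by (simp add: f_def)
    also have "(\<integral>y. indicat_real ?J y *\<^sub>R (G (of_real y) * fexp (- k) y) \<partial>lborel) =
       (LBINT y:{-(1/2)..1/2}. G (of_real y) * fexp (- k) y)"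
      unfolding set_lebesgue_integral_def
    proof (rule integral_cong_AE)
      have [measurable]: "(\<lambda>y. G (of_real y)) \<in> borel_measurable borel"
        by (intro borel_measurable_continuous_onI continuous_on_compose2[OF holomorphic_on_imp_continuous_on[OF G]] continuous_intros) auto
      show "(\<lambda>y. indicat_real ?J y *\<^sub>R (G (of_real y) * fexp (- k) y)) \<in> borel_measurable lborel"
        "(\<lambda>y. indicat_real {-(1/2)..1/2} y *\<^sub>R (G (of_real y) * fexp (- k) y)) \<in> borel_measurable lborel" by measurable
      show "AE y in lborel. indicat_real ?J y *\<^sub>R (G (of_real y) * fexp (- k) y) = indicat_real {-(1/2)..1/2} y *\<^sub>R (G (of_real y) * fexp (- k) y)"
        using AE_lborel_singleton[of "1/2"] by eventually_elim (auto simp: indicator_def)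
    qed
    also have "\<dots> = c k"
      unfolding c_def
    proof (rule set_borel_integral_eq_integral(2))
      show "set_integrable lborel {-(1/2)..1/2} (\<lambda>y. G (of_real y) * fexp (- k) y)"
        by (intro borel_integrable_atLeastAtMost' continuous_intros continuous_on_compose2[OF holomorphic_on_imp_continuous_on[OF G]]) auto
    qed
    finally show ?thesis by simp
  qed
  have "(\<lambda>k::int. exp (0 * of_int k - pi / x * (of_int k)\<^sup>2)) summable_on UNIV"
    by (rule gaussian_summable_int) (use x in auto)
  then have "(\<lambda>k::int. of_real (exp (- pi * (of_int k)\<^sup>2 / x)) * complex_of_real (1 / sqrt x)) summable_on UNIV"
    by (intro summable_on_cmult_left summable_on_of_real) simp
  then have "c summable_on UNIV" unfolding ck by simp
  then have "(c has_sum G (of_real 0)) UNIV"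
    unfolding c_def by (rule fourier_series_at_0[OF G])
  moreover have "G (of_real 0) = (\<Sum>\<^sub>\<infinity>n::int. of_real (exp (- pi * (of_int n)\<^sup>2 * x)))"
    using infsumI[OF Gsum[of 0]] by (simp add: f_def mult_ac)
  ultimately show ?thesis unfolding ck[abs_def] by simp
qed

section \<open>Theta series over sieved integers\<close>

lemma has_sum_int_even:
  fixes f :: "int \<Rightarrow> complex"
  assumes s: "((\<lambda>n. f (int n)) has_sum s) {1..}" and even: "\<And>n. f (- n) = f n"
  shows "(f has_sum f 0 + 2 * s) UNIV"
proof -
  have p: "(f has_sum s) (int ` {1..})"
    by (subst has_sum_reindex) (use s in \<open>auto simp: o_def inj_on_def\<close>)
  have m: "(f has_sum s) ((\<lambda>n. - int n) ` {1..})"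
    by (subst has_sum_reindex) (use s even in \<open>auto simp: o_def inj_on_def\<close>)
  have "(f has_sum f 0) {0}" using has_sum_finite[of "{0}" f] by simp
  then have "(f has_sum f 0 + (s + s)) ({0} \<union> (int ` {1..} \<union> (\<lambda>n. - int n) ` {1..}))"
    by (intro has_sum_Un_disjoint p m) auto
  moreover have "{0} \<union> (int ` {1..} \<union> (\<lambda>n. - int n) ` {1..}) = UNIV"
  proof -
    have "n \<in> {0} \<union> (int ` {1..} \<union> (\<lambda>n. - int n) ` {1..})" for n
    proof (cases n rule: int_cases3)
      case (pos m)
      then have "n = int m" "m \<in> {1..}" by auto
      then show ?thesis by (metis UnI1 UnI2 imageI)
    next
      case (neg m)
      then have n: "n = - int m" "m \<in> {1..}" by auto
      have "- int m \<in> (\<lambda>n. - int n) ` {1..}" using n(2) by (rule imageI)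
      then show ?thesis unfolding n(1) by blast
    qed simp
    then show ?thesis by auto
  qed
  ultimately show ?thesis by (simp only: mult_2)
qed

text \<open>Phrased by single primes instead of their product, so that induction can insert one
  prime at a time starting from P = {}. For primes it contains 1, unlike
  \<open>coprime_indices\<close>.\<close>

definition sieved :: "nat set \<Rightarrow> nat set" where
  "sieved P = {n. 1 \<le> n \<and> (\<forall>p\<in>P. \<not> p dvd n)}"

lemma sieved_empty: "sieved {} = {1..}"
  by (auto simp: sieved_def)

lemma sieved_ge: "n \<in> sieved P \<Longrightarrow> n \<ge> 1"
  by (simp add: sieved_def)

text \<open>As p is a prime outside P, the multiples of p among the sieved numbers are exactly p
  times the sieved numbers. The theta series and the Dirichlet series are both sieved through
  this.\<close>

lemma infsum_sieved_insert:
  fixes f :: "nat \<Rightarrow> complex"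
  assumes f: "f summable_on sieved P" and P: "\<And>q. q \<in> P \<Longrightarrow> prime q" and p: "prime p" "p \<notin> P"
  shows "infsum f (sieved (insert p P)) = infsum f (sieved P) - (\<Sum>\<^sub>\<infinity>n\<in>sieved P. f (p * n))"
proof -
  have un: "sieved P = sieved (insert p P) \<union> (\<lambda>n. p * n) ` sieved P"
  proof (intro equalityI subsetI)
    fix n assume n: "n \<in> sieved P"
    show "n \<in> sieved (insert p P) \<union> (\<lambda>n. p * n) ` sieved P"
    proof (cases "p dvd n")
      case True
      then obtain m where m: "n = p * m" by (elim dvdE)
      have "\<not> q dvd m" if "q \<in> P" for q
        using n that dvd_mult[of q m p] by (auto simp: sieved_def m)
      moreover have "m \<ge> 1" using n by (cases m) (auto simp: sieved_def m)
      ultimately have "m \<in> sieved P" by (simp add: sieved_def)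
      then show ?thesis unfolding m by blast
    qed (use n in \<open>auto simp: sieved_def\<close>)
  next
    fix n assume "n \<in> sieved (insert p P) \<union> (\<lambda>n. p * n) ` sieved P"
    moreover have "\<not> q dvd p * m" if "q \<in> P" "\<not> q dvd m" for q m
      using that P[of q] p by (metis prime_dvd_mult_iff primes_dvd_imp_eq)
    ultimately show "n \<in> sieved P"
      using prime_ge_1_nat[OF p(1)] by (auto simp: sieved_def)
  qed
  have disj: "sieved (insert p P) \<inter> (\<lambda>n. p * n) ` sieved P = {}" by (auto simp: sieved_def)
  have sub: "f summable_on sieved (insert p P)" "f summable_on (\<lambda>n. p * n) ` sieved P"
    by (rule summable_on_subset_banach[OF f]; use un in blast)+
  have "infsum f (sieved P) = infsum f (sieved (insert p P)) + infsum f ((\<lambda>n. p * n) ` sieved P)"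
    by (subst un, rule infsum_Un_disjoint[OF sub disj])
  also have "infsum f ((\<lambda>n. p * n) ` sieved P) = (\<Sum>\<^sub>\<infinity>n\<in>sieved P. f (p * n))"
    using p by (subst infsum_reindex) (auto simp: inj_on_def o_def)
  finally show ?thesis by simp
qed

text \<open>Scaling by a positive real keeps the argument, so the principal logarithm just gains
  x.\<close>

lemma powr_times_exp:
  fixes w a :: complex and x :: real
  assumes "w \<noteq> 0"
  shows "(w * of_real (exp x)) powr a = w powr a * exp (a * of_real x)"
proof -
  have "Ln (w * of_real (exp x)) = Ln w + of_real x"
    using Ln_times_of_real[of "exp x" w] Ln_of_real[of "exp x"] assms by (simp add: mult.commute)
  then show ?thesis using assms by (simp add: powr_def distrib_left exp_add)
qed

section \<open>The sieved theta series near 0 and near infinity\<close>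

lemma inverse_square_summable: "(\<lambda>n::nat. 1 / (real n)\<^sup>2) summable_on A"
proof -
  have "summable (\<lambda>n::nat. 1 / (real n)\<^sup>2)"
    using inverse_power_summable[of 2, where 'a = real] by (simp add: inverse_eq_divide)
  then have "(\<lambda>n::nat. 1 / (real n)\<^sup>2) summable_on UNIV" by (subst summable_on_UNIV_nonneg_real_iff) auto
  then show ?thesis by (rule summable_on_subset_banach) simp
qed

text \<open>From y^M / M! \<le> e^y with y = pi n^2 r. Of (pi n^2)^M only n^2 is kept, enough to sum
  over n, while the full power of r survives.\<close>

lemma gaussian_term_le:
  fixes r :: real
  assumes r: "r > 0" and n: "n \<ge> (1::nat)" and M: "M \<ge> 1"
  shows "exp (- (pi * (real n)\<^sup>2) * r) \<le> fact M / r ^ M * (1 / (real n)\<^sup>2)"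
proof -
  define y where "y = pi * (real n)\<^sup>2 * r"
  have n1: "(real n)\<^sup>2 \<ge> 1" using n by simp
  have y: "y > 0" using r n by (simp add: y_def)
  have "y ^ M / fact M \<le> exp y"
  proof -
    have "(\<Sum>k\<in>{M}. y ^ k /\<^sub>R fact k) \<le> (\<Sum>k. y ^ k /\<^sub>R fact k)"
      using y summable_exp_generic[of y] by (intro sum_le_suminf) auto
    then show ?thesis by (simp add: exp_def divide_inverse mult.commute)
  qed
  then have "exp (- y) \<le> fact M / y ^ M" using y by (simp add: exp_minus field_simps)
  also have "\<dots> \<le> fact M / (r ^ M * (real n)\<^sup>2)"
  proof (rule divide_left_mono)
    have "(real n)\<^sup>2 * 1 \<le> (real n)\<^sup>2 * pi" using pi_gt3 by (intro mult_left_mono) auto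
    then have pn: "(real n)\<^sup>2 \<le> pi * (real n)\<^sup>2" by (simp add: mult.commute)
    also have "(pi * (real n)\<^sup>2) ^ 1 \<le> (pi * (real n)\<^sup>2) ^ M" using M pn n1 by (intro power_increasing) auto
    then have "pi * (real n)\<^sup>2 \<le> (pi * (real n)\<^sup>2) ^ M" by simp
    finally have "(real n)\<^sup>2 \<le> (pi * (real n)\<^sup>2) ^ M" .
    then have "r ^ M * (real n)\<^sup>2 \<le> r ^ M * (pi * (real n)\<^sup>2) ^ M"
      by (rule mult_left_mono) (use r in simp)
    then show "r ^ M * (real n)\<^sup>2 \<le> y ^ M"
      by (simp add: y_def power_mult_distrib mult_ac)
  qed (use r y n in auto)
  finally show ?thesis by (simp add: y_def)
qed

text \<open>For P = {} this is (theta - 1) / 2, where theta is the sum of e^(-pi n^2 z) over all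
  integers n.\<close>

definition psi :: "nat set \<Rightarrow> complex \<Rightarrow> complex" where
  "psi P z = (\<Sum>\<^sub>\<infinity>n\<in>sieved P. exp (- (of_real (pi * (real n)\<^sup>2) * z)))"

lemma psi_summable_bound:
  assumes z: "Re z > 0" and M: "M \<ge> 1"
  shows "(\<lambda>n. norm (exp (- (of_real (pi * (real n)\<^sup>2) * z)))) summable_on sieved P"
    and "(\<Sum>\<^sub>\<infinity>n\<in>sieved P. norm (exp (- (of_real (pi * (real n)\<^sup>2) * z)))) \<le> fact M / Re z ^ M * (\<Sum>\<^sub>\<infinity>n::nat. 1 / (real n)\<^sup>2)"
proof -
  have le: "norm (exp (- (of_real (pi * (real n)\<^sup>2) * z))) \<le> fact M / Re z ^ M * (1 / (real n)\<^sup>2)" if "n \<in> sieved P" for n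
    using gaussian_term_le[OF z sieved_ge[OF that] M] by simp
  have s: "(\<lambda>n::nat. fact M / Re z ^ M * (1 / (real n)\<^sup>2)) summable_on A" for A
    by (intro summable_on_cmult_right inverse_square_summable)
  show i: "(\<lambda>n. norm (exp (- (of_real (pi * (real n)\<^sup>2) * z)))) summable_on sieved P"
    by (rule summable_on_comparison_test[OF s le]) auto
  have "(\<Sum>\<^sub>\<infinity>n\<in>sieved P. norm (exp (- (of_real (pi * (real n)\<^sup>2) * z)))) \<le> (\<Sum>\<^sub>\<infinity>n::nat. fact M / Re z ^ M * (1 / (real n)\<^sup>2))"
    by (rule infsum_mono_neutral[OF i s]) (use le z in auto)
  then show "(\<Sum>\<^sub>\<infinity>n\<in>sieved P. norm (exp (- (of_real (pi * (real n)\<^sup>2) * z)))) \<le> fact M / Re z ^ M * (\<Sum>\<^sub>\<infinity>n::nat. 1 / (real n)\<^sup>2)"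
    by (subst (asm) infsum_cmult_right') simp
qed

lemma psi_has_sum:
  assumes z: "Re z > 0"
  shows "((\<lambda>n. exp (- (of_real (pi * (real n)\<^sup>2) * z))) has_sum psi P z) (sieved P)"
  unfolding psi_def by (rule has_sum_infsum, rule abs_summable_summable, rule psi_summable_bound(1)[OF z, of 1]) simp

lemma psi_norm_le:
  assumes z: "Re z > 0" and M: "M \<ge> 1"
  shows "norm (psi P z) \<le> fact M / Re z ^ M * (\<Sum>\<^sub>\<infinity>n::nat. 1 / (real n)\<^sup>2)"
  using norm_infsum_bound[OF psi_summable_bound(1)[OF z, of 1 P]] psi_summable_bound(2)[OF z M, of P]
  by (simp add: psi_def)

lemma psi_holomorphic: "psi P holomorphic_on {z. Re z > 0}"
proof -
  have eq: "exp (z * of_real (- (pi * (real n)\<^sup>2))) * 1 = exp (- (of_real (pi * (real n)\<^sup>2) * z))" for z :: complex and n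
    by (simp add: mult.commute)
  have "(\<lambda>z. \<Sum>\<^sub>\<infinity>n\<in>sieved P. exp (z * of_real (- (pi * (real n)\<^sup>2))) * 1) holomorphic_on {z. Re z \<in> {0<..}}"
  proof (rule dirichlet_holomorphic)
    fix r :: real assume "r \<in> {0<..}"
    then have "(\<lambda>n. exp (of_real r * of_real (- (pi * (real n)\<^sup>2))) * (1 :: complex)) summable_on sieved P"
      unfolding eq using psi_has_sum[of "of_real r" P] by (auto simp: summable_on_def)
    then show "(\<lambda>n. exp (of_real (r * - (pi * (real n)\<^sup>2))) * (1 :: complex)) summable_on sieved P" by simp
  qed simp
  then show ?thesis unfolding eq psi_def by simp
qed

lemma psi_insert:
  assumes z: "Re z > 0" and P: "\<And>q. q \<in> P \<Longrightarrow> prime q" and p: "prime p" "p \<notin> P"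
  shows "psi (insert p P) z = psi P z - psi P ((of_nat p)\<^sup>2 * z)"
proof -
  have "(\<lambda>n. exp (- (of_real (pi * (real n)\<^sup>2) * z))) summable_on sieved P"
    using psi_has_sum[OF z, of P] by (auto simp: summable_on_def)
  note infsum_sieved_insert[OF this P p]
  moreover have "exp (- (of_real (pi * (real (p * n))\<^sup>2) * z)) = exp (- (of_real (pi * (real n)\<^sup>2) * ((of_nat p)\<^sup>2 * z)))" for n
    by (simp add: power_mult_distrib mult_ac)
  ultimately show ?thesis unfolding psi_def by (simp only:)
qed

lemma theta_has_sum:
  fixes x :: real
  assumes x: "x > 0"
  shows "((\<lambda>n::int. of_real (exp (- pi * (of_int n)\<^sup>2 * x))) has_sum (1 + 2 * psi {} (of_real x))) UNIV"
proof -
  have "((\<lambda>n. exp (- (of_real (pi * (real n)\<^sup>2) * of_real x))) has_sum psi {} (of_real x)) {1..}"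
    using psi_has_sum[of "of_real x" "{}"] x by (simp only: sieved_empty) simp
  moreover have "exp (- (of_real (pi * (real n)\<^sup>2) * of_real x)) = complex_of_real (exp (- pi * (of_int (int n))\<^sup>2 * x))" for n
    by (simp add: exp_of_real[symmetric])
  ultimately have "((\<lambda>n. complex_of_real (exp (- pi * (of_int (int n))\<^sup>2 * x))) has_sum psi {} (of_real x)) {1..}"
    by (simp only:)
  from has_sum_int_even[OF this] show ?thesis by simp
qed

lemma Re_inverse_pos:
  assumes "Re z > 0"
  shows "Re (1 / z) > 0"
proof -
  have "(Re z)\<^sup>2 + (Im z)\<^sup>2 > 0" using assms by (simp add: add_pos_nonneg)
  then show ?thesis using assms by (simp add: Re_divide)
qed

text \<open>Jacobi's transformation, from Poisson summation at positive reals and holomorphy. The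
  two terms with 1/2 come from n = 0 in the sums over all integers.\<close>

lemma psi_theta:
  assumes z: "Re z > 0"
  shows "psi {} z = 1 / 2 * z powr (- 1 / 2) - 1 / 2 + z powr (- 1 / 2) * psi {} (1 / z)"
proof (rule holomorphic_eq_right_half_plane[OF psi_holomorphic _ _ z])
  have inv: "Re (1 / z) > 0" if "Re z > 0" for z
    using that by (rule Re_inverse_pos)
  have "(\<lambda>z. psi {} (1 / z)) holomorphic_on {z. Re z > 0}"
  proof -
    have "(\<lambda>z. 1 / z) holomorphic_on {z. Re z > 0}" by (intro holomorphic_intros) auto
    moreover have "(\<lambda>z. 1 / z) ` {z. Re z > 0} \<subseteq> {z. Re z > 0}" using inv by blast
    ultimately have "psi {} \<circ> (\<lambda>z. 1 / z) holomorphic_on {z. Re z > 0}"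
      using holomorphic_on_compose_gen psi_holomorphic by blast
    then show ?thesis by (simp add: o_def)
  qed
  then show "(\<lambda>z. 1 / 2 * z powr (- 1 / 2) - 1 / 2 + z powr (- 1 / 2) * psi {} (1 / z)) holomorphic_on {z. Re z > 0}"
    by (intro holomorphic_intros) (auto simp: complex_nonpos_Reals_iff)
  fix x :: real assume x: "x > 0"
  have "((\<lambda>k::int. complex_of_real (exp (- pi * (of_int k)\<^sup>2 * (1 / x))) * of_real (1 / sqrt x)) has_sum (1 + 2 * psi {} (of_real (1 / x))) * of_real (1 / sqrt x)) UNIV"
    by (intro has_sum_cmult_left theta_has_sum) (use x in auto)
  moreover have "((\<lambda>k::int. complex_of_real (exp (- pi * (of_int k)\<^sup>2 * (1 / x))) * of_real (1 / sqrt x)) has_sum (1 + 2 * psi {} (of_real x))) UNIV"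
    using theta_poisson[OF x] infsumI[OF theta_has_sum[OF x]] by simp
  ultimately have "1 + 2 * psi {} (of_real x) = (1 + 2 * psi {} (of_real (1 / x))) * of_real (1 / sqrt x)"
    by (metis has_sum_unique)
  have "of_real x powr (- 1 / 2) = complex_of_real (1 / sqrt x)"
  proof -
    have "of_real x powr (- 1 / 2) = complex_of_real (x powr (- 1 / 2))"
      using x powr_of_real[of x "- 1/2"] by simp
    also have "x powr (- 1 / 2) = 1 / sqrt x" using x by (simp add: powr_minus_divide powr_half_sqrt)
    finally show ?thesis .
  qed
  show "psi {} (of_real x) = 1 / 2 * of_real x powr (- 1 / 2) - 1 / 2 + of_real x powr (- 1 / 2) * psi {} (1 / of_real x)"
  proof -
    have gen: "A = 1 / 2 * r - 1 / 2 + r * B" if "1 + 2 * A = (1 + 2 * B) * r" for A B r :: complex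
      using that by (simp add: field_simps)
    note one_over = of_real_divide[of 1 x, where 'a = complex, unfolded of_real_1]
    show ?thesis
      using gen[OF \<open>1 + 2 * psi {} (of_real x) = _\<close>] \<open>of_real x powr (- 1 / 2) = _\<close>
      by (simp only: one_over)
  qed
qed

text \<open>The coefficient of z^(-1/2) at 0. A sieved prime p multiplies it by 1 - 1/p because (p^2
  z)^(-1/2) = z^(-1/2) / p.\<close>

definition psi_lead :: "nat set \<Rightarrow> complex" where
  "psi_lead P = 1 / 2 * (\<Prod>p\<in>P. 1 - 1 / of_nat p)"

text \<open>The constant term at 0. The -1/2 of the full series stands for the missing n = 0, and
  the difference psi(z) - psi(p^2 z) at the first prime cancels it for good.\<close>

definition psi_const :: "nat set \<Rightarrow> complex" where
  "psi_const P = (if P = {} then - 1 / 2 else 0)"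

definition psi_rest :: "nat set \<Rightarrow> complex \<Rightarrow> complex" where
  "psi_rest P z = psi P z - psi_lead P * z powr (- 1 / 2) - psi_const P"

text \<open>Leading coefficient and constant follow the sieve, so the remainder obeys the same
  difference relation as \<open>psi\<close>.\<close>

lemma psi_rest_insert:
  assumes z: "Re z > 0" and P: "finite P" "\<And>q. q \<in> P \<Longrightarrow> prime q" and p: "prime p" "p \<notin> P"
  shows "psi_rest (insert p P) z = psi_rest P z - psi_rest P ((of_nat p)\<^sup>2 * z)"
proof -
  have p0: "p > 0" using p(1) prime_gt_0_nat by blast
  have z0: "z \<noteq> 0" using z by auto
  have "of_real (exp (2 * ln (real p))) = (complex_of_nat p)\<^sup>2"
    using p0 by (simp add: exp_double)
  moreover have "exp (- 1 / 2 * of_real (2 * ln (real p))) = 1 / complex_of_nat p"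
  proof -
    have "- 1 / 2 * of_real (2 * ln (real p)) = complex_of_real (- ln (real p))" by simp
    then have "exp (- 1 / 2 * of_real (2 * ln (real p))) = complex_of_real (exp (- ln (real p)))"
      by (simp only: exp_of_real)
    also have "exp (- ln (real p)) = 1 / real p" using p0 by (simp add: exp_minus inverse_eq_divide)
    finally show ?thesis by (simp only: of_real_divide of_real_1 of_real_of_nat_eq)
  qed
  ultimately have pw: "((of_nat p)\<^sup>2 * z) powr (- 1 / 2) = z powr (- 1 / 2) / of_nat p"
    using powr_times_exp[OF z0, of "2 * ln (real p)" "- 1/2"]
    by (simp only: mult.commute[of z]) simp
  have lead: "psi_lead (insert p P) = psi_lead P * (1 - 1 / of_nat p)"
    using P p by (simp add: psi_lead_def)
  show ?thesis
  proof -
    have "psi_const (insert p P) = 0" by (simp add: psi_const_def)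
    moreover have "A - A' - l * (1 - 1 / n) * y - 0 = A - l * y - k - (A' - l * (y / n) - k)" for A A' l y k n :: complex
      by (simp add: ring_distribs)
    ultimately show ?thesis
      by (simp only: psi_rest_def psi_insert[OF z P(2) p] lead pw)
  qed
qed

lemma psi_decay:
  assumes w: "Re w > 0" and M: "M \<ge> 1"
  shows "\<exists>C. \<forall>x\<ge>0. norm (psi P (w * of_real (exp x))) \<le> C * exp (- real M * x)"
proof (intro exI allI impI)
  fix x :: real assume "x \<ge> 0"
  have "norm (psi P (w * of_real (exp x))) \<le> fact M / (Re w * exp x) ^ M * (\<Sum>\<^sub>\<infinity>n::nat. 1 / (real n)\<^sup>2)"
    using psi_norm_le[of "w * of_real (exp x)" M P] w M by simp
  also have "\<dots> = (fact M / Re w ^ M * (\<Sum>\<^sub>\<infinity>n::nat. 1 / (real n)\<^sup>2)) * exp (- real M * x)"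
    by (simp add: power_mult_distrib exp_minus exp_of_nat_mult[symmetric] divide_inverse)
  finally show "norm (psi P (w * of_real (exp x))) \<le> (fact M / Re w ^ M * (\<Sum>\<^sub>\<infinity>n::nat. 1 / (real n)\<^sup>2)) * exp (- real M * x)" .
qed

text \<open>For P = {} Jacobi's transformation moves z near 0 to 1/z near infinity, where
  \<open>psi\<close> decays. Inserting p takes the difference of remainders at w and p^2 w, which is
  why w varies in the induction.\<close>

lemma psi_rest_decay:
  assumes "finite P" "\<And>q. q \<in> P \<Longrightarrow> prime q" and w: "Re w > 0" and M: "M \<ge> 1"
  shows "\<exists>C. \<forall>x\<le>0. norm (psi_rest P (w * of_real (exp x))) \<le> C * exp (real M * x)"
  using assms(1,2) w
proof (induction P arbitrary: w rule: finite_induct)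
  case empty
  have w0: "w \<noteq> 0" using empty by auto
  define v where "v = 1 / w"
  have v: "Re v > 0" unfolding v_def using empty by (intro Re_inverse_pos)
  \<comment> \<open>One order more than M, to pay for z^(-1/2), which grows like e^(-x/2) as x tends
    to -infinity.\<close>
  obtain C where C: "\<And>x. x \<ge> 0 \<Longrightarrow> norm (psi {} (v * of_real (exp x))) \<le> C * exp (- real (Suc M) * x)"
    using psi_decay[OF v, of "Suc M" "{}"] by auto
  show ?case
  proof (intro exI allI impI)
    fix x :: real assume x: "x \<le> 0"
    let ?z = "w * of_real (exp x)"
    have z: "Re ?z > 0" using empty by simp
    have "1 / ?z = v * of_real (exp (- x))" by (simp add: v_def exp_minus field_simps)
    then have "psi_rest {} ?z = ?z powr (- 1 / 2) * psi {} (v * of_real (exp (- x)))"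
      using psi_theta[OF z] by (simp add: psi_rest_def psi_lead_def psi_const_def)
    also have "?z powr (- 1 / 2) = w powr (- 1 / 2) * exp (- 1 / 2 * of_real x)" by (rule powr_times_exp[OF w0])
    finally have "norm (psi_rest {} ?z) = norm (w powr (- 1 / 2)) * exp (- 1 / 2 * x) * norm (psi {} (v * of_real (exp (- x))))"
      by (simp add: norm_mult)
    also have "\<dots> \<le> norm (w powr (- 1 / 2)) * exp (- 1 / 2 * x) * (C * exp (- real (Suc M) * - x))"
      using C[of "- x"] x by (intro mult_left_mono) auto
    also have "\<dots> = norm (w powr (- 1 / 2)) * C * exp ((real M + 1 / 2) * x)"
      by (simp add: mult_exp_exp algebra_simps)
    also have "\<dots> \<le> norm (w powr (- 1 / 2)) * C * exp (real M * x)"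
    proof (rule mult_left_mono)
      have "0 \<le> C * exp (- real (Suc M) * 0)" using C[of 0] norm_ge_zero order_trans by blast
      then show "0 \<le> norm (w powr (- 1 / 2)) * C" by simp
    qed (use x in \<open>simp add: algebra_simps\<close>)
    finally show "norm (psi_rest {} ?z) \<le> norm (w powr (- 1 / 2)) * C * exp (real M * x)" .
  qed
next
  case (insert p P)
  have p: "prime p" and p0: "p > 0" using insert.prems prime_gt_0_nat by auto
  have w': "Re ((of_nat p)\<^sup>2 * w) > 0"
    using insert.prems p0 by (simp add: power2_eq_square)
  obtain C1 where C1: "\<And>x. x \<le> 0 \<Longrightarrow> norm (psi_rest P (w * of_real (exp x))) \<le> C1 * exp (real M * x)"
    using insert.IH[of w] insert.prems by auto
  obtain C2 where C2: "\<And>x. x \<le> 0 \<Longrightarrow> norm (psi_rest P ((of_nat p)\<^sup>2 * w * of_real (exp x))) \<le> C2 * exp (real M * x)"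
    using insert.IH[OF _ w'] insert.prems by auto
  show ?case
  proof (intro exI allI impI)
    fix x :: real assume x: "x \<le> 0"
    have "psi_rest (insert p P) (w * of_real (exp x)) = psi_rest P (w * of_real (exp x)) - psi_rest P ((of_nat p)\<^sup>2 * w * of_real (exp x))"
      using insert.prems insert.hyps p by (subst psi_rest_insert) (auto simp: mult.assoc)
    then have "norm (psi_rest (insert p P) (w * of_real (exp x))) \<le> C1 * exp (real M * x) + C2 * exp (real M * x)"
      using C1[OF x] C2[OF x] norm_triangle_ineq4 by (smt (verit))
    then show "norm (psi_rest (insert p P) (w * of_real (exp x))) \<le> (C1 + C2) * exp (real M * x)"
      by (simp add: algebra_simps)
  qed
qed

section \<open>The zeta function and completed L-functions\<close>

lemma exp_abs_integrable: "integrable lborel (\<lambda>x::real. exp (- \<bar>x\<bar>))"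
proof -
  let ?g = "\<lambda>x::real. indicat_real {..<0} x *\<^sub>R exp x"
  have "integrable lborel (\<lambda>x::real. indicat_real {..<0} x *\<^sub>R exp (1 * complex_of_real x))"
    using exp_half_line(1)[of 1] by (simp only: set_integrable_def) simp
  then have "integrable lborel (\<lambda>x::real. norm (indicat_real {..<0} x *\<^sub>R exp (1 * complex_of_real x)))"
    by (rule integrable_norm)
  then have g: "integrable lborel ?g" by simp
  then have g': "integrable lborel (\<lambda>x. ?g (0 + (-1) * x))" by (rule lborel_integrable_real_affine) simp
  have ae: "AE x in lborel. ?g x + ?g (0 + (-1) * x) = exp (- \<bar>x\<bar>)"
    using AE_lborel_singleton[of 0] by eventually_elim (auto simp: indicator_def)
  show ?thesis
    by (rule integrable_cong_AE_imp[OF Bochner_Integration.integrable_add[OF g g'] _ ae]) measurable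
qed

text \<open>The singular terms are removed only for x < 0. The result decays faster than every
  exponential at both ends, so its transform \<open>psi_mellin\<close> is entire.\<close>

definition psi_reg :: "nat set \<Rightarrow> complex \<Rightarrow> real \<Rightarrow> complex" where
  "psi_reg P w x = (if x < 0 then psi_rest P (w * of_real (exp x)) else psi P (w * of_real (exp x)))"

definition psi_mellin :: "nat set \<Rightarrow> complex \<Rightarrow> complex \<Rightarrow> complex" where
  "psi_mellin P w k = (\<integral>x. exp (k * of_real x) * psi_reg P w x \<partial>lborel)"

text \<open>This is \<open>w\<^bsup>-s/2\<^esup> \<pi>\<^bsup>-s/2\<^esup> \<Gamma>(s/2) \<zeta>(s)\<close> times the Euler factors \<open>1 - p\<^bsup>-s\<^esup>\<close>, \<open>p \<in> P\<close>, given by its analytic continuation.\<close>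

definition completed_L :: "nat set \<Rightarrow> complex \<Rightarrow> complex \<Rightarrow> complex" where
  "completed_L P w s = psi_mellin P w (s / 2) + 2 * psi_lead P * w powr (- 1 / 2) / (s - 1) + 2 * psi_const P / s"

context
  fixes P :: "nat set" and w :: complex
  assumes P: "finite P" "\<And>q. q \<in> P \<Longrightarrow> prime q" and w: "Re w > 0"
begin

lemma psi_continuous: "continuous_on A (\<lambda>x::real. psi P (w * of_real (exp x)))"
  by (rule continuous_on_compose2[OF holomorphic_on_imp_continuous_on[OF psi_holomorphic]])
    (use w in \<open>auto intro!: continuous_intros\<close>)

lemma psi_measurable [measurable]: "(\<lambda>x. psi P (w * of_real (exp x))) \<in> borel_measurable borel"
  by (rule borel_measurable_continuous_onI[OF psi_continuous])

lemma psi_rest_exp: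
  "psi_rest P (w * of_real (exp x)) =
     psi P (w * of_real (exp x)) - psi_lead P * w powr (- 1 / 2) * exp (- 1 / 2 * of_real x) - psi_const P"
  unfolding psi_rest_def by (subst powr_times_exp) (use w in auto)

lemma psi_reg_measurable [measurable]: "psi_reg P w \<in> borel_measurable borel"
  unfolding psi_reg_def[abs_def] psi_rest_exp by measurable

lemma psi_reg_decay:
  assumes M: "M \<ge> (1::nat)"
  obtains C where "C \<ge> 0" "\<And>x. norm (psi_reg P w x) \<le> C * exp (- real M * \<bar>x\<bar>)"
proof -
  obtain C1 where C1: "\<And>x. x \<ge> 0 \<Longrightarrow> norm (psi P (w * of_real (exp x))) \<le> C1 * exp (- real M * x)"
    using psi_decay[OF w M, of P] by blast
  obtain C2 where C2: "\<And>x. x \<le> 0 \<Longrightarrow> norm (psi_rest P (w * of_real (exp x))) \<le> C2 * exp (real M * x)"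
    using psi_rest_decay[OF P w M] by blast
  show ?thesis
  proof (rule that[of "max 0 (max C1 C2)"])
    fix x :: real
    show "norm (psi_reg P w x) \<le> max 0 (max C1 C2) * exp (- real M * \<bar>x\<bar>)"
    proof (cases "x < 0")
      case True
      then have "norm (psi_reg P w x) \<le> C2 * exp (real M * x)" using C2[of x] by (simp add: psi_reg_def)
      also have "\<dots> \<le> max 0 (max C1 C2) * exp (real M * x)" by (intro mult_right_mono) auto
      finally show ?thesis using True by simp
    next
      case False
      then have "norm (psi_reg P w x) \<le> C1 * exp (- real M * x)" using C1[of x] by (simp add: psi_reg_def)
      also have "\<dots> \<le> max 0 (max C1 C2) * exp (- real M * x)" by (intro mult_right_mono) auto
      finally show ?thesis using False by simp
    qed
  qed simp
qed

lemma psi_reg_bounded: obtains C where "C \<ge> 0" "\<And>x. norm (psi_reg P w x) \<le> C"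
proof -
  obtain C where C: "C \<ge> 0" "\<And>x. norm (psi_reg P w x) \<le> C * exp (- real 1 * \<bar>x\<bar>)"
    using psi_reg_decay[of 1] by auto
  have "C * exp (- real 1 * \<bar>x\<bar>) \<le> C * 1" for x by (rule mult_left_mono) (use C in auto)
  then have "norm (psi_reg P w x) \<le> C" for x using C(2)[of x] by (metis mult_1_right order_trans)
  then show ?thesis using that C(1) by blast
qed

lemma psi_reg_integrable: "integrable lborel (\<lambda>x. exp (k * of_real x) * psi_reg P w x)"
proof -
  \<comment> \<open>Exceeding |Re k| by one leaves the integrable majorant e^(-|x|).\<close>
  obtain M :: nat where "\<bar>Re k\<bar> + 1 \<le> real M" using real_arch_simple by blast
  then have M: "M \<ge> 1" "\<bar>Re k\<bar> \<le> real M - 1" by auto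
  obtain C where C: "C \<ge> 0" "\<And>x. norm (psi_reg P w x) \<le> C * exp (- real M * \<bar>x\<bar>)"
    by (rule psi_reg_decay[OF M(1)]) blast
  show ?thesis
  proof (rule Bochner_Integration.integrable_bound[OF integrable_mult_right[OF exp_abs_integrable, of C]])
    show "AE x in lborel. norm (exp (k * of_real x) * psi_reg P w x) \<le> norm (C * exp (- \<bar>x\<bar>))"
    proof (rule AE_I2)
      fix x :: real
      have "Re k * x \<le> (real M - 1) * \<bar>x\<bar>"
        using M(2) by (metis abs_ge_self abs_mult mult_right_mono abs_ge_zero order_trans)
      then have e: "exp (Re k * x) \<le> exp ((real M - 1) * \<bar>x\<bar>)" by simp
      have "norm (exp (k * of_real x) * psi_reg P w x) \<le> exp ((real M - 1) * \<bar>x\<bar>) * (C * exp (- real M * \<bar>x\<bar>))"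
        unfolding norm_mult norm_exp_of_real_mult by (intro mult_mono e C(2)) auto
      also have "\<dots> = C * exp (- \<bar>x\<bar>)" by (simp add: mult_exp_exp algebra_simps)
      finally show "norm (exp (k * of_real x) * psi_reg P w x) \<le> norm (C * exp (- \<bar>x\<bar>))" using C(1) by simp
    qed
  qed simp
qed

lemma psi_mellin_holomorphic: "psi_mellin P w holomorphic_on A"
proof -
  have "(\<lambda>k. \<integral>x. exp (k * of_real x) * psi_reg P w x \<partial>lborel) holomorphic_on {k. Re k \<in> UNIV}"
    by (rule laplace_holomorphic) (use psi_reg_integrable[of "of_real _"] in auto)
  then show ?thesis unfolding psi_mellin_def[abs_def] by (rule holomorphic_on_subset) simp
qed

text \<open>The pole at 0 stems from \<open>psi_const\<close> and disappears as soon as one prime is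
  sieved.\<close>

lemma completed_L_holomorphic:
  assumes "1 \<notin> A" "P = {} \<Longrightarrow> 0 \<notin> A"
  shows "completed_L P w holomorphic_on A"
proof -
  have "(\<lambda>s. psi_mellin P w (s / 2)) holomorphic_on A"
  proof -
    have "(\<lambda>s::complex. s / 2) holomorphic_on A" by (intro holomorphic_intros) auto
    from holomorphic_on_compose[OF this psi_mellin_holomorphic] show ?thesis by (simp add: o_def)
  qed
  moreover have "(\<lambda>s. 2 * psi_const P / s) holomorphic_on A"
  proof (cases "P = {}")
    case True
    then show ?thesis using assms by (auto intro!: holomorphic_intros)
  qed (simp add: psi_const_def)
  moreover have "(\<lambda>s. 2 * psi_lead P * w powr (- 1 / 2) / (s - 1)) holomorphic_on A"
    using assms(1) by (intro holomorphic_intros) auto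
  ultimately show ?thesis
    unfolding completed_L_def[abs_def] by (intro holomorphic_on_add)
qed

text \<open>For Re s > 1 the removed exponentials are integrable on the negative half-line, and
  their integrals are the rational terms of \<open>completed_L\<close>.\<close>

lemma completed_L_integral:
  assumes s: "Re s > 1"
  shows "integrable lborel (\<lambda>x. exp (s / 2 * of_real x) * psi P (w * of_real (exp x)))" (is "integrable _ ?f")
    and "(\<integral>x. exp (s / 2 * of_real x) * psi P (w * of_real (exp x)) \<partial>lborel) = completed_L P w s"
proof -
  let ?b = "\<lambda>x. exp (s / 2 * of_real x) * psi_reg P w x"
  let ?l = "psi_lead P * w powr (- 1 / 2)"
  let ?h = "\<lambda>c x. indicat_real {..<0} x *\<^sub>R exp (c * of_real x)"
  have c: "Re ((s - 1) / 2) > 0" "Re (s / 2) > 0" using s by auto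
  have ih: "integrable lborel (?h c)" "(\<integral>x. ?h c x \<partial>lborel) = 1 / c" if "Re c > 0" for c
    using exp_half_line[OF that] by (simp_all add: set_integrable_def set_lebesgue_integral_def)
  have f: "?f x = ?b x + (?l * ?h ((s - 1) / 2) x + psi_const P * ?h (s / 2) x)" for x
  proof (cases "x < 0")
    case True
    have e: "exp ((s - 1) / 2 * of_real x) = exp (s / 2 * of_real x) * exp (- 1 / 2 * of_real x)"
      by (simp add: mult_exp_exp field_simps)
    show ?thesis using True unfolding psi_reg_def psi_rest_exp e by (simp add: algebra_simps)
  qed (simp add: psi_reg_def)
  have i: "integrable lborel (\<lambda>x. ?b x + (?l * ?h ((s - 1) / 2) x + psi_const P * ?h (s / 2) x))"
    by (intro Bochner_Integration.integrable_add integrable_mult_right psi_reg_integrable ih c)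
  then show "integrable lborel ?f" unfolding f .
  have "(\<integral>x. ?f x \<partial>lborel) = (\<integral>x. ?b x \<partial>lborel) + (?l * (\<integral>x. ?h ((s - 1) / 2) x \<partial>lborel) + psi_const P * (\<integral>x. ?h (s / 2) x \<partial>lborel))"
    unfolding f
    by (subst Bochner_Integration.integral_add | intro Bochner_Integration.integrable_add integrable_mult_right psi_reg_integrable ih c)+
      (simp only: integral_mult_right_zero)
  also have "\<dots> = completed_L P w s"
    using s unfolding ih(2)[OF c(1)] ih(2)[OF c(2)] completed_L_def psi_mellin_def by (simp add: mult_ac)
  finally show "(\<integral>x. ?f x \<partial>lborel) = completed_L P w s" .
qed

end

section \<open>Dirichlet series and the continuation of zeta\<close>

lemma nat_powr_norm: "n \<ge> 1 \<Longrightarrow> norm (of_nat n powr (s::complex)) = real n powr Re s"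
  using norm_powr_real_powr[of "of_nat n" s] by simp

lemma nat_powr_summable:
  assumes s: "Re s > 1"
  shows "(\<lambda>n::nat. norm (of_nat n powr (- s :: complex))) summable_on sieved P"
proof -
  have "summable (\<lambda>n. real n powr (- Re s))" using s by (simp add: summable_real_powr_iff)
  then have "(\<lambda>n. real n powr (- Re s)) summable_on UNIV" by (subst summable_on_UNIV_nonneg_real_iff) auto
  then have "(\<lambda>n. real n powr (- Re s)) summable_on sieved P" by (rule summable_on_subset_banach) simp
  then show ?thesis
    by (subst summable_on_cong[where g = "\<lambda>n. real n powr (- Re s)"]) (use nat_powr_norm[of _ "- s"] sieved_ge in auto)
qed

definition sieved_L :: "nat set \<Rightarrow> complex \<Rightarrow> complex" where
  "sieved_L P s = (\<Sum>\<^sub>\<infinity>n\<in>sieved P. of_nat n powr (- s))"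

lemma sieved_L_has_sum:
  "Re s > 1 \<Longrightarrow> ((\<lambda>n. of_nat n powr (- s)) has_sum sieved_L P s) (sieved P)"
  unfolding sieved_L_def by (rule has_sum_infsum, rule abs_summable_summable, rule nat_powr_summable)

lemma sieved_L_prod:
  assumes "finite P" "\<And>q. q \<in> P \<Longrightarrow> prime q" and s: "Re s > 1"
  shows "sieved_L P s = sieved_L {} s * (\<Prod>p\<in>P. 1 - 1 / of_nat p powr s)"
  using assms(1,2)
proof (induction P rule: finite_induct)
  case (insert p P)
  have p: "prime p" using insert.prems by simp
  then have p0: "p > 0" by (rule prime_gt_0_nat)
  have "(\<lambda>n. of_nat n powr (- s)) summable_on sieved P"
    using sieved_L_has_sum[OF s] has_sum_imp_summable by blast
  note infsum_sieved_insert[OF this _ p insert.hyps(2)]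
  then have "sieved_L (insert p P) s = sieved_L P s - (\<Sum>\<^sub>\<infinity>n\<in>sieved P. of_nat (p * n) powr (- s))"
    using insert.prems unfolding sieved_L_def by blast
  also have "(\<Sum>\<^sub>\<infinity>n\<in>sieved P. of_nat (p * n) powr (- s)) = (\<Sum>\<^sub>\<infinity>n\<in>sieved P. of_nat p powr (- s) * of_nat n powr (- s))"
  proof (rule infsum_cong)
    fix n
    have "of_nat (p * n) powr (- s) = (of_real (real p) * of_real (real n)) powr (- s)" by simp
    also have "\<dots> = of_real (real p) powr (- s) * of_real (real n) powr (- s)"
      by (rule powr_times_real) auto
    finally show "of_nat (p * n) powr (- s) = of_nat p powr (- s) * of_nat n powr (- s)" by simp
  qed
  also have "\<dots> = of_nat p powr (- s) * sieved_L P s"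
    unfolding sieved_L_def by (rule infsum_cmult_right')
  also have "sieved_L P s - of_nat p powr (- s) * sieved_L P s = sieved_L P s * (1 - 1 / of_nat p powr s)"
    by (simp add: powr_minus divide_inverse algebra_simps)
  also have "\<dots> = sieved_L {} s * ((\<Prod>p\<in>P. 1 - 1 / of_nat p powr s) * (1 - 1 / of_nat p powr s))"
    using insert.IH insert.prems by (simp add: mult.assoc)
  finally show ?case using insert.hyps by (simp add: mult.commute)
qed simp

text \<open>Riemann's computation: the theta series is integrated termwise, and the n-th term is a
  rotated Gamma integral with z = pi n^2 w.\<close>

lemma completed_L_series:
  assumes P: "finite P" "\<And>q. q \<in> P \<Longrightarrow> prime q" and w: "Re w > 0" and s: "Re s > 1"
  shows "completed_L P w s = Gamma (s / 2) * (of_real pi * w) powr (- s / 2) * sieved_L P s"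
proof -
  let ?h = "\<lambda>n x. exp (s / 2 * of_real x) * exp (- (of_real (pi * (real n)\<^sup>2) * w) * of_real (exp x))"
  have cf: "countable (sieved P)" by (rule countable_subset[OF subset_UNIV]) simp
  have rs: "Re (s / 2) > 0" using s by simp
  have pos: "Re (of_real (pi * (real n)\<^sup>2) * w) > 0" if "n \<in> sieved P" for n
    using w sieved_ge[OF that] by simp
  note int = Gamma_integral_rotated[OF rs pos]
  have scale: "(of_real (pi * (real n)\<^sup>2) * w) powr (- (z / 2)) = (of_real pi * w) powr (- z / 2) * of_nat n powr (- z)"
    if n: "n \<ge> 1" for n :: nat and w z :: complex
  proof (cases "w = 0")
    case False
    have e: "of_real (pi * (real n)\<^sup>2) * w = (of_real pi * w) * of_real (exp (2 * ln (real n)))"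
      using n by (simp add: exp_double mult_ac)
    have "Ln (of_nat n) = of_real (ln (real n))" using Ln_of_real[of "real n"] n by simp
    then show ?thesis unfolding e using False n
      by (subst powr_times_exp) (auto simp: powr_def[of "of_nat n"])
  qed simp
  have "((\<lambda>n. \<integral>x. ?h n x \<partial>lborel) has_sum (\<integral>x. exp (s / 2 * of_real x) * psi P (w * of_real (exp x)) \<partial>lborel)) (sieved P)"
  proof (rule has_sum_integral(2)[OF cf lborel.sigma_finite_measure_axioms int(1)])
    show "(\<lambda>n. \<integral>x. norm (?h n x) \<partial>lborel) summable_on sieved P"
    proof -
      \<comment> \<open>The modulus of a term is the same term with s and w replaced by their real
        parts, so its integral is again explicit and decays like n^(-Re s).\<close>
      have rr: "Re (of_real (Re s) / 2) > 0" "Re (of_real (Re s)) > 1" using s by auto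
      have eq: "(\<integral>x. norm (?h n x) \<partial>lborel) = norm (Gamma (complex_of_real (Re s) / 2) * (of_real pi * of_real (Re w)) powr (- of_real (Re s) / 2)) * norm (of_nat n powr (- of_real (Re s) :: complex))"
        if n: "n \<in> sieved P" for n
      proof -
        have p': "Re (of_real (pi * (real n)\<^sup>2) * of_real (Re w)) > 0" using pos[OF n] by simp
        have "complex_of_real (\<integral>x. norm (?h n x) \<partial>lborel) = (\<integral>x. complex_of_real (norm (?h n x)) \<partial>lborel)" by simp
        also have "(\<lambda>x. complex_of_real (norm (?h n x))) = (\<lambda>x. exp (of_real (Re s) / 2 * of_real x) * exp (- (of_real (pi * (real n)\<^sup>2) * of_real (Re w)) * of_real (exp x)))"
        proof
          fix x :: real
          have "norm (?h n x) = exp (Re s / 2 * x) * exp (- (pi * (real n)\<^sup>2 * Re w) * exp x)" by (simp add: norm_mult)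
          then have "complex_of_real (norm (?h n x)) = exp (of_real (Re s / 2 * x)) * exp (of_real (- (pi * (real n)\<^sup>2 * Re w) * exp x))"
            by (subst exp_of_real, subst exp_of_real) (simp only: of_real_mult)
          then show "complex_of_real (norm (?h n x)) = exp (of_real (Re s) / 2 * of_real x) * exp (- (of_real (pi * (real n)\<^sup>2) * of_real (Re w)) * of_real (exp x))"
            by simp
        qed
        also have "(\<integral>x. exp (complex_of_real (Re s) / 2 * of_real x) * exp (- (of_real (pi * (real n)\<^sup>2) * of_real (Re w)) * of_real (exp x)) \<partial>lborel) =
           Gamma (of_real (Re s) / 2) * (of_real pi * of_real (Re w)) powr (- of_real (Re s) / 2) * of_nat n powr (- of_real (Re s))"
          unfolding Gamma_integral_rotated(2)[OF rr(1) p'] scale[OF sieved_ge[OF n]] by simp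
        finally have "norm (complex_of_real (\<integral>x. norm (?h n x) \<partial>lborel)) = norm (Gamma (complex_of_real (Re s) / 2) * (of_real pi * of_real (Re w)) powr (- of_real (Re s) / 2)) * norm (of_nat n powr (- of_real (Re s) :: complex))"
          by (simp only: norm_mult)
        then show ?thesis by simp
      qed
      show ?thesis
        by (subst summable_on_cong[OF eq]) (auto intro!: summable_on_cmult_right nat_powr_summable rr)
    qed
    show "((\<lambda>n. ?h n x) has_sum exp (s / 2 * of_real x) * psi P (w * of_real (exp x))) (sieved P)" for x
    proof -
      have "((\<lambda>n. exp (s / 2 * of_real x) * exp (- (of_real (pi * (real n)\<^sup>2) * (w * of_real (exp x))))) has_sum
        exp (s / 2 * of_real x) * psi P (w * of_real (exp x))) (sieved P)"
        using w by (intro has_sum_cmult_right psi_has_sum) simp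
      then show ?thesis by (simp add: mult.assoc)
    qed
  qed
  then have "((\<lambda>n. Gamma (s / 2) * (of_real (pi * (real n)\<^sup>2) * w) powr (- (s / 2))) has_sum completed_L P w s) (sieved P)"
    by (subst has_sum_cong[OF int(2)[symmetric]]) (simp_all only: completed_L_integral(2)[OF P w s])
  then have "((\<lambda>n. Gamma (s / 2) * (of_real pi * w) powr (- s / 2) * of_nat n powr (- s)) has_sum completed_L P w s) (sieved P)"
    by (subst (asm) has_sum_cong[where g = "\<lambda>n. Gamma (s / 2) * (of_real pi * w) powr (- s / 2) * of_nat n powr (- s)"])
      (use scale sieved_ge in \<open>auto simp: mult.assoc\<close>)
  moreover have "((\<lambda>n. Gamma (s / 2) * (of_real pi * w) powr (- s / 2) * of_nat n powr (- s)) has_sum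
      Gamma (s / 2) * (of_real pi * w) powr (- s / 2) * sieved_L P s) (sieved P)"
    by (intro has_sum_cmult_right sieved_L_has_sum s)
  ultimately show ?thesis by (rule has_sum_unique)
qed

text \<open>As \<open>zeta\<close> is defined by choice, some continuation has to be exhibited
  before anything is known about it. On Re s > 1 the value is pinned down by uniqueness of
  sums.\<close>

lemma zeta_spec:
  "zeta holomorphic_on - {1}" "Re s > 1 \<Longrightarrow> zeta s = sieved_L {} s"
proof -
  \<comment> \<open>This is pi^(s/2) \<open>rGamma (s / 2)\<close> times the completed function of P
    = {}. Its term 1/s is absorbed through rGamma(s/2) / s = rGamma(s/2 + 1) / 2, so f is
    holomorphic at 0 as well.\<close>
  define f where "f = (\<lambda>s. of_real pi powr (s / 2) *
     (rGamma (s / 2) * (psi_mellin {} 1 (s / 2) + 1 / (s - 1)) - rGamma (s / 2 + 1) / 2))"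
  have sums: "(\<lambda>n. of_nat (Suc n) powr (- s)) sums sieved_L {} s" if "Re s > 1" for s :: complex
  proof -
    have "((\<lambda>n. of_nat n powr (- s)) has_sum sieved_L {} s) (Suc ` UNIV)"
      using sieved_L_has_sum[OF that, of "{}"] unfolding sieved_empty by (simp add: image_Suc_lessThan atLeast_Suc_greaterThan greaterThan_0)
    then have "((\<lambda>n. of_nat (Suc n) powr (- s)) has_sum sieved_L {} s) UNIV"
      by (subst (asm) has_sum_reindex) (auto simp: o_def)
    then show ?thesis by (rule has_sum_imp_sums)
  qed
  have "(\<lambda>s. psi_mellin {} 1 (s / 2)) holomorphic_on - {1}"
  proof -
    have "(\<lambda>s::complex. s / 2) holomorphic_on - {1}" by (intro holomorphic_intros) auto
    moreover have "psi_mellin {} 1 holomorphic_on A" for A by (rule psi_mellin_holomorphic) auto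
    ultimately have "psi_mellin {} 1 \<circ> (\<lambda>s. s / 2) holomorphic_on - {1}" by (rule holomorphic_on_compose)
    then show ?thesis by (simp add: o_def)
  qed
  then have hol: "f holomorphic_on - {1}"
    unfolding f_def by (intro holomorphic_intros) auto
  have val: "f s = sieved_L {} s" if s: "Re s > 1" for s
  proof -
    have s0: "s \<noteq> 0" using s by auto
    have "s / 2 * rGamma (s / 2 + 1) = rGamma (s / 2)" by (rule rGamma_plus1)
    then have r: "rGamma (s / 2 + 1) / 2 = rGamma (s / 2) / s" using s0 by (simp add: field_simps)
    have "f s = of_real pi powr (s / 2) * (rGamma (s / 2) * completed_L {} 1 s)"
      unfolding f_def r completed_L_def by (simp add: psi_lead_def psi_const_def algebra_simps)
    also have "\<dots> = (of_real pi powr (s / 2) * of_real pi powr (- s / 2)) * (rGamma (s / 2) * Gamma (s / 2)) * sieved_L {} s"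
      by (subst completed_L_series) (use s in \<open>auto simp: mult_ac\<close>)
    also have "rGamma (s / 2) * Gamma (s / 2) = 1"
    proof -
      have "s / 2 \<notin> \<int>\<^sub>\<le>\<^sub>0" using s by (auto elim!: nonpos_Ints_cases simp: complex_eq_iff)
      then show ?thesis by (simp add: rGamma_inverse_Gamma Gamma_eq_zero_iff)
    qed
    also have "of_real pi powr (s / 2) * of_real pi powr (- s / 2) = (1::complex)"
      by (simp add: powr_add[symmetric])
    finally show ?thesis by simp
  qed
  have "\<exists>f. f holomorphic_on - {1} \<and> (\<forall>s. Re s > 1 \<longrightarrow> (\<lambda>n. of_nat (Suc n) powr (- s)) sums f s)"
    using hol val sums by (intro exI[of _ f]) auto
  from someI_ex[OF this] have z: "zeta holomorphic_on - {1} \<and> (\<forall>s. Re s > 1 \<longrightarrow> (\<lambda>n. of_nat (Suc n) powr (- s)) sums zeta s)"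
    unfolding zeta_def .
  then show "zeta holomorphic_on - {1}" by blast
  show "Re s > 1 \<Longrightarrow> zeta s = sieved_L {} s"
    using z sums sums_unique2 by blast
qed

text \<open>The plane stays connected without finitely many points, and the half-plane stays open
  and nonempty.\<close>

lemma continuation_from_half_plane:
  assumes "finite A" "f holomorphic_on - A" "g holomorphic_on - A"
    and eq: "\<And>s. Re s > r \<Longrightarrow> s \<notin> A \<Longrightarrow> f s = g s" and "s \<notin> A"
  shows "f s = (g s :: complex)"
proof (rule analytic_continuation_open[of "{s. Re s > r} - A" "- A" f g])
  show "open ({s. Re s > r} - A)"
    by (intro open_Diff open_halfspace_Re_gt finite_imp_closed assms)
  have "open {s. Re s > r}" "(of_real (r + 1) :: complex) \<in> {s. Re s > r}" by (auto simp: open_halfspace_Re_gt)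
  then have "infinite {s::complex. Re s > r}"
    using finite_imp_not_open by blast
  then show "{s. Re s > r} - A \<noteq> {}" using assms(1) by (metis Diff_eq_empty_iff finite_subset)
  show "connected (- A)"
    using connected_open_delete_finite[of UNIV A] connected_UNIV assms(1) by (simp add: Compl_eq_Diff_UNIV)
  show "open (- A)" using assms(1) by (simp add: finite_imp_closed open_Compl)
qed (use assms in auto)

text \<open>The functional equation of zeta. Jacobi's transformation makes \<open>psi_reg\<close>
  symmetric under x -> -x up to the factor e^(-x/2), which exchanges k and 1/2 - k; the rational
  part 1/(s-1) - 1/s is symmetric by itself.\<close>

lemma completed_L_reflect: "completed_L {} 1 (1 - s) = completed_L {} 1 s"
proof -
  have reg: "psi_reg {} 1 x = exp (- 1 / 2 * of_real x) * psi_reg {} 1 (- x)" if "x \<noteq> 0" for x :: real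
  proof -
    have neg: "psi_rest {} (of_real (exp y)) = exp (- 1 / 2 * of_real y) * psi {} (of_real (exp (- y)))" for y :: real
    proof -
      have "psi {} (of_real (exp y)) = 1 / 2 * of_real (exp y) powr (- 1 / 2) - 1 / 2 + of_real (exp y) powr (- 1 / 2) * psi {} (1 / of_real (exp y))"
        by (rule psi_theta) simp
      moreover have "complex_of_real (exp y) powr (- 1 / 2) = exp (- 1 / 2 * of_real y)"
        using powr_times_exp[of 1 y "- 1 / 2"] by simp
      moreover have "1 / complex_of_real (exp y) = of_real (exp (- y))" by (simp add: exp_minus divide_inverse)
      ultimately show ?thesis unfolding psi_rest_def by (simp add: psi_lead_def psi_const_def)
    qed
    show ?thesis
    proof (cases "x < 0")
      case True
      then show ?thesis using neg[of x] by (simp add: psi_reg_def)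
    next
      case False
      have "exp (- 1 / 2 * of_real x) * (exp (- 1 / 2 * of_real (- x)) * psi {} (of_real (exp (- (- x))))) = psi {} (of_real (exp x))"
        by (simp add: mult.assoc[symmetric] mult_exp_exp)
      then show ?thesis using False that neg[of "- x"] by (simp add: psi_reg_def)
    qed
  qed
  have mel: "psi_mellin {} 1 (1 / 2 - k) = psi_mellin {} 1 k" for k
  proof -
    have [measurable]: "psi_reg {} 1 \<in> borel_measurable borel" by (rule psi_reg_measurable) auto
    have "psi_mellin {} 1 k = (\<integral>x. exp (k * of_real (0 + (-1) * x)) * psi_reg {} 1 (0 + (-1) * x) \<partial>lborel)"
      unfolding psi_mellin_def using lborel_integral_real_affine[of "-1" "\<lambda>x. exp (k * of_real x) * psi_reg {} 1 x" 0] by simp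
    also have "\<dots> = (\<integral>x. exp ((1 / 2 - k) * of_real x) * psi_reg {} 1 x \<partial>lborel)"
    proof (rule integral_cong_AE)
      show "AE x in lborel. exp (k * of_real (0 + (-1) * x)) * psi_reg {} 1 (0 + (-1) * x) = exp ((1 / 2 - k) * of_real x) * psi_reg {} 1 x"
        using AE_lborel_singleton[of 0]
      proof eventually_elim
        case (elim x)
        have "exp ((1 / 2 - k) * of_real x) * exp (- 1 / 2 * of_real x) = exp (k * of_real (- x))"
          by (simp add: mult_exp_exp algebra_simps)
        then show ?case using elim by (subst reg[of x]) (auto simp: mult.assoc[symmetric])
      qed
    qed auto
    finally show ?thesis by (simp add: psi_mellin_def)
  qed
  have "(1 - s) / 2 = 1 / 2 - s / 2" by (simp add: diff_divide_distrib)
  then have m: "psi_mellin {} 1 ((1 - s) / 2) = psi_mellin {} 1 (s / 2)" by (simp only: mel)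
  have "1 / (1 - s - 1) - 1 / (1 - s) = 1 / (s - 1) - 1 / s"
    by (metis (no_types, opaque_lifting) add_uminus_conv_diff diff_add_cancel divide_minus_right minus_diff_eq diff_minus_eq_add add.commute uminus_add_conv_diff)
  then show ?thesis unfolding completed_L_def m by (simp add: psi_lead_def psi_const_def algebra_simps)
qed

text \<open>The reciprocal Gamma function keeps the identity valid at negative even s, where Gamma
  has poles.\<close>

lemma zeta_completed:
  assumes s: "s \<noteq> 0" "s \<noteq> 1"
  shows "rGamma (s / 2) * completed_L {} 1 s = of_real pi powr (- s / 2) * zeta s"
proof (rule continuation_from_half_plane[of "{0, 1}" "\<lambda>s. rGamma (s / 2) * completed_L {} 1 s" "\<lambda>s. of_real pi powr (- s / 2) * zeta s" 1])
  have "completed_L {} 1 holomorphic_on - {0, 1}" by (rule completed_L_holomorphic) auto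
  then show "(\<lambda>s. rGamma (s / 2) * completed_L {} 1 s) holomorphic_on - {0, 1}" by (intro holomorphic_intros) auto
  have "zeta holomorphic_on - {0, 1}" using zeta_spec(1) by (rule holomorphic_on_subset) auto
  then show "(\<lambda>s. of_real pi powr (- s / 2) * zeta s) holomorphic_on - {0, 1}" by (intro holomorphic_intros) auto
  fix s :: complex assume r: "Re s > 1"
  have "s / 2 \<notin> \<int>\<^sub>\<le>\<^sub>0" using r by (auto elim!: nonpos_Ints_cases simp: complex_eq_iff)
  then have "rGamma (s / 2) * Gamma (s / 2) = 1" by (simp add: rGamma_inverse_Gamma Gamma_eq_zero_iff)
  then show "rGamma (s / 2) * completed_L {} 1 s = of_real pi powr (- s / 2) * zeta s"
    using completed_L_series[of "{}" 1 s] r zeta_spec(2)[OF r] by (simp add: mult.assoc[symmetric])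
qed (use s in auto)

text \<open>The Euler factors and the power of w are separated where the Dirichlet series converges,
  then continued.\<close>

lemma completed_L_sieved:
  assumes P: "finite P" "\<And>q. q \<in> P \<Longrightarrow> prime q" and w: "Re w > 0" and s: "s \<noteq> 0" "s \<noteq> 1"
  shows "completed_L P w s = w powr (- s / 2) * (\<Prod>p\<in>P. 1 - 1 / of_nat p powr s) * completed_L {} 1 s"
proof (rule continuation_from_half_plane[of "{0, 1}" "completed_L P w" "\<lambda>s. w powr (- s / 2) * (\<Prod>p\<in>P. 1 - 1 / of_nat p powr s) * completed_L {} 1 s" 1])
  show "completed_L P w holomorphic_on - {0, 1}" by (rule completed_L_holomorphic[OF P w]) auto
  have "completed_L {} 1 holomorphic_on - {0, 1}" by (rule completed_L_holomorphic) auto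
  moreover have "of_nat p \<noteq> (0::complex)" if "p \<in> P" for p using P(2)[OF that] by auto
  moreover have "w \<noteq> 0" using w by auto
  ultimately show "(\<lambda>s. w powr (- s / 2) * (\<Prod>p\<in>P. 1 - 1 / of_nat p powr s) * completed_L {} 1 s) holomorphic_on - {0, 1}"
    by (intro holomorphic_intros) auto
  fix s :: complex assume r: "Re s > 1"
  have "(of_real pi * w) powr (- s / 2) = of_real pi powr (- s / 2) * w powr (- s / 2)"
  proof -
    have "(w * of_real (exp (ln pi))) powr (- s / 2) = w powr (- s / 2) * exp (- s / 2 * of_real (ln pi))"
      by (rule powr_times_exp) (use w in auto)
    moreover have "exp (- s / 2 * of_real (ln pi)) = of_real pi powr (- s / 2)" by (simp add: powr_def Ln_of_real)
    ultimately show ?thesis by (simp add: mult.commute)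
  qed
  then show "completed_L P w s = w powr (- s / 2) * (\<Prod>p\<in>P. 1 - 1 / of_nat p powr s) * completed_L {} 1 s"
    using completed_L_series[OF P w r] completed_L_series[of "{}" 1 s] r sieved_L_prod[OF P r] by (simp add: mult_ac)
qed (use s in auto)

section \<open>Convolution of two theta series\<close>

definition theta_conv :: "nat set \<Rightarrow> complex \<Rightarrow> complex \<Rightarrow> real \<Rightarrow> complex" where
  "theta_conv P w \<nu> x =
     (\<integral>y. exp (\<nu> * of_real y) * psi P (w * of_real (exp y)) * psi P (w * of_real (exp (x - y))) \<partial>lborel)"

definition psi_sing_coeff :: "nat set \<Rightarrow> complex \<Rightarrow> complex" where
  "psi_sing_coeff P w = psi_lead P * w powr (- 1 / 2)"

definition psi_sing :: "nat set \<Rightarrow> complex \<Rightarrow> real \<Rightarrow> complex" where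
  "psi_sing P w x = (if x < 0 then psi_sing_coeff P w * exp (- 1 / 2 * of_real x) else 0)"

text \<open>What is lost when a singular factor restricts the transform of \<open>psi_reg\<close> to
  y > x.\<close>

definition psi_reg_tail :: "nat set \<Rightarrow> complex \<Rightarrow> complex \<Rightarrow> real \<Rightarrow> complex" where
  "psi_reg_tail P w k x = (\<integral>y. indicat_real {..x} y *\<^sub>R (exp (k * of_real y) * psi_reg P w y) \<partial>lborel)"

section \<open>Expansion of the convolution on the negative half-line\<close>

lemma indicator_integrable:
  fixes f :: "real \<Rightarrow> complex"
  assumes "integrable lborel f" "A \<in> sets borel"
  shows "integrable lborel (\<lambda>x. indicat_real A x *\<^sub>R f x)"
  using assms(1) by (rule Bochner_Integration.integrable_bound) (use assms in \<open>auto simp: indicator_def\<close>)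

text \<open>The overlap of the two singular parts. At \<nu> = 0 the value would be -x, which is
  where the condition \<alpha> \<noteq> 0 originates.\<close>

lemma exp_interval_integral:
  fixes \<nu> :: complex
  assumes \<nu>: "\<nu> \<noteq> 0" and x: "x \<le> (0::real)"
  shows "(\<integral>y. indicat_real {x<..<0} y *\<^sub>R exp (\<nu> * of_real y) \<partial>lborel) = (1 - exp (\<nu> * of_real x)) / \<nu>"
proof -
  have "((\<lambda>y. exp (\<nu> * of_real y)) has_integral exp (\<nu> * of_real 0) / \<nu> - exp (\<nu> * of_real x) / \<nu>) {x..0}"
  proof (rule fundamental_theorem_of_calculus[OF x])
    show "((\<lambda>y. exp (\<nu> * of_real y) / \<nu>) has_vector_derivative exp (\<nu> * of_real y)) (at y within {x..0})" for y
    proof -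
      have "((\<lambda>z. exp (\<nu> * z) / \<nu>) has_field_derivative exp (\<nu> * of_real y)) (at (of_real y))"
        using \<nu> by (auto intro!: derivative_eq_intros)
      then show ?thesis by (rule has_vector_derivative_real_field)
    qed
  qed
  moreover have "set_integrable lborel {x..0} (\<lambda>y. exp (\<nu> * of_real y))"
    by (intro borel_integrable_atLeastAtMost' continuous_intros)
  from set_borel_integral_eq_integral(2)[OF this]
  have "(\<integral>y. indicat_real {x..0} y *\<^sub>R exp (\<nu> * of_real y) \<partial>lborel) = integral {x..0} (\<lambda>y. exp (\<nu> * of_real y))"
    unfolding set_lebesgue_integral_def .
  moreover have "(\<integral>y. indicat_real {x<..<0} y *\<^sub>R exp (\<nu> * of_real y) \<partial>lborel) = (\<integral>y. indicat_real {x..0} y *\<^sub>R exp (\<nu> * of_real y) \<partial>lborel)"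
  proof (rule integral_cong_AE)
    show "AE y in lborel. indicat_real {x<..<0} y *\<^sub>R exp (\<nu> * of_real y) = indicat_real {x..0} y *\<^sub>R exp (\<nu> * of_real y)"
      using AE_lborel_singleton[of 0] AE_lborel_singleton[of x] by eventually_elim (auto simp: indicator_def)
  qed auto
  ultimately show ?thesis by (simp add: has_integral_iff diff_divide_distrib)
qed

context
  fixes P :: "nat set" and w :: complex
  assumes P: "finite P" "\<And>q. q \<in> P \<Longrightarrow> prime q" and P_ne: "P \<noteq> {}" and w: "Re w > 0"
begin

lemma psi_split: "psi P (w * of_real (exp x)) = psi_sing P w x + psi_reg P w x"
  using P_ne psi_rest_exp[OF P w, of x] by (simp add: psi_sing_def psi_reg_def psi_sing_coeff_def psi_const_def)

lemma psi_sing_measurable [measurable]: "psi_sing P w \<in> borel_measurable borel"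
  unfolding psi_sing_def[abs_def] by measurable

lemma psi_reg_meas [measurable]: "psi_reg P w \<in> borel_measurable borel"
  by (rule psi_reg_measurable[OF P w])

lemma reg_shift:
  shows "integrable lborel (\<lambda>y. exp (k * of_real y) * psi_reg P w (x - y))"
    and "(\<integral>y. exp (k * of_real y) * psi_reg P w (x - y) \<partial>lborel) = exp (k * of_real x) * psi_mellin P w (- k)"
proof -
  let ?g = "\<lambda>z. exp (- k * of_real z) * psi_reg P w z"
  have e: "exp (k * of_real x) * ?g (x + (- 1) * y) = exp (k * of_real y) * psi_reg P w (x - y)" for y
    by (simp add: mult.assoc[symmetric] mult_exp_exp algebra_simps)
  have g: "integrable lborel ?g" by (rule psi_reg_integrable[OF P w])
  have "integrable lborel (\<lambda>y. ?g (x + (- 1) * y))" by (rule lborel_integrable_real_affine[OF g]) simp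
  then have "integrable lborel (\<lambda>y. exp (k * of_real x) * ?g (x + (- 1) * y))" by (rule integrable_mult_right)
  then show "integrable lborel (\<lambda>y. exp (k * of_real y) * psi_reg P w (x - y))" unfolding e .
  have "psi_mellin P w (- k) = (\<integral>y. ?g (x + (- 1) * y) \<partial>lborel)"
    unfolding psi_mellin_def using lborel_integral_real_affine[of "- 1" ?g x] by simp
  then have "exp (k * of_real x) * psi_mellin P w (- k) = (\<integral>y. exp (k * of_real x) * ?g (x + (- 1) * y) \<partial>lborel)" by simp
  then show "(\<integral>y. exp (k * of_real y) * psi_reg P w (x - y) \<partial>lborel) = exp (k * of_real x) * psi_mellin P w (- k)"
    unfolding e by simp
qed

text \<open>Two singular factors meet only on x < y < 0; in a mixed product the regular factor beats
  every exponential; two regular factors give a bounded function times an integrable one.\<close>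

lemma theta_conv_pieces:
  fixes \<nu> :: complex and x :: real
  shows "integrable lborel (\<lambda>y. exp (\<nu> * of_real y) * psi_sing P w y * psi_sing P w (x - y))"
    and "integrable lborel (\<lambda>y. exp (\<nu> * of_real y) * psi_sing P w y * psi_reg P w (x - y))"
    and "integrable lborel (\<lambda>y. exp (\<nu> * of_real y) * psi_reg P w y * psi_sing P w (x - y))"
    and "integrable lborel (\<lambda>y. exp (\<nu> * of_real y) * psi_reg P w y * psi_reg P w (x - y))"
proof -
  have a: "exp (\<nu> * of_real y) * psi_sing P w y * psi_sing P w (x - y) =
     (psi_sing_coeff P w)\<^sup>2 * exp (- 1 / 2 * of_real x) * (indicat_real {x<..<0} y *\<^sub>R exp (\<nu> * of_real y))" for y
  proof -
    have "exp (- 1 / 2 * of_real y) * exp (- 1 / 2 * of_real (x - y)) = exp (- 1 / 2 * complex_of_real x)"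
      by (simp add: mult_exp_exp diff_divide_distrib)
    then show ?thesis by (auto simp: psi_sing_def indicator_def power2_eq_square mult_ac)
  qed
  have "set_integrable lborel {x..0} (\<lambda>y. exp (\<nu> * of_real y))"
    by (intro borel_integrable_atLeastAtMost' continuous_intros)
  then have "set_integrable lborel {x<..<0} (\<lambda>y. exp (\<nu> * of_real y))"
    by (rule set_integrable_subset) auto
  then show "integrable lborel (\<lambda>y. exp (\<nu> * of_real y) * psi_sing P w y * psi_sing P w (x - y))"
    unfolding a set_integrable_def by (rule integrable_mult_right)
  have b: "exp (\<nu> * of_real y) * psi_sing P w y * psi_reg P w (x - y) =
     psi_sing_coeff P w * (indicat_real {..<0} y *\<^sub>R (exp ((\<nu> - 1 / 2) * of_real y) * psi_reg P w (x - y)))" for y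
  proof -
    have "exp (\<nu> * of_real y) * exp (- 1 / 2 * of_real y) = exp ((\<nu> - 1 / 2) * of_real y)"
      by (simp add: mult_exp_exp algebra_simps diff_divide_distrib)
    then show ?thesis by (auto simp: psi_sing_def indicator_def mult_ac)
  qed
  show "integrable lborel (\<lambda>y. exp (\<nu> * of_real y) * psi_sing P w y * psi_reg P w (x - y))"
    unfolding b by (intro integrable_mult_right indicator_integrable reg_shift) simp
  have c: "exp (\<nu> * of_real y) * psi_reg P w y * psi_sing P w (x - y) =
     psi_sing_coeff P w * exp (- 1 / 2 * of_real x) * (indicat_real {x<..} y *\<^sub>R (exp ((\<nu> + 1 / 2) * of_real y) * psi_reg P w y))" for y
  proof -
    have "exp (\<nu> * of_real y) * exp (- 1 / 2 * of_real (x - y)) = exp (- 1 / 2 * complex_of_real x) * exp ((\<nu> + 1 / 2) * of_real y)"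
      by (simp add: mult_exp_exp algebra_simps diff_divide_distrib)
    then show ?thesis by (auto simp: psi_sing_def indicator_def mult_ac)
  qed
  show "integrable lborel (\<lambda>y. exp (\<nu> * of_real y) * psi_reg P w y * psi_sing P w (x - y))"
    unfolding c by (intro integrable_mult_right indicator_integrable psi_reg_integrable[OF P w]) simp_all
  obtain C where C: "C \<ge> 0" "\<And>x. norm (psi_reg P w x) \<le> C" using psi_reg_bounded[OF P w] by blast
  show "integrable lborel (\<lambda>y. exp (\<nu> * of_real y) * psi_reg P w y * psi_reg P w (x - y))"
  proof (rule Bochner_Integration.integrable_bound[OF integrable_mult_right[OF psi_reg_integrable[OF P w, of \<nu>], of "of_real C"]])
    show "AE y in lborel. norm (exp (\<nu> * of_real y) * psi_reg P w y * psi_reg P w (x - y)) \<le> norm (of_real C * (exp (\<nu> * of_real y) * psi_reg P w y))"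
    proof (rule AE_I2)
      fix y
      have "norm (exp (\<nu> * of_real y) * psi_reg P w y) * norm (psi_reg P w (x - y)) \<le> norm (exp (\<nu> * of_real y) * psi_reg P w y) * C"
        by (intro mult_left_mono C) simp
      then show "norm (exp (\<nu> * of_real y) * psi_reg P w y * psi_reg P w (x - y)) \<le> norm (of_real C * (exp (\<nu> * of_real y) * psi_reg P w y))"
        using C(1) by (simp add: norm_mult mult_ac)
    qed
  qed measurable
qed

lemma theta_conv_split:
  shows "integrable lborel (\<lambda>y. exp (\<nu> * of_real y) * psi P (w * of_real (exp y)) * psi P (w * of_real (exp (x - y))))"
    and "theta_conv P w \<nu> x =
      ((\<integral>y. exp (\<nu> * of_real y) * psi_sing P w y * psi_sing P w (x - y) \<partial>lborel) +
       (\<integral>y. exp (\<nu> * of_real y) * psi_sing P w y * psi_reg P w (x - y) \<partial>lborel)) +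
      ((\<integral>y. exp (\<nu> * of_real y) * psi_reg P w y * psi_sing P w (x - y) \<partial>lborel) +
       (\<integral>y. exp (\<nu> * of_real y) * psi_reg P w y * psi_reg P w (x - y) \<partial>lborel))"
proof -
  have e: "exp (\<nu> * of_real y) * psi P (w * of_real (exp y)) * psi P (w * of_real (exp (x - y))) =
     (exp (\<nu> * of_real y) * psi_sing P w y * psi_sing P w (x - y) + exp (\<nu> * of_real y) * psi_sing P w y * psi_reg P w (x - y)) +
     (exp (\<nu> * of_real y) * psi_reg P w y * psi_sing P w (x - y) + exp (\<nu> * of_real y) * psi_reg P w y * psi_reg P w (x - y))" for y
    unfolding psi_split by (simp add: ring_distribs)
  note i = theta_conv_pieces[of \<nu> x]
  show "integrable lborel (\<lambda>y. exp (\<nu> * of_real y) * psi P (w * of_real (exp y)) * psi P (w * of_real (exp (x - y))))"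
    unfolding e by (intro Bochner_Integration.integrable_add i)
  show "theta_conv P w \<nu> x =
      ((\<integral>y. exp (\<nu> * of_real y) * psi_sing P w y * psi_sing P w (x - y) \<partial>lborel) +
       (\<integral>y. exp (\<nu> * of_real y) * psi_sing P w y * psi_reg P w (x - y) \<partial>lborel)) +
      ((\<integral>y. exp (\<nu> * of_real y) * psi_reg P w y * psi_sing P w (x - y) \<partial>lborel) +
       (\<integral>y. exp (\<nu> * of_real y) * psi_reg P w y * psi_reg P w (x - y) \<partial>lborel))"
    unfolding theta_conv_def e
    by (simp only: Bochner_Integration.integral_add Bochner_Integration.integrable_add i)
qed

lemma psi_reg_tail_compl:
  "(\<integral>y. indicat_real {x<..} y *\<^sub>R (exp (k * of_real y) * psi_reg P w y) \<partial>lborel) = psi_mellin P w k - psi_reg_tail P w k x"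
proof -
  let ?f = "\<lambda>y. exp (k * of_real y) * psi_reg P w y"
  have i: "integrable lborel (\<lambda>y. indicat_real A y *\<^sub>R ?f y)" if "A \<in> sets borel" for A
    by (intro indicator_integrable psi_reg_integrable[OF P w] that)
  have m: "{..x} \<in> sets borel" "{x<..} \<in> sets borel" by simp_all
  have "?f y = indicat_real {..x} y *\<^sub>R ?f y + indicat_real {x<..} y *\<^sub>R ?f y" for y
    by (auto simp: indicator_def)
  then have "psi_mellin P w k = (\<integral>y. indicat_real {..x} y *\<^sub>R ?f y + indicat_real {x<..} y *\<^sub>R ?f y \<partial>lborel)"
    unfolding psi_mellin_def by (intro Bochner_Integration.integral_cong refl)
  also have "\<dots> = psi_reg_tail P w k x + (\<integral>y. indicat_real {x<..} y *\<^sub>R ?f y \<partial>lborel)"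
    unfolding psi_reg_tail_def by (intro Bochner_Integration.integral_add i m)
  finally show ?thesis by simp
qed

text \<open>For y \<le> x and N \<ge> 0 one may insert e^(N (x - y)) \<ge> 1; the weight e^(-N y) is
  harmless since \<open>psi_reg\<close> beats every exponential.\<close>

lemma psi_reg_tail_decay:
  assumes "N \<ge> 0"
  obtains C where "C \<ge> 0" "\<And>x. norm (psi_reg_tail P w k x) \<le> C * exp (N * x)"
proof -
  let ?f = "\<lambda>y. exp (k * of_real y) * psi_reg P w y"
  define g where "g = (\<lambda>y. norm (exp ((k - of_real N) * of_real y) * psi_reg P w y))"
  have gi: "integrable lborel g" unfolding g_def by (intro integrable_norm psi_reg_integrable[OF P w])
  have "norm (psi_reg_tail P w k x) \<le> (\<integral>y. g y \<partial>lborel) * exp (N * x)" for x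
  proof -
    have "norm (psi_reg_tail P w k x) \<le> (\<integral>y. norm (indicat_real {..x} y *\<^sub>R ?f y) \<partial>lborel)"
      unfolding psi_reg_tail_def by (rule integral_norm_bound)
    also have "\<dots> \<le> (\<integral>y. g y * exp (N * x) \<partial>lborel)"
    proof (rule integral_mono)
      show "integrable lborel (\<lambda>y. norm (indicat_real {..x} y *\<^sub>R ?f y))"
        by (intro integrable_norm indicator_integrable psi_reg_integrable[OF P w]) simp_all
      show "integrable lborel (\<lambda>y. g y * exp (N * x))" using gi by simp
      fix y
      have "exp (Re k * y) = exp ((Re k - N) * y) * exp (N * y)" by (simp add: mult_exp_exp algebra_simps diff_divide_distrib)
      moreover have "exp (N * y) \<le> exp (N * x)" if "y \<le> x" using that assms by (simp add: mult_left_mono)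
      ultimately have "exp (Re k * y) * norm (psi_reg P w y) \<le> exp ((Re k - N) * y) * exp (N * x) * norm (psi_reg P w y)" if "y \<le> x"
        using that by (simp only:) (intro mult_right_mono mult_left_mono; simp)
      then show "norm (indicat_real {..x} y *\<^sub>R ?f y) \<le> g y * exp (N * x)"
        by (auto simp: g_def indicator_def norm_mult mult_ac)
    qed
    finally show ?thesis by simp
  qed
  moreover have "(\<integral>y. g y \<partial>lborel) \<ge> 0" by (simp add: g_def)
  ultimately show ?thesis using that by blast
qed

text \<open>The mixed products give \<open>psi_mellin\<close> at 1/2 - \<nu> and 1/2 + \<nu> up to
  tails. The product of the singular parts contributes quotients by \<nu>, which are precisely the
  polar terms that complete these values to \<open>completed_L\<close> at 1 - 2\<nu> and 1 +
  2\<nu>.\<close>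

lemma theta_conv_neg:
  assumes x: "x < 0" and \<nu>: "\<nu> \<noteq> 0"
  shows "theta_conv P w \<nu> x =
    psi_sing_coeff P w * exp ((\<nu> - 1 / 2) * of_real x) * completed_L P w (1 - 2 * \<nu>) + psi_sing_coeff P w * exp (- 1 / 2 * of_real x) * completed_L P w (1 + 2 * \<nu>)
    + ((\<integral>y. exp (\<nu> * of_real y) * psi_reg P w y * psi_reg P w (x - y) \<partial>lborel)
       - psi_sing_coeff P w * exp ((\<nu> - 1 / 2) * of_real x) * psi_reg_tail P w (1 / 2 - \<nu>) x
       - psi_sing_coeff P w * exp (- 1 / 2 * of_real x) * psi_reg_tail P w (1 / 2 + \<nu>) x)"
proof -
  have a: "exp (\<nu> * of_real y) * psi_sing P w y * psi_sing P w (x - y) =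
     (psi_sing_coeff P w)\<^sup>2 * exp (- 1 / 2 * of_real x) * (indicat_real {x<..<0} y *\<^sub>R exp (\<nu> * of_real y))" for y
  proof -
    have "exp (- 1 / 2 * of_real y) * exp (- 1 / 2 * of_real (x - y)) = exp (- 1 / 2 * complex_of_real x)"
      by (simp add: mult_exp_exp diff_divide_distrib)
    then show ?thesis by (auto simp: psi_sing_def indicator_def power2_eq_square mult_ac)
  qed
  have AA: "(\<integral>y. exp (\<nu> * of_real y) * psi_sing P w y * psi_sing P w (x - y) \<partial>lborel) =
     (psi_sing_coeff P w)\<^sup>2 * exp (- 1 / 2 * of_real x) * ((1 - exp (\<nu> * of_real x)) / \<nu>)"
    by (simp only: a integral_mult_right_zero exp_interval_integral[OF \<nu> less_imp_le[OF x]])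
  let ?g = "\<lambda>z. exp ((1 / 2 - \<nu>) * of_real z) * psi_reg P w z"
  let ?h = "\<lambda>z. indicat_real {x<..} z *\<^sub>R ?g z"
  have b: "exp (\<nu> * of_real y) * psi_sing P w y * psi_reg P w (x - y) =
     psi_sing_coeff P w * exp ((\<nu> - 1 / 2) * of_real x) * ?h (x + (- 1) * y)" for y
  proof -
    have "exp (\<nu> * of_real y) * exp (- 1 / 2 * of_real y) = exp ((\<nu> - 1 / 2) * of_real x) * exp ((1 / 2 - \<nu>) * of_real (x - y))"
      by (simp add: mult_exp_exp algebra_simps diff_divide_distrib)
    then show ?thesis by (auto simp: psi_sing_def indicator_def mult_ac)
  qed
  have "(\<integral>y. ?h (x + (- 1) * y) \<partial>lborel) = (\<integral>y. ?h y \<partial>lborel)"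
    using lborel_integral_real_affine[of "- 1" ?h x] by simp
  then have AB: "(\<integral>y. exp (\<nu> * of_real y) * psi_sing P w y * psi_reg P w (x - y) \<partial>lborel) =
     psi_sing_coeff P w * exp ((\<nu> - 1 / 2) * of_real x) * (psi_mellin P w (1 / 2 - \<nu>) - psi_reg_tail P w (1 / 2 - \<nu>) x)"
    by (simp only: b integral_mult_right_zero psi_reg_tail_compl)
  have c: "exp (\<nu> * of_real y) * psi_reg P w y * psi_sing P w (x - y) =
     psi_sing_coeff P w * exp (- 1 / 2 * of_real x) * (indicat_real {x<..} y *\<^sub>R (exp ((1 / 2 + \<nu>) * of_real y) * psi_reg P w y))" for y
  proof -
    have "exp (\<nu> * of_real y) * exp (- 1 / 2 * of_real (x - y)) = exp (- 1 / 2 * complex_of_real x) * exp ((1 / 2 + \<nu>) * of_real y)"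
      by (simp add: mult_exp_exp algebra_simps diff_divide_distrib)
    then show ?thesis by (auto simp: psi_sing_def indicator_def mult_ac)
  qed
  have BA: "(\<integral>y. exp (\<nu> * of_real y) * psi_reg P w y * psi_sing P w (x - y) \<partial>lborel) =
     psi_sing_coeff P w * exp (- 1 / 2 * of_real x) * (psi_mellin P w (1 / 2 + \<nu>) - psi_reg_tail P w (1 / 2 + \<nu>) x)"
    by (simp only: c integral_mult_right_zero psi_reg_tail_compl)
  have D: "completed_L P w (1 - 2 * \<nu>) = psi_mellin P w (1 / 2 - \<nu>) - psi_sing_coeff P w / \<nu>"
    "completed_L P w (1 + 2 * \<nu>) = psi_mellin P w (1 / 2 + \<nu>) + psi_sing_coeff P w / \<nu>"
  proof -
    have e: "(1 - 2 * \<nu>) / 2 = 1 / 2 - \<nu>" "(1 + 2 * \<nu>) / 2 = 1 / 2 + \<nu>" by (simp_all add: field_simps)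
    show "completed_L P w (1 - 2 * \<nu>) = psi_mellin P w (1 / 2 - \<nu>) - psi_sing_coeff P w / \<nu>"
      "completed_L P w (1 + 2 * \<nu>) = psi_mellin P w (1 / 2 + \<nu>) + psi_sing_coeff P w / \<nu>"
      unfolding completed_L_def e using P_ne \<nu> by (simp_all add: psi_const_def psi_sing_coeff_def field_simps)
  qed
  have e1: "exp ((\<nu> - 1 / 2) * of_real x) = exp (- 1 / 2 * of_real x) * exp (\<nu> * of_real x)"
    by (simp add: mult_exp_exp algebra_simps diff_divide_distrib)
  show ?thesis
    unfolding theta_conv_split(2) AA AB BA D e1 using \<nu> by (simp add: field_simps power2_eq_square)
qed

end

section \<open>Mellin transform of the convolution\<close>

lemma mult_regroup:
  fixes A B C D a b :: complex
  assumes "A * B = C * D"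
  shows "A * a * (B * b) = C * (D * a * b)"
proof -
  have "A * a * (B * b) = (A * B) * (a * b)" "C * (D * a * b) = (C * D) * (a * b)" by (simp_all add: mult_ac)
  then show ?thesis using assms by (simp only:)
qed

definition conv_main :: "nat set \<Rightarrow> complex \<Rightarrow> complex \<Rightarrow> real \<Rightarrow> complex" where
  "conv_main P w \<nu> x =
     psi_sing_coeff P w * exp ((\<nu> - 1 / 2) * of_real x) * completed_L P w (1 - 2 * \<nu>) +
     psi_sing_coeff P w * exp (- 1 / 2 * of_real x) * completed_L P w (1 + 2 * \<nu>)"

definition mellin_right :: "nat set \<Rightarrow> complex \<Rightarrow> complex \<Rightarrow> complex \<Rightarrow> complex" where
  "mellin_right P w \<nu> k =
     (\<integral>x. exp (k * of_real x) * (indicat_real {0..} x *\<^sub>R theta_conv P w \<nu> x) \<partial>lborel)"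

definition mellin_left :: "nat set \<Rightarrow> complex \<Rightarrow> complex \<Rightarrow> complex \<Rightarrow> complex" where
  "mellin_left P w \<nu> k =
     (\<integral>x. exp (k * of_real x) * (indicat_real {..<0} x *\<^sub>R (theta_conv P w \<nu> x - conv_main P w \<nu> x)) \<partial>lborel)"

context
  fixes P :: "nat set" and w :: complex
  assumes P: "finite P" "\<And>q. q \<in> P \<Longrightarrow> prime q" and P_ne: "P \<noteq> {}" and w: "Re w > 0"
begin

text \<open>Distributing e^(k x) over y and x - y makes the weighted function a convolution; the
  weight e^(\<nu> y) shifts the parameter of the first factor only.\<close>

lemma theta_conv_mellin_direct:
  assumes k: "Re k > 1 / 2" "Re (k + \<nu>) > 1 / 2"
  shows "integrable lborel (\<lambda>x. exp (k * of_real x) * theta_conv P w \<nu> x)"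
    and "(\<integral>x. exp (k * of_real x) * theta_conv P w \<nu> x \<partial>lborel) = completed_L P w (2 * (k + \<nu>)) * completed_L P w (2 * k)"
proof -
  let ?f = "\<lambda>y. exp ((k + \<nu>) * of_real y) * psi P (w * of_real (exp y))"
  let ?g = "\<lambda>y. exp (k * of_real y) * psi P (w * of_real (exp y))"
  have r: "Re (2 * (k + \<nu>)) > 1" "Re (2 * k) > 1" using k by auto
  have half: "2 * z / 2 = z" for z :: complex by simp
  have f: "integrable lborel ?f" "(\<integral>y. ?f y \<partial>lborel) = completed_L P w (2 * (k + \<nu>))"
    using completed_L_integral[OF P w r(1)] unfolding half by blast+
  have g: "integrable lborel ?g" "(\<integral>y. ?g y \<partial>lborel) = completed_L P w (2 * k)"
    using completed_L_integral[OF P w r(2)] unfolding half by blast+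
  have e: "?f y * ?g (x - y) = exp (k * of_real x) * (exp (\<nu> * of_real y) * psi P (w * of_real (exp y)) * psi P (w * of_real (exp (x - y))))" for x y
  proof -
    have "exp ((k + \<nu>) * of_real y) * exp (k * of_real (x - y)) = exp (k * of_real x) * exp (\<nu> * of_real y)"
      by (simp add: mult_exp_exp algebra_simps)
    then have "exp ((k + \<nu>) * of_real y) * a * (exp (k * of_real (x - y)) * b) = exp (k * of_real x) * (exp (\<nu> * of_real y) * a * b)" for a b :: complex
      by (rule mult_regroup)
    then show ?thesis .
  qed
  have c: "(\<integral>y. ?f y * ?g (x - y) \<partial>lborel) = exp (k * of_real x) * theta_conv P w \<nu> x" for x
    by (simp only: e integral_mult_right_zero theta_conv_def)
  show "integrable lborel (\<lambda>x. exp (k * of_real x) * theta_conv P w \<nu> x)"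
    using integral_convolution(1)[OF f(1) g(1)] by (simp only: c)
  show "(\<integral>x. exp (k * of_real x) * theta_conv P w \<nu> x \<partial>lborel) = completed_L P w (2 * (k + \<nu>)) * completed_L P w (2 * k)"
    using integral_convolution(2)[OF f(1) g(1)] by (simp only: c f(2) g(2))
qed

lemma theta_conv_measurable [measurable]: "theta_conv P w \<nu> \<in> borel_measurable borel"
proof -
  \<comment> \<open>Measurability is read off from integrability: this k lies in the half-plane of
    absolute convergence, and the exponential weight can be undone.\<close>
  define k where "k = complex_of_real (1 + \<bar>Re \<nu>\<bar>)"
  have k: "Re k > 1 / 2" "Re (k + \<nu>) > 1 / 2" by (auto simp: k_def)
  have "(\<lambda>x. exp (k * of_real x) * theta_conv P w \<nu> x) \<in> borel_measurable borel"
    using theta_conv_mellin_direct(1)[OF k] by auto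
  then have "(\<lambda>x. exp (- k * of_real x) * (exp (k * of_real x) * theta_conv P w \<nu> x)) \<in> borel_measurable borel"
    by measurable
  then show ?thesis by (simp add: mult.assoc[symmetric] mult_exp_exp)
qed

lemma conv_main_measurable [measurable]: "conv_main P w \<nu> \<in> borel_measurable borel"
  unfolding conv_main_def[abs_def] by measurable

text \<open>On x \<ge> 0 a larger Re k only enlarges the integrand, so every k inherits
  integrability from the half-plane of absolute convergence.\<close>

lemma theta_conv_right:
  "integrable lborel (\<lambda>x. exp (k * of_real x) * (indicat_real {0..} x *\<^sub>R theta_conv P w \<nu> x))"
proof -
  define k' where "k' = complex_of_real (1 + \<bar>Re \<nu>\<bar> + \<bar>Re k\<bar>)"
  have k': "Re k' > 1 / 2" "Re (k' + \<nu>) > 1 / 2" by (auto simp: k'_def)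
  show ?thesis
  proof (rule Bochner_Integration.integrable_bound[OF theta_conv_mellin_direct(1)[OF k']])
    have le: "exp (Re k * x) \<le> exp (Re k' * x)" if "x \<ge> 0" for x
      using that by (simp only: exp_le_cancel_iff) (intro mult_right_mono; simp add: k'_def)
    show "AE x in lborel. norm (exp (k * of_real x) * (indicat_real {0..} x *\<^sub>R theta_conv P w \<nu> x)) \<le> norm (exp (k' * of_real x) * theta_conv P w \<nu> x)"
    proof (rule AE_I2)
      fix x :: real
      show "norm (exp (k * of_real x) * (indicat_real {0..} x *\<^sub>R theta_conv P w \<nu> x)) \<le> norm (exp (k' * of_real x) * theta_conv P w \<nu> x)"
        using mult_right_mono[OF le[of x] norm_ge_zero[of "theta_conv P w \<nu> x"]] by (cases "x \<ge> 0") (simp_all add: norm_mult)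
    qed
  qed measurable
qed

text \<open>The remainder consists of the convolution of the regular parts, whose transform
  converges for every k by the convolution theorem, and of two tails that decay at any prescribed
  exponential rate.\<close>

lemma conv_rem_left:
  assumes \<nu>: "\<nu> \<noteq> 0"
  shows "integrable lborel (\<lambda>x. exp (k * of_real x) * (indicat_real {..<0} x *\<^sub>R (theta_conv P w \<nu> x - conv_main P w \<nu> x)))"
proof -
  let ?BB = "\<lambda>x. \<integral>y. exp (\<nu> * of_real y) * psi_reg P w y * psi_reg P w (x - y) \<partial>lborel"
  let ?R = "\<lambda>\<kappa> l x. exp (k * of_real x) * (psi_sing_coeff P w * exp (l * of_real x) * psi_reg_tail P w \<kappa> x)"
  have m [measurable]: "psi_reg P w \<in> borel_measurable borel" by (rule psi_reg_measurable[OF P w])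
  have B: "integrable lborel (\<lambda>x. exp (k * of_real x) * ?BB x)"
  proof -
    let ?f = "\<lambda>y. exp ((k + \<nu>) * of_real y) * psi_reg P w y"
    let ?g = "\<lambda>y. exp (k * of_real y) * psi_reg P w y"
    have e: "?f y * ?g (x - y) = exp (k * of_real x) * (exp (\<nu> * of_real y) * psi_reg P w y * psi_reg P w (x - y))" for x y
    proof -
      have "exp ((k + \<nu>) * of_real y) * exp (k * of_real (x - y)) = exp (k * of_real x) * exp (\<nu> * of_real y)"
        by (simp add: mult_exp_exp algebra_simps)
      then have "exp ((k + \<nu>) * of_real y) * a * (exp (k * of_real (x - y)) * b) = exp (k * of_real x) * (exp (\<nu> * of_real y) * a * b)" for a b :: complex
        by (rule mult_regroup)
      then show ?thesis .
    qed
    have c: "(\<integral>y. ?f y * ?g (x - y) \<partial>lborel) = exp (k * of_real x) * ?BB x" for x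
      by (simp only: e integral_mult_right_zero)
    show ?thesis
      using integral_convolution(1)[OF psi_reg_integrable[OF P w, of "k + \<nu>"] psi_reg_integrable[OF P w, of k]] by (simp only: c)
  qed
  have tail_meas: "psi_reg_tail P w \<kappa> \<in> borel_measurable borel" for \<kappa>
  proof -
    have [measurable]: "Measurable.pred (borel \<Otimes>\<^sub>M borel) (\<lambda>(x, y::real). y \<in> {..x})"
      by simp
    have "(\<lambda>x. \<integral>y. indicat_real {..x} y *\<^sub>R (exp (\<kappa> * of_real y) * psi_reg P w y) \<partial>lborel) \<in> borel_measurable lborel"
      by (rule lborel.borel_measurable_lebesgue_integral) (simp add: indicator_def[abs_def] case_prod_unfold)
    moreover have "psi_reg_tail P w \<kappa> = (\<lambda>x. \<integral>y. indicat_real {..x} y *\<^sub>R (exp (\<kappa> * of_real y) * psi_reg P w y) \<partial>lborel)"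
      by (rule ext, rule psi_reg_tail_def)
    ultimately show ?thesis by simp
  qed
  have R: "integrable lborel (\<lambda>x. indicat_real {..<0} x *\<^sub>R ?R \<kappa> l x)" for \<kappa> l
  proof -
    \<comment> \<open>Makes Re k + Re l + N at least 1, so that e^x remains as majorant for x <
      0.\<close>
    define N where "N = 1 + \<bar>Re k\<bar> + \<bar>Re l\<bar>"
    have "N \<ge> 0" by (simp add: N_def)
    then obtain C where C: "C \<ge> 0" "\<And>x. norm (psi_reg_tail P w \<kappa> x) \<le> C * exp (N * x)"
      using psi_reg_tail_decay[OF P P_ne w] by blast
    show ?thesis
    proof (rule Bochner_Integration.integrable_bound[OF integrable_mult_right[OF exp_abs_integrable, of "norm (psi_sing_coeff P w) * C"]])
      show "(\<lambda>x. indicat_real {..<0} x *\<^sub>R ?R \<kappa> l x) \<in> borel_measurable lborel"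
        using tail_meas[of \<kappa>] by measurable
      show "AE x in lborel. norm (indicat_real {..<0} x *\<^sub>R ?R \<kappa> l x) \<le> norm (norm (psi_sing_coeff P w) * C * exp (- \<bar>x\<bar>))"
      proof (rule AE_I2)
        fix x :: real
        show "norm (indicat_real {..<0} x *\<^sub>R ?R \<kappa> l x) \<le> norm (norm (psi_sing_coeff P w) * C * exp (- \<bar>x\<bar>))"
        proof (cases "x < 0")
          case True
          have "(Re k + Re l + N - 1) * x \<le> 0" using True by (intro mult_nonneg_nonpos) (auto simp: N_def)
          then have le: "exp (Re k * x + Re l * x + N * x) \<le> exp x" by (simp add: algebra_simps)
          have "norm (?R \<kappa> l x) = exp (Re k * x) * (norm (psi_sing_coeff P w) * exp (Re l * x) * norm (psi_reg_tail P w \<kappa> x))"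
            by (simp add: norm_mult)
          also have "\<dots> \<le> exp (Re k * x) * (norm (psi_sing_coeff P w) * exp (Re l * x) * (C * exp (N * x)))"
            by (intro mult_left_mono C) auto
          also have "\<dots> = norm (psi_sing_coeff P w) * C * exp (Re k * x + Re l * x + N * x)"
            by (simp add: exp_add mult_ac)
          also have "\<dots> \<le> norm (psi_sing_coeff P w) * C * exp x" using C(1) le by (intro mult_left_mono) auto
          finally show ?thesis using True C(1) by simp
        qed simp
      qed
    qed
  qed
  have eq: "exp (k * of_real x) * (indicat_real {..<0} x *\<^sub>R (theta_conv P w \<nu> x - conv_main P w \<nu> x)) =
      indicat_real {..<0} x *\<^sub>R (exp (k * of_real x) * ?BB x)
      - indicat_real {..<0} x *\<^sub>R ?R (1 / 2 - \<nu>) (\<nu> - 1 / 2) x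
      - indicat_real {..<0} x *\<^sub>R ?R (1 / 2 + \<nu>) (- 1 / 2) x" for x
  proof (cases "x < 0")
    case True
    have "theta_conv P w \<nu> x = conv_main P w \<nu> x +
      (?BB x - psi_sing_coeff P w * exp ((\<nu> - 1 / 2) * of_real x) * psi_reg_tail P w (1 / 2 - \<nu>) x
       - psi_sing_coeff P w * exp (- 1 / 2 * of_real x) * psi_reg_tail P w (1 / 2 + \<nu>) x)"
      unfolding conv_main_def by (rule theta_conv_neg[OF P P_ne w True \<nu>])
    moreover have "a * (c + (B - R - R') - c) = a * B - a * R - a * R'" for a c B R R' :: complex
      by (simp add: ring_distribs)
    ultimately show ?thesis using True by simp
  qed simp
  have IB: "integrable lborel (\<lambda>x. indicat_real {..<0} x *\<^sub>R (exp (k * of_real x) * ?BB x))"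
    by (rule indicator_integrable[OF B]) simp_all
  show ?thesis unfolding eq by (intro Bochner_Integration.integrable_diff R IB)
qed

text \<open>In the half-plane where all integrals converge absolutely, the term \<^const>\<open>conv_main\<close> contributes the two polar
  terms; both sides continue to the whole plane.\<close>

lemma theta_conv_mellin:
  assumes \<nu>: "\<nu> \<noteq> 0" and k: "k \<noteq> 1 / 2" "k \<noteq> 1 / 2 - \<nu>"
  shows "mellin_right P w \<nu> k + mellin_left P w \<nu> k
      + (psi_sing_coeff P w * completed_L P w (1 - 2 * \<nu>) / (k + \<nu> - 1 / 2) + psi_sing_coeff P w * completed_L P w (1 + 2 * \<nu>) / (k - 1 / 2))
    = completed_L P w (2 * (k + \<nu>)) * completed_L P w (2 * k)"
proof (rule continuation_from_half_plane[of "{1 / 2, 1 / 2 - \<nu>}"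
    "\<lambda>k. mellin_right P w \<nu> k + mellin_left P w \<nu> k
      + (psi_sing_coeff P w * completed_L P w (1 - 2 * \<nu>) / (k + \<nu> - 1 / 2) + psi_sing_coeff P w * completed_L P w (1 + 2 * \<nu>) / (k - 1 / 2))"
    "\<lambda>k. completed_L P w (2 * (k + \<nu>)) * completed_L P w (2 * k)" "max (1 / 2) (1 / 2 - Re \<nu>)"])
  let ?A = "- {1 / 2, 1 / 2 - \<nu>}"
  have "mellin_right P w \<nu> holomorphic_on {k. Re k \<in> UNIV}"
    unfolding mellin_right_def[abs_def] by (rule laplace_holomorphic) (use theta_conv_right[of "of_real _"] in auto)
  then have h1: "mellin_right P w \<nu> holomorphic_on ?A" by (rule holomorphic_on_subset) simp
  have "mellin_left P w \<nu> holomorphic_on {k. Re k \<in> UNIV}"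
    unfolding mellin_left_def[abs_def] by (rule laplace_holomorphic) (use conv_rem_left[OF \<nu>, of "of_real _"] in auto)
  then have h2: "mellin_left P w \<nu> holomorphic_on ?A" by (rule holomorphic_on_subset) simp
  have h3: "(\<lambda>k. psi_sing_coeff P w * completed_L P w (1 - 2 * \<nu>) / (k + \<nu> - 1 / 2) + psi_sing_coeff P w * completed_L P w (1 + 2 * \<nu>) / (k - 1 / 2)) holomorphic_on ?A"
    by (intro holomorphic_intros) (auto simp: algebra_simps)
  show "(\<lambda>k. mellin_right P w \<nu> k + mellin_left P w \<nu> k
      + (psi_sing_coeff P w * completed_L P w (1 - 2 * \<nu>) / (k + \<nu> - 1 / 2) + psi_sing_coeff P w * completed_L P w (1 + 2 * \<nu>) / (k - 1 / 2))) holomorphic_on ?A"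
    by (intro holomorphic_on_add[OF holomorphic_on_add[OF h1 h2] h3])
  have D: "completed_L P w holomorphic_on - {1}" by (rule completed_L_holomorphic[OF P w]) (use P_ne in auto)
  have d: "completed_L P w \<circ> (\<lambda>k. 2 * (k + c)) holomorphic_on ?A" if "c \<in> {0, \<nu>}" for c
  proof (rule holomorphic_on_compose_gen[OF _ D])
    show "(\<lambda>k. 2 * (k + c)) holomorphic_on ?A" by (intro holomorphic_intros)
    show "(\<lambda>k. 2 * (k + c)) ` ?A \<subseteq> - {1}"
    proof
      fix z assume "z \<in> (\<lambda>k. 2 * (k + c)) ` ?A"
      then obtain k where "k \<in> ?A" and kk3: "z = 2 * (k + c)" by blast
      then have kk: "k \<noteq> 1 / 2" "k \<noteq> 1 / 2 - \<nu>" "z = 2 * (k + c)" by simp_all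
      have "k = 1 / 2 - c" if "z = 1" using kk(3) that by (simp add: field_simps)
      then show "z \<in> - {1}" using kk \<open>c \<in> {0, \<nu>}\<close> by auto
    qed
  qed
  show "(\<lambda>k. completed_L P w (2 * (k + \<nu>)) * completed_L P w (2 * k)) holomorphic_on ?A"
    using d[of 0] d[of \<nu>] by (intro holomorphic_intros) (simp_all add: o_def)
next
  fix k assume r: "Re k > max (1 / 2) (1 / 2 - Re \<nu>)" and kA: "k \<notin> {1 / 2, 1 / 2 - \<nu>}"
  have r': "Re k > 1 / 2" "Re (k + \<nu>) > 1 / 2" "Re (k + \<nu> - 1 / 2) > 0" "Re (k - 1 / 2) > 0" using r by auto
  let ?m1 = "\<lambda>x. indicat_real {..<0} x *\<^sub>R exp ((k + \<nu> - 1 / 2) * of_real x)"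
  let ?m2 = "\<lambda>x. indicat_real {..<0} x *\<^sub>R exp ((k - 1 / 2) * of_real x)"
  let ?r = "\<lambda>x. exp (k * of_real x) * (indicat_real {0..} x *\<^sub>R theta_conv P w \<nu> x)"
  let ?l = "\<lambda>x. exp (k * of_real x) * (indicat_real {..<0} x *\<^sub>R (theta_conv P w \<nu> x - conv_main P w \<nu> x))"
  let ?c1 = "psi_sing_coeff P w * completed_L P w (1 - 2 * \<nu>)" and ?c2 = "psi_sing_coeff P w * completed_L P w (1 + 2 * \<nu>)"
  have m: "integrable lborel ?m1" "integrable lborel ?m2"
    "(\<integral>x. ?m1 x \<partial>lborel) = 1 / (k + \<nu> - 1 / 2)" "(\<integral>x. ?m2 x \<partial>lborel) = 1 / (k - 1 / 2)"
    using exp_half_line[OF r'(3)] exp_half_line[OF r'(4)] by (simp_all only: set_integrable_def set_lebesgue_integral_def)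
  have e: "exp (k * of_real x) * theta_conv P w \<nu> x = (?r x + ?l x) + (?c1 * ?m1 x + ?c2 * ?m2 x)" for x
  proof (cases "x < 0")
    case True
    have "exp ((k + \<nu> - 1 / 2) * of_real x) = exp (k * of_real x) * exp ((\<nu> - 1 / 2) * of_real x)"
      "exp ((k - 1 / 2) * of_real x) = exp (k * of_real x) * exp (- 1 / 2 * of_real x)"
      by (simp_all add: mult_exp_exp algebra_simps)
    then show ?thesis using True by (simp only: conv_main_def) (simp add: ring_distribs mult_ac)
  qed simp
  have "completed_L P w (2 * (k + \<nu>)) * completed_L P w (2 * k) = (\<integral>x. (?r x + ?l x) + (?c1 * ?m1 x + ?c2 * ?m2 x) \<partial>lborel)"
    unfolding theta_conv_mellin_direct(2)[OF r'(1,2), symmetric] e ..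
  also have "\<dots> = ((\<integral>x. ?r x \<partial>lborel) + (\<integral>x. ?l x \<partial>lborel)) + (?c1 * (\<integral>x. ?m1 x \<partial>lborel) + ?c2 * (\<integral>x. ?m2 x \<partial>lborel))"
    by (simp only: Bochner_Integration.integral_add Bochner_Integration.integrable_add integrable_mult_right
        theta_conv_right conv_rem_left[OF \<nu>] m(1,2) integral_mult_right_zero)
  also have "\<dots> = mellin_right P w \<nu> k + mellin_left P w \<nu> k + (?c1 / (k + \<nu> - 1 / 2) + ?c2 / (k - 1 / 2))"
    unfolding m(3,4) mellin_right_def mellin_left_def by simp
  finally show "mellin_right P w \<nu> k + mellin_left P w \<nu> k + (?c1 / (k + \<nu> - 1 / 2) + ?c2 / (k - 1 / 2)) = completed_L P w (2 * (k + \<nu>)) * completed_L P w (2 * k)"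
    by simp
qed (use k in auto)

end

text \<open>Finite sums of integrated norms are bounded by the integral of Re G. G is complex-valued
  because it will be the same kind of theta product, taken at real parameters.\<close>

lemma has_sum_integral_dominated:
  fixes f :: "'i \<Rightarrow> 'a \<Rightarrow> complex"
  assumes A: "countable A" "sigma_finite_measure M"
    and int: "\<And>a. a \<in> A \<Longrightarrow> integrable M (f a)"
    and G: "integrable M G" "\<And>x. x \<in> space M \<Longrightarrow> ((\<lambda>a. of_real (norm (f a x))) has_sum (G x :: complex)) A"
    and F: "\<And>x. x \<in> space M \<Longrightarrow> ((\<lambda>a. f a x) has_sum F x) A"
  shows "((\<lambda>a. \<integral>x. f a x \<partial>M) has_sum (\<integral>x. F x \<partial>M)) A"
proof (rule has_sum_integral(2)[OF A int _ F])
  have le: "(\<Sum>a\<in>B. norm (f a x)) \<le> Re (G x)" if "x \<in> space M" "finite B" "B \<subseteq> A" for x B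
  proof -
    have "((\<lambda>a. norm (f a x)) has_sum Re (G x)) A"
      using has_sum_Re[OF G(2)[OF that(1)]] by simp
    then show ?thesis using that by (intro finite_sum_le_has_sum) auto
  qed
  show "(\<lambda>a. \<integral>x. norm (f a x) \<partial>M) summable_on A"
  proof (rule nonneg_bdd_above_summable_on)
    show "bdd_above (sum (\<lambda>a. \<integral>x. norm (f a x) \<partial>M) ` {B. B \<subseteq> A \<and> finite B})"
    proof (rule bdd_aboveI2)
      fix B assume "B \<in> {B. B \<subseteq> A \<and> finite B}"
      then have B: "finite B" "B \<subseteq> A" by auto
      have "(\<Sum>a\<in>B. \<integral>x. norm (f a x) \<partial>M) = (\<integral>x. (\<Sum>a\<in>B. norm (f a x)) \<partial>M)"
        using int B by (intro Bochner_Integration.integral_sum[symmetric] integrable_norm) auto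
      also have "\<dots> \<le> (\<integral>x. Re (G x) \<partial>M)"
        using int B G(1) le by (intro integral_mono Bochner_Integration.integrable_sum integrable_norm integrable_Re) auto
      finally show "(\<Sum>a\<in>B. \<integral>x. norm (f a x) \<partial>M) \<le> (\<integral>x. Re (G x) \<partial>M)" .
    qed
  qed simp
qed

section \<open>The convolution as a divisor-Bessel series\<close>

lemma one_in_sieved: "(\<And>q. q \<in> P \<Longrightarrow> prime q) \<Longrightarrow> 1 \<in> sieved P"
  by (force simp: sieved_def dest: not_prime_unit)

text \<open>By primality, pairs of sieved numbers (m, d) correspond to sieved n = m d with a marked
  divisor d.\<close>

lemma sieved_mult_iff:
  assumes "\<And>q. q \<in> P \<Longrightarrow> prime q"
  shows "m * d \<in> sieved P \<longleftrightarrow> m \<in> sieved P \<and> d \<in> sieved P"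
proof -
  have "q dvd m * d \<longleftrightarrow> q dvd m \<or> q dvd d" if "q \<in> P" for q
    using assms[OF that] prime_dvd_mult_iff by blast
  moreover have "1 \<le> m * d \<longleftrightarrow> 1 \<le> m \<and> 1 \<le> d" by (metis One_nat_def Suc_le_eq nat_0_less_mult_iff)
  ultimately show ?thesis unfolding sieved_def by blast
qed

lemma sieved_eq_insert_coprime_indices:
  assumes P: "finite P" "\<And>q. q \<in> P \<Longrightarrow> prime q"
  shows "sieved P = insert 1 (coprime_indices P)" "1 \<notin> coprime_indices P"
proof -
  have c: "coprime n (\<Prod>P) \<longleftrightarrow> (\<forall>q\<in>P. \<not> q dvd n)" for n
  proof -
    have "coprime n (\<Prod>P) \<longleftrightarrow> (\<forall>q\<in>P. coprime n q)"
      using P(1)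
    proof (induction P rule: finite_induct)
      case (insert q Q)
      then show ?case by simp
    qed simp
    also have "\<dots> \<longleftrightarrow> (\<forall>q\<in>P. \<not> q dvd n)"
      using P(2) by (metis coprime_commute prime_imp_coprime coprime_absorb_left not_prime_unit)
    finally show ?thesis .
  qed
  have "n \<in> sieved P \<longleftrightarrow> n \<in> insert 1 (coprime_indices P)" for n
  proof (cases "n = 1")
    case True
    then show ?thesis using one_in_sieved[OF P(2)] by simp
  next
    case False
    then have "1 \<le> n \<longleftrightarrow> 2 \<le> n" by auto
    then show ?thesis using False by (simp add: sieved_def coprime_indices_def c)
  qed
  then show "sieved P = insert 1 (coprime_indices P)" by blast
  show "1 \<notin> coprime_indices P" by (simp add: coprime_indices_def)
qed

definition gauss_term :: "complex \<Rightarrow> complex \<Rightarrow> nat \<times> nat \<Rightarrow> real \<Rightarrow> real \<Rightarrow> complex" where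
  "gauss_term w \<nu> p x y = exp (\<nu> * of_real y) *
     (exp (- (of_real (pi * (real (fst p))\<^sup>2) * (w * of_real (exp y)))) *
      exp (- (of_real (pi * (real (snd p))\<^sup>2) * (w * of_real (exp (x - y))))))"

text \<open>Symmetrising the exponents by \<open>e\<^sup>y = (d / m) e\<^sup>x\<^sup>/\<^sup>2 e\<^sup>v\<close> turns each term into a Bessel integral.\<close>

lemma gauss_term_integral:
  assumes w: "Re w > 0" and md: "m \<ge> 1" "d \<ge> 1"
  shows "integrable lborel (gauss_term w \<nu> (m, d) x)"
    and "(\<integral>y. gauss_term w \<nu> (m, d) x y \<partial>lborel) =
      2 * exp (\<nu> * of_real (x / 2)) * (of_nat d powr (2 * \<nu>) / of_nat (m * d) powr \<nu>) *
      bessel_K \<nu> (2 * of_nat (m * d) * of_real pi * (w * of_real (exp (x / 2))))"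
proof -
  define q where "q = of_real (pi * real (m * d)) * (w * of_real (exp (x / 2)))"
  have q: "Re q > 0" using w md by (simp add: q_def)
  define c where "c = x / 2 + (ln (real d) - ln (real m))"
  have pos: "real m > 0" "real d > 0" using md by auto
  have ec: "exp c = exp (x / 2) * (real d / real m)" using pos by (simp add: c_def exp_add exp_diff)
  have exc: "exp (x - c) = exp (x / 2) * (real m / real d)"
  proof -
    have "x - c = x / 2 + (ln (real m) - ln (real d))" by (simp add: c_def field_simps)
    then show ?thesis using pos by (simp add: exp_add exp_diff)
  qed
  let ?g = "\<lambda>v. exp (\<nu> * of_real v) * exp (- q * of_real (exp v + exp (- v)))"
  have sh: "gauss_term w \<nu> (m, d) x (c + 1 * v) = exp (\<nu> * of_real c) * ?g v" for v
  proof -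
    have a: "of_real (pi * (real m)\<^sup>2) * (w * of_real (exp (c + v))) = q * of_real (exp v)"
    proof -
      have "pi * (real m)\<^sup>2 * exp (c + v) = pi * real (m * d) * exp (x / 2) * exp v"
        using pos unfolding exp_add ec by (simp add: power2_eq_square field_simps)
      then have "complex_of_real (pi * (real m)\<^sup>2 * exp (c + v)) * w = of_real (pi * real (m * d) * exp (x / 2) * exp v) * w" by (simp only:)
      then show ?thesis unfolding q_def of_real_mult by (simp only: mult_ac)
    qed
    have b: "of_real (pi * (real d)\<^sup>2) * (w * of_real (exp (x - (c + v)))) = q * of_real (exp (- v))"
    proof -
      have "exp (x - (c + v)) = exp (x - c) * exp (- v)" by (simp add: mult_exp_exp)
      then have "pi * (real d)\<^sup>2 * exp (x - (c + v)) = pi * real (m * d) * exp (x / 2) * exp (- v)"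
        using pos unfolding exc by (simp add: power2_eq_square field_simps)
      then have "complex_of_real (pi * (real d)\<^sup>2 * exp (x - (c + v))) * w = of_real (pi * real (m * d) * exp (x / 2) * exp (- v)) * w" by (simp only:)
      then show ?thesis unfolding q_def of_real_mult by (simp only: mult_ac)
    qed
    have "exp (- (q * of_real (exp v))) * exp (- (q * of_real (exp (- v)))) = exp (- q * of_real (exp v + exp (- v)))"
      by (simp add: mult_exp_exp algebra_simps)
    moreover have "exp (\<nu> * of_real (c + v)) = exp (\<nu> * of_real c) * exp (\<nu> * of_real v)"
      by (simp add: mult_exp_exp algebra_simps)
    ultimately show ?thesis unfolding gauss_term_def fst_conv snd_conv mult_1 a b by (simp only: mult.assoc)
  qed
  have gi: "integrable lborel ?g" using bessel_J_halves(1)[OF q] .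
  then have "integrable lborel (\<lambda>v. gauss_term w \<nu> (m, d) x (c + 1 * v))" unfolding sh by (rule integrable_mult_right)
  then show "integrable lborel (gauss_term w \<nu> (m, d) x)"
    by (subst (asm) lborel_integrable_real_affine_iff) auto
  have "(\<integral>y. gauss_term w \<nu> (m, d) x y \<partial>lborel) = (\<integral>v. gauss_term w \<nu> (m, d) x (c + 1 * v) \<partial>lborel)"
    using lborel_integral_real_affine[of 1 "gauss_term w \<nu> (m, d) x" c] by simp
  also have "\<dots> = exp (\<nu> * of_real c) * bessel_J q \<nu>" unfolding sh bessel_J_def by simp
  also have "bessel_J q \<nu> = 2 * bessel_K \<nu> (2 * q)" using bessel_K_integral[of "2 * q" \<nu>] q by (simp add: mult.commute)
  also have "2 * q = 2 * of_nat (m * d) * of_real pi * (w * of_real (exp (x / 2)))" by (simp add: q_def)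
  \<comment> \<open>(d / m)^\<nu> = d^(2\<nu>) / (m d)^\<nu>, the weight that sums to the divisor
    function over d | n.\<close>
  also have "exp (\<nu> * of_real c) = exp (\<nu> * of_real (x / 2)) * (of_nat d powr (2 * \<nu>) / of_nat (m * d) powr \<nu>)"
  proof -
    have l: "Ln (of_nat d) = of_real (ln (real d))" "Ln (of_nat (m * d)) = of_real (ln (real m) + ln (real d))"
      using Ln_of_real[of "real d"] Ln_of_real[of "real (m * d)"] pos by (simp_all add: ln_mult)
    have nz: "of_nat d \<noteq> (0::complex)" "of_nat (m * d) \<noteq> (0::complex)" using md by auto
    have "of_nat d powr (2 * \<nu>) / of_nat (m * d) powr \<nu> = exp (2 * \<nu> * of_real (ln (real d)) - \<nu> * of_real (ln (real m) + ln (real d)))"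
      using nz unfolding powr_def l by (simp add: exp_diff)
    then show ?thesis by (simp add: c_def mult_exp_exp algebra_simps)
  qed
  finally show "(\<integral>y. gauss_term w \<nu> (m, d) x y \<partial>lborel) =
      2 * exp (\<nu> * of_real (x / 2)) * (of_nat d powr (2 * \<nu>) / of_nat (m * d) powr \<nu>) *
      bessel_K \<nu> (2 * of_nat (m * d) * of_real pi * (w * of_real (exp (x / 2))))"
    by simp
qed

text \<open>Taking norms replaces w and \<nu> by their real parts, so the dominating function is the
  convolution integrand at these parameters.\<close>

lemma theta_conv_has_sum_pairs:
  assumes P: "finite P" "\<And>q. q \<in> P \<Longrightarrow> prime q" "P \<noteq> {}" and w: "Re w > 0"
  shows "((\<lambda>p. \<integral>y. gauss_term w \<nu> p x y \<partial>lborel) has_sum theta_conv P w \<nu> x) (sieved P \<times> sieved P)"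
  unfolding theta_conv_def
proof (rule has_sum_integral_dominated)
  have cf: "countable (sieved P)" by (rule countable_subset[OF subset_UNIV]) simp
  then show "countable (sieved P \<times> sieved P)" by (intro countable_SIGMA)
  show "sigma_finite_measure (lborel :: real measure)" by (rule lborel.sigma_finite_measure_axioms)
  show "integrable lborel (gauss_term w \<nu> p x)" if "p \<in> sieved P \<times> sieved P" for p
    using that gauss_term_integral(1)[OF w] sieved_ge by (cases p) auto
  have sum: "((\<lambda>p. gauss_term w \<nu> p x y) has_sum exp (\<nu> * of_real y) * psi P (w * of_real (exp y)) * psi P (w * of_real (exp (x - y)))) (sieved P \<times> sieved P)"
    if "Re w > 0" for w \<nu> y
  proof -
    have "((\<lambda>(m, d). exp (- (of_real (pi * (real m)\<^sup>2) * (w * of_real (exp y)))) * exp (- (of_real (pi * (real d)\<^sup>2) * (w * of_real (exp (x - y))))))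
       has_sum psi P (w * of_real (exp y)) * psi P (w * of_real (exp (x - y)))) (sieved P \<times> sieved P)"
      by (intro has_sum_Times_complex psi_has_sum) (use that in auto)
    then have "((\<lambda>p. exp (\<nu> * of_real y) * (case p of (m, d) \<Rightarrow> exp (- (of_real (pi * (real m)\<^sup>2) * (w * of_real (exp y)))) * exp (- (of_real (pi * (real d)\<^sup>2) * (w * of_real (exp (x - y)))))))
       has_sum exp (\<nu> * of_real y) * (psi P (w * of_real (exp y)) * psi P (w * of_real (exp (x - y))))) (sieved P \<times> sieved P)"
      by (rule has_sum_cmult_right)
    then show ?thesis unfolding gauss_term_def by (simp only: case_prod_unfold mult.assoc)
  qed
  show "((\<lambda>p. gauss_term w \<nu> p x y) has_sum exp (\<nu> * of_real y) * psi P (w * of_real (exp y)) * psi P (w * of_real (exp (x - y)))) (sieved P \<times> sieved P)" for y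
    by (rule sum[OF w])
  let ?w = "complex_of_real (Re w)" and ?\<nu> = "complex_of_real (Re \<nu>)"
  have rw: "Re ?w > 0" using w by simp
  show "integrable lborel (\<lambda>y. exp (?\<nu> * of_real y) * psi P (?w * of_real (exp y)) * psi P (?w * of_real (exp (x - y))))"
    by (rule theta_conv_split(1)[OF P rw])
  show "((\<lambda>p. of_real (norm (gauss_term w \<nu> p x y))) has_sum exp (?\<nu> * of_real y) * psi P (?w * of_real (exp y)) * psi P (?w * of_real (exp (x - y)))) (sieved P \<times> sieved P)" for y
  proof -
    have "of_real (norm (gauss_term w \<nu> p x y)) = gauss_term ?w ?\<nu> p x y" for p
    proof -
      have "norm (gauss_term w \<nu> p x y) = exp (Re \<nu> * y) * (exp (- (pi * (real (fst p))\<^sup>2 * (Re w * exp y))) * exp (- (pi * (real (snd p))\<^sup>2 * (Re w * exp (x - y)))))"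
        by (simp add: gauss_term_def norm_mult)
      then show ?thesis unfolding gauss_term_def
        by (simp only: of_real_mult[symmetric] of_real_minus[symmetric] exp_of_real)
    qed
    then show ?thesis using sum[OF rw, of ?\<nu> y] by (simp only:)
  qed
qed

text \<open>Pairs are grouped by their product n: the Bessel factor depends on n alone and the
  weights add up to the divisor function.\<close>

lemma theta_conv_has_sum:
  assumes P: "finite P" "\<And>q. q \<in> P \<Longrightarrow> prime q" "P \<noteq> {}" and w: "Re w > 0"
  shows "((\<lambda>n. 2 * exp (\<nu> * of_real (x / 2)) * sigma_bessel_term (2 * \<nu>) (w * of_real (exp (x / 2))) n)
    has_sum theta_conv P w \<nu> x) (sieved P)"
proof -
  define K where "K = (\<lambda>n::nat. bessel_K \<nu> (2 * of_nat n * of_real pi * (w * of_real (exp (x / 2)))))"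
  define E where "E = 2 * exp (\<nu> * of_real (x / 2))"
  let ?S = "sieved P" and ?T = "Sigma (sieved P) (\<lambda>n. {d. d dvd n})"
  let ?F = "\<lambda>(m, d). \<integral>y. gauss_term w \<nu> (m, d) x y \<partial>lborel"
  let ?h = "\<lambda>(n::nat, d::nat). (n div d, d)"
  have bij: "bij_betw ?h ?T (?S \<times> ?S)"
  proof (rule bij_betw_byWitness[where f' = "\<lambda>(m, d). (m * d, d)"])
    show "\<forall>a\<in>?T. (case ?h a of (m, d) \<Rightarrow> (m * d, d)) = a" by auto
    show "\<forall>a'\<in>?S \<times> ?S. ?h (case a' of (m, d) \<Rightarrow> (m * d, d)) = a'" using sieved_ge by fastforce
    show "?h ` ?T \<subseteq> ?S \<times> ?S"
    proof
      fix z assume "z \<in> ?h ` ?T"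
      then obtain n d where z: "z = (n div d, d)" "n \<in> ?S" "d dvd n" by auto
      then have "n div d * d \<in> ?S" by simp
      then show "z \<in> ?S \<times> ?S" unfolding z(1) using sieved_mult_iff[OF P(2)] by blast
    qed
    show "(\<lambda>(m, d). (m * d, d)) ` (?S \<times> ?S) \<subseteq> ?T"
      using sieved_mult_iff[OF P(2)] by auto
  qed
  have "(?F has_sum theta_conv P w \<nu> x) (?S \<times> ?S)"
    using theta_conv_has_sum_pairs[OF P w, of \<nu> x] by (simp add: case_prod_unfold)
  then have s: "((\<lambda>p. ?F (?h p)) has_sum theta_conv P w \<nu> x) ?T"
    by (subst has_sum_reindex_bij_betw[OF bij])
  have inner: "((\<lambda>d. ?F (?h (n, d))) has_sum E * sigma_bessel_term (2 * \<nu>) (w * of_real (exp (x / 2))) n) {d. d dvd n}"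
    if n: "n \<in> ?S" for n
  proof -
    have n0: "n > 0" using sieved_ge[OF n] by simp
    have fin: "finite {d. d dvd n}" using n0 by simp
    have v: "?F (?h (n, d)) = E * (of_nat d powr (2 * \<nu>) / of_nat n powr \<nu>) * K n" if "d dvd n" for d
    proof -
      have "n div d * d = n" using that by simp
      moreover from this have "n div d \<ge> 1" "d \<ge> 1" using n0 by (metis One_nat_def Suc_leI mult_eq_0_iff neq0_conv)+
      ultimately show ?thesis using gauss_term_integral(2)[OF w, of "n div d" d \<nu> x] by (simp add: E_def K_def)
    qed
    have "(\<Sum>d | d dvd n. ?F (?h (n, d))) = (\<Sum>d | d dvd n. E * (of_nat d powr (2 * \<nu>) / of_nat n powr \<nu>) * K n)"
      by (rule sum.cong[OF refl v]) simp
    also have "\<dots> = E * ((\<Sum>d | d dvd n. of_nat d powr (2 * \<nu>)) / of_nat n powr \<nu> * K n)"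
      by (simp add: sum_divide_distrib sum_distrib_left sum_distrib_right mult.assoc)
    also have "\<dots> = E * sigma_bessel_term (2 * \<nu>) (w * of_real (exp (x / 2))) n"
      by (simp add: sigma_bessel_term_def divisor_sigma_def K_def)
    finally show ?thesis using has_sum_finite[OF fin, of "\<lambda>d. ?F (?h (n, d))"] by (simp only:)
  qed
  show ?thesis unfolding E_def[symmetric]
    by (rule has_sum_SigmaD[OF s inner])
qed

text \<open>The n = 1 term of the divisor-Bessel series, with its exponential factor.\<close>

definition gauss_conv :: "complex \<Rightarrow> complex \<Rightarrow> real \<Rightarrow> complex" where
  "gauss_conv w \<nu> x = (\<integral>y. gauss_term w \<nu> (1, 1) x y \<partial>lborel)"

lemma sigma_bessel_sum_eq:
  assumes P: "finite P" "\<And>q. q \<in> P \<Longrightarrow> prime q" "P \<noteq> {}" and w: "Re w > 0"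
  shows "sigma_bessel_term (2 * \<nu>) (w * of_real (exp (x / 2))) summable_on coprime_indices P"
    and "sigma_bessel_sum P (2 * \<nu>) (w * of_real (exp (x / 2))) =
      exp (- \<nu> * of_real (x / 2)) / 2 * (theta_conv P w \<nu> x - gauss_conv w \<nu> x)"
proof -
  define E where "E = 2 * exp (\<nu> * of_real (x / 2))"
  let ?t = "sigma_bessel_term (2 * \<nu>) (w * of_real (exp (x / 2)))"
  have E: "E \<noteq> 0" "1 / E = exp (- \<nu> * of_real (x / 2)) / 2" by (simp_all add: E_def exp_minus field_simps)
  have "gauss_conv w \<nu> x = E * ?t 1"
    unfolding gauss_conv_def by (subst gauss_term_integral(2)[OF w]) (simp_all add: E_def sigma_bessel_term_def divisor_sigma_def)
  moreover have s: "((\<lambda>n. E * ?t n) has_sum theta_conv P w \<nu> x) (insert 1 (coprime_indices P))"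
    using theta_conv_has_sum[OF P w, of \<nu> x] sieved_eq_insert_coprime_indices(1)[OF P(1,2)] by (simp only: E_def)
  have "((\<lambda>n. E * ?t n) has_sum theta_conv P w \<nu> x - E * ?t 1) (insert 1 (coprime_indices P) - {1})"
    using has_sum_finite[of "{1}" "\<lambda>n. E * ?t n"] by (intro has_sum_Diff[OF s]) auto
  moreover have "insert 1 (coprime_indices P) - {1} = coprime_indices P"
    using sieved_eq_insert_coprime_indices(2)[OF P(1,2)] by simp
  ultimately have "((\<lambda>n. E * ?t n) has_sum theta_conv P w \<nu> x - gauss_conv w \<nu> x) (coprime_indices P)" by simp
  then have "((\<lambda>n. 1 / E * (E * ?t n)) has_sum 1 / E * (theta_conv P w \<nu> x - gauss_conv w \<nu> x)) (coprime_indices P)"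
    by (rule has_sum_cmult_right)
  then have h: "(?t has_sum 1 / E * (theta_conv P w \<nu> x - gauss_conv w \<nu> x)) (coprime_indices P)"
    using E(1) by simp
  then show "?t summable_on coprime_indices P" by (rule has_sum_imp_summable)
  show "sigma_bessel_sum P (2 * \<nu>) (w * of_real (exp (x / 2))) =
      exp (- \<nu> * of_real (x / 2)) / 2 * (theta_conv P w \<nu> x - gauss_conv w \<nu> x)"
    unfolding sigma_bessel_sum_def using infsumI[OF h] E(2) by simp
qed

text \<open>A convolution of two single Gaussian factors, which lack the e^(-x/2) growth of
  \<open>psi\<close> at -infinity; positive real parts therefore suffice. For k = (s - \<alpha>)/2
  and \<nu> = \<alpha>/2 they mean Re s > max(0, Re \<alpha>).\<close>

lemma gauss_conv_mellin:
  assumes w: "Re w > 0" and k: "Re k > 0" "Re (k + \<nu>) > 0"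
  shows "integrable lborel (\<lambda>x. exp (k * of_real x) * gauss_conv w \<nu> x)"
    and "(\<integral>x. exp (k * of_real x) * gauss_conv w \<nu> x \<partial>lborel) =
      Gamma (k + \<nu>) * Gamma k * (of_real pi * w) powr (- (2 * k + \<nu>))"
proof -
  let ?f = "\<lambda>y. exp ((k + \<nu>) * of_real y) * exp (- (of_real pi * w) * of_real (exp y))"
  let ?g = "\<lambda>y. exp (k * of_real y) * exp (- (of_real pi * w) * of_real (exp y))"
  have pw: "Re (of_real pi * w) > 0" using w by simp
  note f = Gamma_integral_rotated[OF k(2) pw] and g = Gamma_integral_rotated[OF k(1) pw]
  have e: "?f y * ?g (x - y) = exp (k * of_real x) * gauss_term w \<nu> (1, 1) x y" for x y
  proof -
    have "exp ((k + \<nu>) * of_real y) * exp (k * of_real (x - y)) = exp (k * of_real x) * exp (\<nu> * of_real y)"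
      by (simp add: mult_exp_exp algebra_simps)
    then have "exp ((k + \<nu>) * of_real y) * a * (exp (k * of_real (x - y)) * b) = exp (k * of_real x) * (exp (\<nu> * of_real y) * a * b)" for a b :: complex
      by (rule mult_regroup)
    from this[of "exp (- (of_real pi * w) * of_real (exp y))" "exp (- (of_real pi * w) * of_real (exp (x - y)))"]
    show ?thesis unfolding gauss_term_def by (simp add: mult.assoc)
  qed
  have c: "(\<integral>y. ?f y * ?g (x - y) \<partial>lborel) = exp (k * of_real x) * gauss_conv w \<nu> x" for x
    by (simp only: e integral_mult_right_zero gauss_conv_def)
  show "integrable lborel (\<lambda>x. exp (k * of_real x) * gauss_conv w \<nu> x)"
    using integral_convolution(1)[OF f(1) g(1)] by (simp only: c)
  have "(\<integral>x. exp (k * of_real x) * gauss_conv w \<nu> x \<partial>lborel) =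
      (Gamma (k + \<nu>) * (of_real pi * w) powr (- (k + \<nu>))) * (Gamma k * (of_real pi * w) powr (- k))"
    using integral_convolution(2)[OF f(1) g(1)] by (simp only: c f(2) g(2))
  also have "\<dots> = Gamma (k + \<nu>) * Gamma k * ((of_real pi * w) powr (- (k + \<nu>)) * (of_real pi * w) powr (- k))"
    by (simp only: mult_ac)
  also have "(of_real pi * w) powr (- (k + \<nu>)) * (of_real pi * w) powr (- k) = (of_real pi * w) powr (- (2 * k + \<nu>))"
    by (simp add: powr_add[symmetric] algebra_simps)
  finally show "(\<integral>x. exp (k * of_real x) * gauss_conv w \<nu> x \<partial>lborel) =
      Gamma (k + \<nu>) * Gamma k * (of_real pi * w) powr (- (2 * k + \<nu>))" .
qed

section \<open>The representation of the zeta product\<close>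

lemma gamma_zeta_pole_Ints: "gamma_zeta_pole b \<Longrightarrow> b \<in> \<int>"
proof -
  assume "gamma_zeta_pole b"
  moreover have "b \<in> \<int>" if "b / 2 \<in> \<int>\<^sub>\<le>\<^sub>0"
  proof -
    have "b / 2 \<in> \<int>" using that nonpos_Ints_Int by blast
    then have "2 * (b / 2) \<in> \<int>" by (intro Ints_mult) auto
    then show ?thesis by simp
  qed
  ultimately show ?thesis by (auto simp: gamma_zeta_pole_def)
qed

text \<open>The exceptional points are integers, hence isolated, so a continuous function that
  agrees with F off them determines the limit.\<close>

lemma gamma_zeta_limit_eq:
  assumes eq: "\<And>b. \<not> gamma_zeta_pole b \<Longrightarrow> F b = Q b" and Q: "isCont Q \<beta>"
  shows "(if gamma_zeta_pole \<beta> then Lim (at \<beta>) F else F \<beta>) = Q \<beta>"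
proof (cases "gamma_zeta_pole \<beta>")
  case True
  have "open (- (\<int> - {\<beta>}) :: complex set)"
    by (intro open_Compl closed_subset_Ints) auto
  then have "\<forall>\<^sub>F b in at \<beta>. b \<in> - (\<int> - {\<beta>}) - {\<beta>}"
    by (rule eventually_at_in_open) auto
  then have "\<forall>\<^sub>F b in at \<beta>. Q b = F b"
    by eventually_elim (use eq gamma_zeta_pole_Ints in force)
  moreover have "(Q \<longlongrightarrow> Q \<beta>) (at \<beta>)" using Q by (simp add: isCont_def)
  ultimately have "(F \<longlongrightarrow> Q \<beta>) (at \<beta>)" using Lim_transform_eventually by blast
  then have "Lim (at \<beta>) F = Q \<beta>" by (intro tendsto_Lim) auto
  then show ?thesis using True by simp
qed (use eq in simp)

lemma isCont_powr_right:
  fixes w :: complex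
  assumes "w \<noteq> 0" "isCont f x"
  shows "isCont (\<lambda>b. w powr f b) x"
  using assms by (auto simp: powr_def intro!: continuous_intros)

text \<open>Eliminates Gamma and \<open>zeta\<close> together in favour of a function whose
  singularities are known.\<close>

lemma Gamma_zeta_eq:
  assumes "\<not> gamma_zeta_pole b"
  shows "b \<noteq> 0" "b \<noteq> 1" "Gamma (b / 2) * zeta b = of_real pi powr (b / 2) * completed_L {} 1 b"
proof -
  have b: "b / 2 \<notin> \<int>\<^sub>\<le>\<^sub>0" "b \<noteq> 1" using assms by (auto simp: gamma_zeta_pole_def)
  then show b0: "b \<noteq> 0" "b \<noteq> 1" by auto
  have G: "Gamma (b / 2) * rGamma (b / 2) = 1" using b(1) by (simp add: rGamma_inverse_Gamma Gamma_eq_zero_iff)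
  have pi: "of_real pi powr (b / 2) * of_real pi powr (- b / 2) = (1::complex)" by (simp add: powr_add[symmetric])
  have "of_real pi powr (b / 2) * completed_L {} 1 b = of_real pi powr (b / 2) * (Gamma (b / 2) * rGamma (b / 2)) * completed_L {} 1 b"
    by (simp add: G)
  also have "\<dots> = Gamma (b / 2) * (of_real pi powr (b / 2) * (rGamma (b / 2) * completed_L {} 1 b))" by (simp only: mult_ac)
  also have "\<dots> = Gamma (b / 2) * ((of_real pi powr (b / 2) * of_real pi powr (- b / 2)) * zeta b)"
    using zeta_completed[OF b0] by (simp only: mult.assoc)
  finally show "Gamma (b / 2) * zeta b = of_real pi powr (b / 2) * completed_L {} 1 b" unfolding pi by simp
qed

lemma pi_powr_split:
  fixes w a :: complex
  shows "w \<noteq> 0 \<Longrightarrow> (of_real pi * w) powr a = of_real pi powr a * w powr a"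
  using powr_times_exp[of w "ln pi" a] by (simp add: powr_def Ln_of_real mult_ac)

section \<open>The factors of the formula in terms of the completed L-function\<close>

context
  fixes P :: "nat set" and w :: complex
  assumes P: "finite P" "\<And>q. q \<in> P \<Longrightarrow> prime q" and P_ne: "P \<noteq> {}" and w: "Re w > 0"
begin

lemma completed_L_isCont:
  assumes "b \<noteq> 1"
  shows "isCont (completed_L P w) b"
proof -
  have "completed_L P w holomorphic_on - {1}" by (rule completed_L_holomorphic[OF P w]) (use P_ne in auto)
  then have "continuous_on (- {1}) (completed_L P w)" by (rule holomorphic_on_imp_continuous_on)
  moreover have "open (- {1::complex})" by (simp add: open_Compl)
  ultimately show ?thesis using assms continuous_on_eq_continuous_at by blast
qed

lemma euler_factors: "(\<Prod>p\<in>P. (1 - 1 / of_nat p) * (1 - 1 / of_nat p powr b)) = 2 * psi_lead P * (\<Prod>p\<in>P. 1 - 1 / of_nat p powr b)"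
  by (simp add: prod.distrib psi_lead_def)

text \<open>As P is nonempty, the right-hand side is regular at 0 too and provides the continuous
  extension there.\<close>

lemma completed_L_sieved': 
  assumes b: "b \<noteq> 0" "b \<noteq> 1"
  shows "(\<Prod>p\<in>P. 1 - 1 / of_nat p powr b) * completed_L {} 1 b = w powr (b / 2) * completed_L P w b"
proof -
  have "w powr (b / 2) * w powr (- b / 2) = 1" using w by (auto simp: powr_add[symmetric])
  then show ?thesis using completed_L_sieved[OF P w b] by (simp add: mult.assoc[symmetric])
qed

text \<open>The right-hand side is continuous at every \<beta> \<noteq> 1 and so equals the limit at
  nonpositive even \<beta>. At \<beta> = 1 - \<alpha> and 1 + \<alpha> the hypothesis amounts to
  \<alpha> \<noteq> 0.\<close>

lemma calR_eq:
  assumes "\<beta> \<noteq> 1"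
  shows "calR P \<beta> = 2 * psi_lead P * (w powr (\<beta> / 2) * completed_L P w \<beta>)"
  unfolding calR_def Let_def
proof (rule gamma_zeta_limit_eq)
  have "w \<noteq> 0" using w by auto
  then show "isCont (\<lambda>b. 2 * psi_lead P * (w powr (b / 2) * completed_L P w b)) \<beta>"
    using completed_L_isCont[OF assms] by (intro continuous_intros isCont_powr_right) auto
  fix b assume np: "\<not> gamma_zeta_pole b"
  note g = Gamma_zeta_eq[OF np]
  have pi: "of_real pi powr (- b / 2) * of_real pi powr (b / 2) = (1::complex)" by (simp add: powr_add[symmetric])
  have "of_real pi powr (- b / 2) * Gamma (b / 2) * zeta b * (\<Prod>p\<in>P. (1 - 1 / of_nat p) * (1 - 1 / of_nat p powr b))
     = of_real pi powr (- b / 2) * (Gamma (b / 2) * zeta b) * (2 * psi_lead P * (\<Prod>p\<in>P. 1 - 1 / of_nat p powr b))"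
    unfolding euler_factors by (simp only: mult.assoc)
  also have "\<dots> = (of_real pi powr (- b / 2) * of_real pi powr (b / 2)) * (2 * psi_lead P * ((\<Prod>p\<in>P. 1 - 1 / of_nat p powr b) * completed_L {} 1 b))"
    unfolding g(3) by (simp only: mult_ac)
  also have "\<dots> = 2 * psi_lead P * (w powr (b / 2) * completed_L P w b)"
    unfolding pi completed_L_sieved'[OF g(1,2)] by simp
  finally show "of_real pi powr (- b / 2) * Gamma (b / 2) * zeta b * (\<Prod>p\<in>P. (1 - 1 / of_nat p) * (1 - 1 / of_nat p powr b))
     = 2 * psi_lead P * (w powr (b / 2) * completed_L P w b)" .
qed

text \<open>Zeta is taken at b but the Euler factors at 1 - b; the functional equation moves the
  completed zeta function to 1 - b, where the factors can be absorbed.\<close>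

lemma calF_eq:
  assumes "\<beta> \<noteq> 0" and W: "csqrt (\<tau> / of_real t) = W" "W \<noteq> 0"
  shows "calF P \<tau> \<beta> t = 1 / 2 * psi_lead P * W powr (\<beta> / 2) * (w powr ((1 - \<beta>) / 2) * completed_L P w (1 - \<beta>))"
  unfolding calF_def Let_def W(1)
proof (rule gamma_zeta_limit_eq)
  have "isCont (\<lambda>b. completed_L P w (1 - b)) \<beta>"
    using assms(1) by (intro continuous_within_compose3[OF completed_L_isCont] continuous_intros) auto
  moreover have "w \<noteq> 0" using w by auto
  ultimately show "isCont (\<lambda>b. 1 / 2 * psi_lead P * W powr (b / 2) * (w powr ((1 - b) / 2) * completed_L P w (1 - b))) \<beta>"
    using W(2) by (intro continuous_intros isCont_powr_right) auto
  fix b assume np: "\<not> gamma_zeta_pole b"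
  note g = Gamma_zeta_eq[OF np]
  have b: "1 - b \<noteq> 0" "1 - b \<noteq> 1" using g(1,2) by auto
  have r: "completed_L {} 1 b = completed_L {} 1 (1 - b)" by (rule completed_L_reflect[symmetric])
  have "(1 / of_real pi * W) powr (b / 2) = of_real pi powr (- b / 2) * W powr (b / 2)"
  proof -
    have "of_real (exp (- ln pi)) = 1 / complex_of_real pi" by (simp add: exp_minus inverse_eq_divide)
    moreover have "exp (b / 2 * of_real (- ln pi)) = of_real pi powr (- b / 2)" by (simp add: powr_def Ln_of_real)
    ultimately have "(W * (1 / of_real pi)) powr (b / 2) = W powr (b / 2) * of_real pi powr (- b / 2)"
      using powr_times_exp[OF W(2), of "- ln pi" "b / 2"] by (simp only:)
    then show ?thesis by (simp only: mult.commute)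
  qed
  moreover have "of_real pi powr (b / 2) * of_real pi powr (- b / 2) = (1::complex)" by (simp add: powr_add[symmetric])
  ultimately have pi: "of_real pi powr (b / 2) * (1 / of_real pi * W) powr (b / 2) = W powr (b / 2)"
    by (simp add: mult.assoc[symmetric])
  have "1 / 4 * Gamma (b / 2) * zeta b * (1 / of_real pi * W) powr (b / 2) * (\<Prod>p\<in>P. (1 - 1 / of_nat p) * (1 - 1 / of_nat p powr (1 - b)))
    = 1 / 4 * (Gamma (b / 2) * zeta b) * (1 / of_real pi * W) powr (b / 2) * (2 * psi_lead P * (\<Prod>p\<in>P. 1 - 1 / of_nat p powr (1 - b)))"
    unfolding euler_factors by (simp only: mult.assoc)
  also have "\<dots> = 1 / 4 * (of_real pi powr (b / 2) * (1 / of_real pi * W) powr (b / 2)) * (2 * psi_lead P * ((\<Prod>p\<in>P. 1 - 1 / of_nat p powr (1 - b)) * completed_L {} 1 (1 - b)))"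
    unfolding g(3) r by (simp only: mult_ac)
  also have "\<dots> = 1 / 2 * psi_lead P * W powr (b / 2) * (w powr ((1 - b) / 2) * completed_L P w (1 - b))"
    unfolding pi completed_L_sieved'[OF b] by simp
  finally show "1 / 4 * Gamma (b / 2) * zeta b * (1 / of_real pi * W) powr (b / 2) * (\<Prod>p\<in>P. (1 - 1 / of_nat p) * (1 - 1 / of_nat p powr (1 - b)))
    = 1 / 2 * psi_lead P * W powr (b / 2) * (w powr ((1 - b) / 2) * completed_L P w (1 - b))" .
qed

lemma zeta_euler_eq:
  assumes s: "Re s > 0" "s \<noteq> 1"
  shows "zeta s * (\<Prod>p\<in>P. 1 - 1 / of_nat p powr s) = (of_real pi * w) powr (s / 2) * completed_L P w s / Gamma (s / 2)"
proof -
  have "s / 2 \<notin> \<int>\<^sub>\<le>\<^sub>0" using s(1) by (auto elim!: nonpos_Ints_cases simp: complex_eq_iff)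
  then have np: "\<not> gamma_zeta_pole s" and G: "Gamma (s / 2) \<noteq> 0"
    using s(2) by (auto simp: gamma_zeta_pole_def Gamma_eq_zero_iff)
  note g = Gamma_zeta_eq[OF np]
  have w0: "w \<noteq> 0" using w by auto
  have "Gamma (s / 2) * (zeta s * (\<Prod>p\<in>P. 1 - 1 / of_nat p powr s)) = of_real pi powr (s / 2) * ((\<Prod>p\<in>P. 1 - 1 / of_nat p powr s) * completed_L {} 1 s)"
    unfolding mult.assoc[symmetric] g(3) by (simp only: mult_ac)
  also have "\<dots> = (of_real pi * w) powr (s / 2) * completed_L P w s"
    unfolding completed_L_sieved'[OF g(1,2)] pi_powr_split[OF w0] by (simp only: mult.assoc)
  finally show ?thesis using G by (simp add: field_simps)
qed

end

text \<open>Half a principal argument is again principal, so the logarithm of the root is exactly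
  half the logarithm.\<close>

lemma csqrt_powr:
  assumes "z \<noteq> 0"
  shows "z powr a = csqrt z powr (2 * a)"
proof -
  have "csqrt z = exp (Ln z / 2)" using assms by (rule csqrt_exp_Ln)
  moreover have "Ln (exp (Ln z / 2)) = Ln z / 2"
  proof (rule Ln_exp)
    have "Im (Ln z / 2) = Im (Ln z) / 2" by simp
    then show "- pi < Im (Ln z / 2)" "Im (Ln z / 2) \<le> pi"
      using mpi_less_Im_Ln[OF assms] Im_Ln_le_pi[OF assms] pi_gt_zero by linarith+
  qed
  ultimately have L: "Ln (csqrt z) = Ln z / 2" by (simp only:)
  have "csqrt z \<noteq> 0" using assms by simp
  then show ?thesis unfolding powr_def L using assms by simp
qed

lemma Re_csqrt_pos:
  assumes "Re z > 0"
  shows "Re (csqrt z) > 0"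
proof (rule ccontr)
  assume "\<not> ?thesis"
  then have r: "Re (csqrt z) = 0" using Re_csqrt[of z] by linarith
  have "Re (c\<^sup>2) \<le> 0" if "Re c = 0" for c using that by (simp add: power2_eq_square)
  from this[OF r] have "Re z \<le> 0" by (simp only: power2_csqrt)
  then show False using assms by simp
qed

lemma csqrt_exp_scale:
  assumes "Re z > 0"
  shows "csqrt (z * of_real (exp x)) = csqrt z * of_real (exp (x / 2))"
proof (rule csqrt_unique)
  have "(complex_of_real (exp (x / 2)))\<^sup>2 = of_real (exp x)"
    by (simp add: of_real_power[symmetric] exp_double[symmetric] del: of_real_power)
  then show "(csqrt z * of_real (exp (x / 2)))\<^sup>2 = z * of_real (exp x)" by (simp add: power_mult_distrib)
  show "0 < Re (csqrt z * of_real (exp (x / 2))) \<or> Re (csqrt z * of_real (exp (x / 2))) = 0 \<and> 0 \<le> Im (csqrt z * of_real (exp (x / 2)))"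
    using Re_csqrt_pos[OF assms] by simp
qed

section \<open>The integrand in the variable x = ln t\<close>

lemma gauss_conv_measurable:
  assumes w: "Re w > 0"
  shows "gauss_conv w \<nu> \<in> borel_measurable borel"
proof -
  define k where "k = complex_of_real (1 + \<bar>Re \<nu>\<bar>)"
  have k: "Re k > 0" "Re (k + \<nu>) > 0" by (auto simp: k_def)
  have "(\<lambda>x. exp (k * of_real x) * gauss_conv w \<nu> x) \<in> borel_measurable borel"
    using gauss_conv_mellin(1)[OF w k] by auto
  then have "(\<lambda>x. exp (- k * of_real x) * (exp (k * of_real x) * gauss_conv w \<nu> x)) \<in> borel_measurable borel"
    by measurable
  then show ?thesis by (simp add: mult.assoc[symmetric] mult_exp_exp)
qed

text \<open>The Mellin integral over the line, folded at 0 by x -> -x. \<open>conv_main\<close> is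
  subtracted only in the reflected part, since it describes the convolution at -infinity; the factor
  1/2 reflects that the exponential integral represents twice the Bessel function.\<close>

definition folded_integrand :: "nat set \<Rightarrow> complex \<Rightarrow> complex \<Rightarrow> complex \<Rightarrow> real \<Rightarrow> complex" where
  "folded_integrand P w \<nu> k x = (exp (k * of_real x) * (theta_conv P w \<nu> x - gauss_conv w \<nu> x)
     + exp (- k * of_real x) * (theta_conv P w \<nu> (- x) - conv_main P w \<nu> (- x) - gauss_conv w \<nu> (- x))) / 2"

text \<open>For t = e^x the roots of \<tau> t and \<tau> / t are w e^(x/2) and w e^(-x/2), so the
  two series are the convolution at x and at -x without its n = 1 term. The factor e^(-x) will
  cancel against dt = e^x dx.\<close>

lemma zeta_integrand_exp:
  assumes P: "finite P" "\<And>q. q \<in> P \<Longrightarrow> prime q" "P \<noteq> {}" and \<tau>: "Re \<tau> > 0" and \<nu>: "\<nu> \<noteq> 0"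
  shows "zeta_integrand P \<tau> (2 * \<nu>) s (exp x) = of_real (exp (- x)) * folded_integrand P (csqrt \<tau>) \<nu> (s / 2 - \<nu>) x"
proof -
  define w where "w = csqrt \<tau>"
  have w: "Re w > 0" unfolding w_def by (rule Re_csqrt_pos[OF \<tau>])
  have w0: "w \<noteq> 0" using w by auto
  have sq1: "csqrt (\<tau> * of_real (exp y)) = w * of_real (exp (y / 2))" for y
    unfolding w_def by (rule csqrt_exp_scale[OF \<tau>])
  have div: "\<tau> / of_real (exp x) = \<tau> * of_real (exp (- x))" by (simp add: exp_minus divide_inverse)
  have sq2: "csqrt (\<tau> / of_real (exp x)) = w * of_real (exp (- x / 2))" unfolding div sq1 by simp
  have sq3: "csqrt (of_real (exp x) / \<tau>) = 1 / w * of_real (exp (x / 2))"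
  proof -
    have "csqrt (1 / \<tau>) = 1 / w"
    proof (rule csqrt_unique)
      show "(1 / w)\<^sup>2 = 1 / \<tau>" by (simp add: w_def power_divide)
      show "0 < Re (1 / w) \<or> Re (1 / w) = 0 \<and> 0 \<le> Im (1 / w)" using Re_inverse_pos[OF w] by simp
    qed
    then show ?thesis using csqrt_exp_scale[OF Re_inverse_pos[OF \<tau>], of x] by simp
  qed
  have pw: "of_real (exp x) powr a = exp (a * of_real x)" for a :: complex
    using powr_times_exp[of 1 x a] by simp
  define T where "T = theta_conv P w \<nu>"
  define g where "g = gauss_conv w \<nu>"
  define m where "m = conv_main P w \<nu>"
  have S1: "sigma_bessel_sum P (2 * \<nu>) (csqrt (\<tau> * of_real (exp x))) = exp (- \<nu> * of_real (x / 2)) / 2 * (T x - g x)"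
    unfolding sq1 T_def g_def by (rule sigma_bessel_sum_eq(2)[OF P w])
  have S2: "sigma_bessel_sum P (2 * \<nu>) (csqrt (\<tau> / of_real (exp x))) = exp (- \<nu> * of_real (- x / 2)) / 2 * (T (- x) - g (- x))"
    unfolding sq2 T_def g_def by (rule sigma_bessel_sum_eq(2)[OF P w])
  have F: "calF P \<tau> \<beta> (exp x) = 1 / 2 * psi_lead P * w powr (1 / 2) * exp (- (\<beta> / 4) * of_real x) * completed_L P w (1 - \<beta>)"
    if "\<beta> \<noteq> 0" for \<beta>
  proof -
    have "calF P \<tau> \<beta> (exp x) = 1 / 2 * psi_lead P * (w * of_real (exp (- x / 2))) powr (\<beta> / 2) * (w powr ((1 - \<beta>) / 2) * completed_L P w (1 - \<beta>))"
      using w0 by (intro calF_eq[OF P(1,2,3) w that sq2]) auto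
    also have "(w * of_real (exp (- x / 2))) powr (\<beta> / 2) = w powr (\<beta> / 2) * exp (\<beta> / 2 * of_real (- x / 2))"
      by (rule powr_times_exp[OF w0])
    also have "\<beta> / 2 * of_real (- x / 2) = - (\<beta> / 4) * of_real x" by simp
    also have "1 / 2 * psi_lead P * (w powr (\<beta> / 2) * exp (- (\<beta> / 4) * of_real x)) * (w powr ((1 - \<beta>) / 2) * completed_L P w (1 - \<beta>))
      = 1 / 2 * psi_lead P * (w powr (\<beta> / 2) * w powr ((1 - \<beta>) / 2)) * exp (- (\<beta> / 4) * of_real x) * completed_L P w (1 - \<beta>)"
      by (simp only: mult_ac)
    also have "w powr (\<beta> / 2) * w powr ((1 - \<beta>) / 2) = w powr (1 / 2)"
      by (simp add: powr_add[symmetric] add_divide_distrib[symmetric])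
    finally show ?thesis .
  qed
  \<comment> \<open>For either sign the powers of w in \<open>calF\<close> combine to w^(1/2); the
    factor 1/w from the root of t / \<tau> lowers this to the w^(-1/2) in
    \<open>psi_sing_coeff\<close>.\<close>
  have main: "csqrt (of_real (exp x) / \<tau>) * (calF P \<tau> (2 * \<nu>) (exp x) + calF P \<tau> (- (2 * \<nu>)) (exp x)) = exp (\<nu> / 2 * of_real x) / 2 * m (- x)"
  proof -
    have lw: "1 / w * w powr (1 / 2) = w powr (- 1 / 2)"
    proof -
      have "w powr (- 1 / 2) * w = w powr (1 / 2)" using powr_add[of w "- 1 / 2" 1] w0 by simp
      then show ?thesis using w0 by (simp add: field_simps)
    qed
    have e: "of_real (exp (x / 2)) = exp (1 / 2 * complex_of_real x)"
      using exp_of_real[of "x / 2", where 'a = complex] by simp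
    have n: "2 * \<nu> \<noteq> 0" "- (2 * \<nu>) \<noteq> 0" using \<nu> by auto
    have "csqrt (of_real (exp x) / \<tau>) * (calF P \<tau> (2 * \<nu>) (exp x) + calF P \<tau> (- (2 * \<nu>)) (exp x)) =
      1 / 2 * (psi_lead P * (1 / w * w powr (1 / 2))) *
       ((exp (1 / 2 * of_real x) * exp (- (2 * \<nu> / 4) * of_real x)) * completed_L P w (1 - 2 * \<nu>)
        + (exp (1 / 2 * of_real x) * exp (- (- (2 * \<nu>) / 4) * of_real x)) * completed_L P w (1 - - (2 * \<nu>)))"
      unfolding F[OF n(1)] F[OF n(2)] sq3 e by (simp only: distrib_left distrib_right mult_ac)
    also have "exp (1 / 2 * of_real x) * exp (- (2 * \<nu> / 4) * of_real x) = exp (\<nu> / 2 * of_real x) * exp ((\<nu> - 1 / 2) * of_real (- x))"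
      by (simp add: mult_exp_exp algebra_simps)
    also have "exp (1 / 2 * of_real x) * exp (- (- (2 * \<nu>) / 4) * of_real x) = exp (\<nu> / 2 * of_real x) * exp (- 1 / 2 * of_real (- x))"
      by (simp add: mult_exp_exp algebra_simps)
    finally have main_calc: "csqrt (of_real (exp x) / \<tau>) * (calF P \<tau> (2 * \<nu>) (exp x) + calF P \<tau> (- (2 * \<nu>)) (exp x)) =
      1 / 2 * (psi_lead P * (1 / w * w powr (1 / 2))) *
       ((exp (\<nu> / 2 * of_real x) * exp ((\<nu> - 1 / 2) * of_real (- x))) * completed_L P w (1 - 2 * \<nu>)
        + (exp (\<nu> / 2 * of_real x) * exp (- 1 / 2 * of_real (- x))) * completed_L P w (1 - - (2 * \<nu>)))" .
    show ?thesis
    proof -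
      have sc: "psi_sing_coeff P w = psi_lead P * w powr (- 1 / 2)" by (rule psi_sing_coeff_def)
      have mx: "m (- x) = psi_sing_coeff P w * exp ((\<nu> - 1 / 2) * of_real (- x)) * completed_L P w (1 - 2 * \<nu>)
          + psi_sing_coeff P w * exp (- 1 / 2 * of_real (- x)) * completed_L P w (1 + 2 * \<nu>)"
        unfolding m_def by (rule conv_main_def)
      have gen: "1 / 2 * C * ((e * a) * d + (e * b) * d') = e / 2 * (C * a * d + C * b * d')" for C e a b d d' :: complex
        by (simp add: algebra_simps)
      show ?thesis unfolding main_calc lw mx sc diff_minus_eq_add by (rule gen)
    qed
  qed
  have "zeta_integrand P \<tau> (2 * \<nu>) s (exp x) =
     exp ((- (2 * \<nu>) / 4 + s / 2 - 1) * of_real x) *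
       (exp (- \<nu> * of_real (x / 2)) / 2 * (T x - g x) +
        exp ((2 * \<nu> / 2) * of_real x) / exp (s * of_real x) *
          (exp (- \<nu> * of_real (- x / 2)) / 2 * (T (- x) - g (- x)) - exp (\<nu> / 2 * of_real x) / 2 * m (- x)))"
    unfolding zeta_integrand_def pw S1 S2 main ..
  also have "\<dots> = (exp ((- (2 * \<nu>) / 4 + s / 2 - 1) * of_real x) * exp (- \<nu> * of_real (x / 2))) / 2 * (T x - g x) +
      (exp ((- (2 * \<nu>) / 4 + s / 2 - 1) * of_real x) * (exp ((2 * \<nu> / 2) * of_real x) * exp (- s * of_real x)) * exp (\<nu> / 2 * of_real x)) / 2 * (T (- x) - m (- x) - g (- x))"
  proof -
    have a: "exp ((2 * \<nu> / 2) * of_real x) / exp (s * of_real x) = exp ((2 * \<nu> / 2) * of_real x) * exp (- s * of_real x)"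
    proof -
      have "exp (- s * of_real x) = 1 / exp (s * of_real x)" by (simp add: exp_minus inverse_eq_divide)
      then show ?thesis by simp
    qed
    have b: "exp (- \<nu> * of_real (- x / 2)) = exp (\<nu> / 2 * of_real x)" by simp
    have gen: "A * (B / 2 * t1 + C * (D / 2 * (t2 - g2) - D / 2 * m2)) = (A * B) / 2 * t1 + (A * C * D) / 2 * (t2 - m2 - g2)"
      for A B C D t1 t2 g2 m2 :: complex by (simp add: field_simps)
    show ?thesis unfolding a b by (rule gen)
  qed
  also have "exp ((- (2 * \<nu>) / 4 + s / 2 - 1) * of_real x) * exp (- \<nu> * of_real (x / 2)) = exp (- of_real x) * exp ((s / 2 - \<nu>) * of_real x)"
    by (simp add: mult_exp_exp algebra_simps)
  also have "exp ((- (2 * \<nu>) / 4 + s / 2 - 1) * of_real x) * (exp ((2 * \<nu> / 2) * of_real x) * exp (- s * of_real x)) * exp (\<nu> / 2 * of_real x) = exp (- of_real x) * exp (- (s / 2 - \<nu>) * of_real x)"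
    by (simp add: mult_exp_exp algebra_simps)
  also have "exp (- of_real x) = complex_of_real (exp (- x))" using exp_of_real[of "- x"] by simp
  finally have fin: "zeta_integrand P \<tau> (2 * \<nu>) s (exp x) =
      (of_real (exp (- x)) * exp ((s / 2 - \<nu>) * of_real x)) / 2 * (T x - g x) +
      (of_real (exp (- x)) * exp (- (s / 2 - \<nu>) * of_real x)) / 2 * (T (- x) - m (- x) - g (- x))" .
  have gen: "(E * A) / 2 * a + (E * B) / 2 * b = E * ((A * a + B * b) / 2)" for E A B a b :: complex
    by (simp add: field_simps)
  show ?thesis
    unfolding folded_integrand_def w_def[symmetric] T_def[symmetric] g_def[symmetric] m_def[symmetric] fin by (rule gen)
qed

text \<open>Reflecting the second half restores \<open>mellin_left\<close>, and the two pieces of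
  the n = 1 term join to a transform over the whole line, a product of Gamma values.\<close>

lemma folded_integrand_integral:
  assumes P: "finite P" "\<And>q. q \<in> P \<Longrightarrow> prime q" "P \<noteq> {}" and w: "Re w > 0" and \<nu>: "\<nu> \<noteq> 0"
    and k: "Re k > 0" "Re (k + \<nu>) > 0"
  shows "set_integrable lborel {0..} (folded_integrand P w \<nu> k)"
    and "(LBINT x:{0..}. folded_integrand P w \<nu> k x) =
      (mellin_right P w \<nu> k + mellin_left P w \<nu> k - Gamma (k + \<nu>) * Gamma k * (of_real pi * w) powr (- (2 * k + \<nu>))) / 2"
proof -
  let ?r = "\<lambda>x. exp (k * of_real x) * (indicat_real {0..} x *\<^sub>R theta_conv P w \<nu> x)"
  let ?l = "\<lambda>x. exp (k * of_real x) * (indicat_real {..<0} x *\<^sub>R (theta_conv P w \<nu> x - conv_main P w \<nu> x))"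
  let ?g = "\<lambda>x. exp (k * of_real x) * gauss_conv w \<nu> x"
  let ?g1 = "\<lambda>x. indicat_real {0..} x *\<^sub>R ?g x" and ?g2 = "\<lambda>x. indicat_real {..<0} x *\<^sub>R ?g x"
  have [measurable]: "theta_conv P w \<nu> \<in> borel_measurable borel" by (rule theta_conv_measurable[OF P w])
  have [measurable]: "conv_main P w \<nu> \<in> borel_measurable borel" by (rule conv_main_measurable[OF P w])
  have [measurable]: "gauss_conv w \<nu> \<in> borel_measurable borel" by (rule gauss_conv_measurable[OF w])
  have [measurable]: "folded_integrand P w \<nu> k \<in> borel_measurable borel" unfolding folded_integrand_def[abs_def] by measurable
  have r: "integrable lborel ?r" by (rule theta_conv_right[OF P w])
  have l: "integrable lborel ?l" by (rule conv_rem_left[OF P w \<nu>])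
  have g: "integrable lborel ?g" by (rule gauss_conv_mellin(1)[OF w k])
  have g1: "integrable lborel ?g1" and g2: "integrable lborel ?g2"
    by (rule Bochner_Integration.integrable_bound[OF g]; auto simp: indicator_def)+
  have flip: "integrable lborel (\<lambda>x. f (0 + (- 1) * x))" "(\<integral>x. f (0 + (- 1) * x) \<partial>lborel) = (\<integral>x. f x \<partial>lborel)"
    if "integrable lborel f" for f :: "real \<Rightarrow> complex"
    using lborel_integrable_real_affine[OF that, of "- 1" 0] lborel_integral_real_affine[of "- 1" f 0] by simp_all
  let ?all = "\<lambda>x. ((?r x - ?g1 x) + (?l (0 + (- 1) * x) - ?g2 (0 + (- 1) * x))) / 2"
  have all: "integrable lborel ?all"
    by (intro integrable_divide_zero Bochner_Integration.integrable_add Bochner_Integration.integrable_diff r g1 flip(1)[OF l] flip(1)[OF g2])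
  \<comment> \<open>At x = 0 the strict and non-strict half-lines disagree; a single point is
    null.\<close>
  have ae: "AE x in lborel. ?all x = indicat_real {0..} x *\<^sub>R folded_integrand P w \<nu> k x"
    using AE_lborel_singleton[of 0]
  proof eventually_elim
    case (elim x)
    then show ?case by (cases "x > 0") (auto simp: folded_integrand_def indicator_def algebra_simps)
  qed
  show "set_integrable lborel {0..} (folded_integrand P w \<nu> k)"
    unfolding set_integrable_def by (rule integrable_cong_AE_imp[OF all _ ae]) measurable
  have "(LBINT x:{0..}. folded_integrand P w \<nu> k x) = (\<integral>x. ?all x \<partial>lborel)"
    unfolding set_lebesgue_integral_def
  proof (rule integral_cong_AE)
    show "?all \<in> borel_measurable lborel" using all by auto
    show "AE x in lborel. indicat_real {0..} x *\<^sub>R folded_integrand P w \<nu> k x = ?all x" using ae by eventually_elim simp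
  qed measurable
  also have "\<dots> = (((\<integral>x. ?r x \<partial>lborel) - (\<integral>x. ?g1 x \<partial>lborel)) + ((\<integral>x. ?l x \<partial>lborel) - (\<integral>x. ?g2 x \<partial>lborel))) / 2"
    by (simp only: integral_divide_zero Bochner_Integration.integral_add Bochner_Integration.integral_diff
        Bochner_Integration.integrable_add Bochner_Integration.integrable_diff r g1 flip[OF l] flip[OF g2])
  also have "(\<integral>x. ?r x \<partial>lborel) = mellin_right P w \<nu> k" by (rule mellin_right_def[symmetric])
  also have "(\<integral>x. ?l x \<partial>lborel) = mellin_left P w \<nu> k" by (rule mellin_left_def[symmetric])
  finally have "(LBINT x:{0..}. folded_integrand P w \<nu> k x) =
     (mellin_right P w \<nu> k + mellin_left P w \<nu> k - ((\<integral>x. ?g1 x \<partial>lborel) + (\<integral>x. ?g2 x \<partial>lborel))) / 2"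
    by (simp add: algebra_simps)
  moreover have "(\<integral>x. ?g1 x \<partial>lborel) + (\<integral>x. ?g2 x \<partial>lborel) = (\<integral>x. ?g x \<partial>lborel)"
    unfolding Bochner_Integration.integral_add[OF g1 g2, symmetric]
    by (intro Bochner_Integration.integral_cong refl) (auto simp: indicator_def)
  ultimately show "(LBINT x:{0..}. folded_integrand P w \<nu> k x) =
      (mellin_right P w \<nu> k + mellin_left P w \<nu> k - Gamma (k + \<nu>) * Gamma k * (of_real pi * w) powr (- (2 * k + \<nu>))) / 2"
    unfolding gauss_conv_mellin(2)[OF w k] by simp
qed

text \<open>A divergent \<open>infsum\<close> or set integral is 0 by convention, so summability for
  each t \<ge> 1 and integrability are proved along with the formula to give it its intended
  meaning.\<close>

theorem theorem3p2:
  fixes P :: "nat set" and \<tau> \<alpha> s :: complex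
  assumes "finite P" and "P \<noteq> {}" and "\<And>p. p \<in> P \<Longrightarrow> prime p"
    and "Re \<tau> > 0" and "\<alpha> \<noteq> 0"
    and "Re s > max 0 (Re \<alpha>)" and "s \<noteq> 1" and "s \<noteq> 1 + \<alpha>"
  shows "(\<forall>t\<ge>1. sigma_bessel_term \<alpha> (csqrt (\<tau> * of_real t)) summable_on coprime_indices P \<and>
                 sigma_bessel_term \<alpha> (csqrt (\<tau> / of_real t)) summable_on coprime_indices P) \<and>
         set_integrable lborel {1..} (zeta_integrand P \<tau> \<alpha> s) \<and>
         zeta s * zeta (s - \<alpha>) *
           (\<Prod>p\<in>P. (1 - 1 / of_nat p powr s) * (1 - 1 / of_nat p powr (s - \<alpha>))) =
         1 + of_real pi powr (s - \<alpha> / 2) * \<tau> powr (s / 2) / (Gamma (s / 2) * Gamma ((s - \<alpha>) / 2)) *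
           (\<tau> powr (- 1 / 2) / (s - 1) * calR P (1 - \<alpha>) +
            \<tau> powr (- (1 + \<alpha>) / 2) / (s - 1 - \<alpha>) * calR P (1 + \<alpha>) +
            2 * \<tau> powr (- \<alpha> / 4) * (LBINT t:{1..}. zeta_integrand P \<tau> \<alpha> s t))"
proof (intro conjI allI impI)
  define w where "w = csqrt \<tau>"
  define \<nu> where "\<nu> = \<alpha> / 2"
  \<comment> \<open>Then k = (s - \<alpha>)/2 and k + \<nu> = s/2, the arguments of the two Gamma
    factors.\<close>
  define k where "k = s / 2 - \<nu>"
  note P = assms(1,3,2)
  note \<tau> = assms(4)
  have \<alpha>: "\<alpha> = 2 * \<nu>" and \<nu>: "\<nu> \<noteq> 0" using assms(5) by (simp_all add: \<nu>_def)
  have w: "Re w > 0" unfolding w_def by (rule Re_csqrt_pos[OF \<tau>])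
  have w0: "w \<noteq> 0" using w by auto
  have re: "Re s > 0" "Re (s - \<alpha>) > 0" using assms(6) by auto
  have k\<nu>: "k + \<nu> = s / 2" "k = (s - \<alpha>) / 2" by (simp_all add: k_def \<alpha> diff_divide_distrib)
  have kre: "Re k > 0" "Re (k + \<nu>) > 0" 
    unfolding k\<nu>(1) using re by (simp_all add: k\<nu>(2))
  show "sigma_bessel_term \<alpha> (csqrt (\<tau> * of_real t)) summable_on coprime_indices P" if "1 \<le> t" for t
  proof -
    have "csqrt (\<tau> * of_real t) = w * of_real (exp (ln t / 2))"
      using csqrt_exp_scale[OF \<tau>, of "ln t"] that by (simp add: w_def)
    then show ?thesis unfolding \<alpha> by (simp only: sigma_bessel_sum_eq(1)[OF P w])
  qed
  show "sigma_bessel_term \<alpha> (csqrt (\<tau> / of_real t)) summable_on coprime_indices P" if "1 \<le> t" for t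
  proof -
    have "\<tau> * of_real (exp (- ln t)) = \<tau> / of_real t" using that by (simp add: exp_minus inverse_eq_divide)
    then have "csqrt (\<tau> / of_real t) = w * of_real (exp (- ln t / 2))"
      using csqrt_exp_scale[OF \<tau>, of "- ln t"] by (simp only: w_def)
    then show ?thesis unfolding \<alpha> by (simp only: sigma_bessel_sum_eq(1)[OF P w])
  qed
  have [measurable]: "theta_conv P w \<nu> \<in> borel_measurable borel" by (rule theta_conv_measurable[OF P w])
  have [measurable]: "conv_main P w \<nu> \<in> borel_measurable borel" by (rule conv_main_measurable[OF P w])
  have [measurable]: "gauss_conv w \<nu> \<in> borel_measurable borel" by (rule gauss_conv_measurable[OF w])
  have [measurable]: "folded_integrand P w \<nu> k \<in> borel_measurable borel" unfolding folded_integrand_def[abs_def] by measurable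
  \<comment> \<open>Agrees with the integrand on t \<ge> 1 and is visibly Borel measurable on the
    whole line, as the substitution requires.\<close>
  define f where "f = (\<lambda>t. of_real (1 / t) * folded_integrand P w \<nu> k (ln t))"
  have fm: "f \<in> borel_measurable borel" unfolding f_def by measurable
  have zf: "zeta_integrand P \<tau> \<alpha> s t = f t" if "t \<in> {1..}" for t
    using zeta_integrand_exp[OF P \<tau> \<nu>, of s "ln t"] that
    by (simp add: f_def \<alpha> w_def k_def exp_minus inverse_eq_divide)
  have im: "exp ` {0..} = {1::real..}" by (auto simp: exp_image_eq)
  have fe: "of_real (exp x) * f (exp x) = folded_integrand P w \<nu> k x" for x
    by (simp add: f_def)
  note sub = set_integral_exp_subst[OF fm, of "{0..}", unfolded im fe]
  note fold = folded_integrand_integral[OF P w \<nu> kre]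
  show "set_integrable lborel {1..} (zeta_integrand P \<tau> \<alpha> s)"
    using sub(1) fold(1) by (subst set_integrable_cong[OF refl refl zf]) auto
  have "(LBINT t:{1..}. zeta_integrand P \<tau> \<alpha> s t) = (LBINT t:{1..}. f t)"
    by (rule set_lebesgue_integral_cong) (auto simp: zf)
  also have "\<dots> = (LBINT x:{0..}. folded_integrand P w \<nu> k x)" using sub(2) fold(1) by simp
  finally have I0: "(LBINT t:{1..}. zeta_integrand P \<tau> \<alpha> s t) = (LBINT x:{0..}. folded_integrand P w \<nu> k x)" .
  have I: "(LBINT t:{1..}. zeta_integrand P \<tau> \<alpha> s t) =
     (mellin_right P w \<nu> k + mellin_left P w \<nu> k - Gamma (s / 2) * Gamma ((s - \<alpha>) / 2) * (of_real pi * w) powr (- (2 * k + \<nu>))) / 2"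
    by (simp only: I0 fold(2) k\<nu>(1) k\<nu>(2)[symmetric])
  define G where "G = Gamma (s / 2) * Gamma ((s - \<alpha>) / 2)"
  define D where "D = completed_L P w s * completed_L P w (s - \<alpha>)"
  define l where "l = psi_lead P"
  define D1 where "D1 = completed_L P w (1 - \<alpha>)"
  define D2 where "D2 = completed_L P w (1 + \<alpha>)"
  \<comment> \<open>Gathers all powers of pi and w: it is the prefactor of the formula times
    \<open>Y\<close>, and 1 / X is the power in the Gaussian transform.\<close>
  define X where "X = (of_real pi * w) powr (s - \<nu>)"
  have X0: "X \<noteq> 0" using w0 by (simp add: X_def)
  have "2 * k + \<nu> = s - \<nu>" by (simp add: k_def)
  then have Xi: "(of_real pi * w) powr (- (2 * k + \<nu>)) = 1 / X"
    by (simp only: X_def powr_minus inverse_eq_divide)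
  have nz: "s - 1 \<noteq> 0" "s - 1 - \<alpha> \<noteq> 0" using assms(7,8) by auto
  \<comment> \<open>The two excluded values of k correspond to s = 1 + \<alpha> and s = 1.\<close>
  have kne: "k \<noteq> 1 / 2" "k \<noteq> 1 / 2 - \<nu>" 
  proof -
    have se: "s = 2 * k + 2 * \<nu>" by (simp add: k_def)
    have "s = 1 + \<alpha>" if "k = 1 / 2" unfolding \<alpha> se that by simp
    moreover have "s = 1" if "k = 1 / 2 - \<nu>" unfolding se that by simp
    ultimately show "k \<noteq> 1 / 2" "k \<noteq> 1 / 2 - \<nu>" using assms(7,8) by blast+
  qed
  have M: "mellin_right P w \<nu> k + mellin_left P w \<nu> k
      + (l * w powr (- 1 / 2) * D1 / ((s - 1) / 2) + l * w powr (- 1 / 2) * D2 / ((s - 1 - \<alpha>) / 2)) = D"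
  proof -
    have e: "2 * (k + \<nu>) = s" "2 * k = s - \<alpha>" "k + \<nu> - 1 / 2 = (s - 1) / 2" "k - 1 / 2 = (s - 1 - \<alpha>) / 2"
      by (simp_all add: k_def \<alpha> field_simps)
    have sc: "psi_sing_coeff P w = l * w powr (- 1 / 2)" unfolding l_def by (rule psi_sing_coeff_def)
    show ?thesis
      using theta_conv_mellin[OF P w \<nu> kne] unfolding e sc by (simp only: D1_def D2_def D_def \<alpha>)
  qed
  have G0: "G \<noteq> 0"
  proof -
    have "s / 2 \<notin> \<int>\<^sub>\<le>\<^sub>0" "(s - \<alpha>) / 2 \<notin> \<int>\<^sub>\<le>\<^sub>0"
      using re by (auto elim!: nonpos_Ints_cases simp: complex_eq_iff)
    then show ?thesis by (simp add: G_def Gamma_eq_zero_iff)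
  qed
  have R: "calR P (1 - \<alpha>) = 2 * l * (w powr ((1 - \<alpha>) / 2) * D1)" "calR P (1 + \<alpha>) = 2 * l * (w powr ((1 + \<alpha>) / 2) * D2)"
    unfolding l_def D1_def D2_def using assms(5) by (intro calR_eq[OF P w]; simp)+
  have tp: "\<tau> powr a = w powr (2 * a)" for a
    unfolding w_def using \<tau> by (intro csqrt_powr) auto
  define Y where "Y = w powr (- \<nu>)"
  have t1: "\<tau> powr (- 1 / 2) * w powr ((1 - \<alpha>) / 2) = Y * w powr (- 1 / 2)"
    "\<tau> powr (- (1 + \<alpha>) / 2) * w powr ((1 + \<alpha>) / 2) = Y * w powr (- 1 / 2)"
    "\<tau> powr (- \<alpha> / 4) = Y"
  proof -
    have e: "2 * (- 1 / 2) + (1 - \<alpha>) / 2 = - \<nu> + - 1 / 2" "2 * (- (1 + \<alpha>) / 2) + (1 + \<alpha>) / 2 = - \<nu> + - 1 / 2" "2 * (- \<alpha> / 4) = - \<nu>"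
      by (simp_all add: \<alpha> field_simps)
    show "\<tau> powr (- 1 / 2) * w powr ((1 - \<alpha>) / 2) = Y * w powr (- 1 / 2)"
      "\<tau> powr (- (1 + \<alpha>) / 2) * w powr ((1 + \<alpha>) / 2) = Y * w powr (- 1 / 2)"
      "\<tau> powr (- \<alpha> / 4) = Y"
      by (simp_all only: tp Y_def powr_add[symmetric] e)
  qed
  have t2: "of_real pi powr (s - \<alpha> / 2) * \<tau> powr (s / 2) * Y = X"
  proof -
    have "w powr (2 * (s / 2)) * Y = w powr (s - \<nu>)" unfolding Y_def by (simp add: powr_add[symmetric])
    then show ?thesis unfolding tp X_def pi_powr_split[OF w0] by (simp add: \<alpha> mult.assoc)
  qed
  let ?b = "w powr (- 1 / 2)"
  let ?I = "LBINT t:{1..}. zeta_integrand P \<tau> \<alpha> s t"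
  have I': "2 * ?I = D - 2 * l * ?b * D1 / (s - 1) - 2 * l * ?b * D2 / (s - 1 - \<alpha>) - G / X"
  proof -
    have "2 * ?I = mellin_right P w \<nu> k + mellin_left P w \<nu> k - G / X"
      unfolding I Xi by (simp add: G_def)
    moreover have "c / (d / 2) = 2 * c / d" for c d :: complex by simp
    then have "mellin_right P w \<nu> k + mellin_left P w \<nu> k + (2 * (l * ?b * D1) / (s - 1) + 2 * (l * ?b * D2) / (s - 1 - \<alpha>)) = D"
      using M by (simp only:)
    then have "mellin_right P w \<nu> k + mellin_left P w \<nu> k = D - 2 * l * ?b * D1 / (s - 1) - 2 * l * ?b * D2 / (s - 1 - \<alpha>)"
      by (simp add: algebra_simps)
    ultimately show ?thesis by (simp only:)
  qed
  have "\<tau> powr (- 1 / 2) / (s - 1) * calR P (1 - \<alpha>) + \<tau> powr (- (1 + \<alpha>) / 2) / (s - 1 - \<alpha>) * calR P (1 + \<alpha>) + 2 * \<tau> powr (- \<alpha> / 4) * ?I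
    = 2 * l * D1 / (s - 1) * (\<tau> powr (- 1 / 2) * w powr ((1 - \<alpha>) / 2)) + 2 * l * D2 / (s - 1 - \<alpha>) * (\<tau> powr (- (1 + \<alpha>) / 2) * w powr ((1 + \<alpha>) / 2)) + \<tau> powr (- \<alpha> / 4) * (2 * ?I)"
    unfolding R by (simp only: mult_ac divide_inverse)
  \<comment> \<open>The polar terms inside the integral cancel both \<open>calR\<close> terms. What
    is left of the n = 1 term, -G / X, turns into -1 after multiplication by X / G and is balanced
    by the leading 1.\<close>
  also have "\<dots> = Y * (D - G / X)"
    unfolding t1 I' by (simp add: algebra_simps)
  finally have "of_real pi powr (s - \<alpha> / 2) * \<tau> powr (s / 2) / G *
      (\<tau> powr (- 1 / 2) / (s - 1) * calR P (1 - \<alpha>) + \<tau> powr (- (1 + \<alpha>) / 2) / (s - 1 - \<alpha>) * calR P (1 + \<alpha>) + 2 * \<tau> powr (- \<alpha> / 4) * ?I)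
      = (of_real pi powr (s - \<alpha> / 2) * \<tau> powr (s / 2) * Y) / G * (D - G / X)" by simp
  also have "\<dots> = X * D / G - 1" unfolding t2 using X0 G0 by (simp add: field_simps)
  finally have rhs: "1 + of_real pi powr (s - \<alpha> / 2) * \<tau> powr (s / 2) / G *
      (\<tau> powr (- 1 / 2) / (s - 1) * calR P (1 - \<alpha>) + \<tau> powr (- (1 + \<alpha>) / 2) / (s - 1 - \<alpha>) * calR P (1 + \<alpha>) + 2 * \<tau> powr (- \<alpha> / 4) * ?I) = X * D / G" by simp
  have "zeta s * zeta (s - \<alpha>) * (\<Prod>p\<in>P. (1 - 1 / of_nat p powr s) * (1 - 1 / of_nat p powr (s - \<alpha>))) =
     (zeta s * (\<Prod>p\<in>P. 1 - 1 / of_nat p powr s)) * (zeta (s - \<alpha>) * (\<Prod>p\<in>P. 1 - 1 / of_nat p powr (s - \<alpha>)))"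
    by (simp add: prod.distrib mult_ac)
  also have "\<dots> = ((of_real pi * w) powr (s / 2) * (of_real pi * w) powr ((s - \<alpha>) / 2)) * D / G"
  proof -
    have "s - \<alpha> \<noteq> 1" using assms(8) by (simp add: diff_eq_eq)
    from zeta_euler_eq[OF P w re(2) this] zeta_euler_eq[OF P w re(1) assms(7)]
    show ?thesis unfolding D_def G_def by (simp add: mult_ac)
  qed
  also have "(of_real pi * w) powr (s / 2) * (of_real pi * w) powr ((s - \<alpha>) / 2) = X"
  proof -
    have e: "s / 2 + (s - \<alpha>) / 2 = s - \<nu>" by (simp add: \<alpha> field_simps)
    show ?thesis by (simp only: X_def powr_add[symmetric] e)
  qed
  finally show "zeta s * zeta (s - \<alpha>) *
           (\<Prod>p\<in>P. (1 - 1 / of_nat p powr s) * (1 - 1 / of_nat p powr (s - \<alpha>))) =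
         1 + of_real pi powr (s - \<alpha> / 2) * \<tau> powr (s / 2) / (Gamma (s / 2) * Gamma ((s - \<alpha>) / 2)) *
           (\<tau> powr (- 1 / 2) / (s - 1) * calR P (1 - \<alpha>) +
            \<tau> powr (- (1 + \<alpha>) / 2) / (s - 1 - \<alpha>) * calR P (1 + \<alpha>) +
            2 * \<tau> powr (- \<alpha> / 4) * ?I)"
    using rhs unfolding G_def by simp
qed

end
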